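(* Let $\Sigma$ be a compact connected smooth surface with non-empty boundary and let $x:\Sigma\to\mathbb{B}^4$ be a minimal Lagrangian immersion with Legendrian free boundary on $\mathbb{S}^3$. Then $\Sigma$ is an equatorial plane disk, i.e. $\Sigma$ is a topological disk and $x(\Sigma)=\Pi\cap\mathbb{B}^4$ for some $2$-dimensional linear subspace $\Pi\subset\mathbb{R}^4$.
   Context: $\mathbb{R}^4=\mathbb{C}^2$ carries its standard Euclidean inner product $\langle\cdot,\cdot\rangle$ and standard orthogonal complex structure $J$. $\mathbb{B}^4$ is the closed unit ball and $\mathbb{S}^3=\partial\mathbb{B}^4$. An immersed surface $x:\Sigma\to\mathbb{B}^4$ is Lagrangian if $J T\Sigma=T^{\bot}\Sigma$ (the normal bundle in $\mathbb{R}^4$), and minimal if its mean curvature vector vanishes. It has Legendrian boundary on $\mathbb{S}^3$ if $x(\partial\Sigma)\subset\mathbb{S}^3$ and the vector $Jx(p)$ is orthogonal to $dx(T_p\partial\Sigma)$ at each $p\in\partial\Sigma$. In that case the unit outward normal $\nu$ of $\partial\Sigma$ in $\Sigma$ (tangent to $\Sigma$) lies in $\mathrm{span}\{x,Jx\}$ and is written $\nu=\sin\theta\, x+\cos\theta\, Jx$ with contact angle $\theta:\partial\Sigma\to[0,\pi)$. The boundary is Legendrian free boundary if $\theta\equiv\frac{\pi}{2}$, i.e. $\nu=x$ along $\partial\Sigma$. *)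

theory Defs
  imports "HOL-Analysis.Analysis"
begin

text \<open>For open \<open>S\<close> this is the usual class of \<open>k\<close> times continuously differentiable maps.\<close>

primrec Ck_on :: "nat \<Rightarrow> ('a::euclidean_space \<Rightarrow> 'b::real_normed_vector) \<Rightarrow> 'a set \<Rightarrow> bool"
  where
    "Ck_on 0 f S \<longleftrightarrow> continuous_on S f"
  | "Ck_on (Suc k) f S \<longleftrightarrow>
       (\<forall>x\<in>S. f differentiable (at x)) \<and>
       (\<forall>v. Ck_on k (\<lambda>x. frechet_derivative f (at x) v) S)"

text \<open>On an arbitrary set, smoothness means the existence of local smooth extensions.\<close>

definition smooth_on :: "'a set \<Rightarrow> ('a::euclidean_space \<Rightarrow> 'b::real_normed_vector) \<Rightarrow> bool"
  where "smooth_on A f \<longleftrightarrow>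
    (\<forall>a\<in>A. \<exists>V g. open V \<and> a \<in> V \<and> (\<forall>k. Ck_on k g V) \<and> (\<forall>u\<in>A \<inter> V. g u = f u))"


text \<open>A chart is a pair of its domain and its coordinate map, which takes values in the closed
  upper half-plane.\<close>

type_synonym 'p chart = "'p set \<times> ('p \<Rightarrow> real^2)"

definition half_plane :: "(real^2) set"
  where "half_plane = {u. 0 \<le> u $ 2}"

definition coord_image :: "'p chart \<Rightarrow> (real^2) set"
  where "coord_image c = snd c ` fst c"

definition coord_rep :: "'p chart \<Rightarrow> ('p \<Rightarrow> 'b) \<Rightarrow> real^2 \<Rightarrow> 'b"
  where "coord_rep c f = f \<circ> inv_into (fst c) (snd c)"

definition surface_chart :: "'p topology \<Rightarrow> 'p chart \<Rightarrow> bool"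
  where "surface_chart S c \<longleftrightarrow>
    openin S (fst c) \<and>
    openin (top_of_set half_plane) (coord_image c) \<and>
    homeomorphic_map (subtopology S (fst c)) (top_of_set (coord_image c)) (snd c)"

definition smoothly_compatible :: "'p chart \<Rightarrow> 'p chart \<Rightarrow> bool"
  where "smoothly_compatible c d \<longleftrightarrow> smooth_on (snd c ` (fst c \<inter> fst d)) (coord_rep c (snd d))"

definition smooth_surface :: "'p topology \<Rightarrow> 'p chart set \<Rightarrow> bool"
  where "smooth_surface S \<A> \<longleftrightarrow>
    Hausdorff_space S \<and> second_countable S \<and>
    (\<forall>c\<in>\<A>. surface_chart S c) \<and> (\<Union>c\<in>\<A>. fst c) = topspace S \<and>
    (\<forall>c\<in>\<A>. \<forall>d\<in>\<A>. smoothly_compatible c d)"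

definition surface_boundary :: "'p chart set \<Rightarrow> 'p set"
  where "surface_boundary \<A> = {p. \<exists>c\<in>\<A>. p \<in> fst c \<and> snd c p $ 2 = 0}"


text \<open>Four-space is \<open>complex^2\<close>, whose library inner product is the Euclidean one
  \<open>Re (z\<^sub>1 * cnj w\<^sub>1 + z\<^sub>2 * cnj w\<^sub>2)\<close>. Tangent vectors at a point are written in the coordinates
  of a chart \<open>c\<close> around it. The derivative is taken within the coordinate image, so that it is also
  the right one at boundary points.\<close>

definition complex_structure :: "complex^2 \<Rightarrow> complex^2"  (\<open>\<J>\<close>)
  where "\<J> v = \<i> *s v"

definition differential ::
    "'p chart \<Rightarrow> ('p \<Rightarrow> 'b::real_normed_vector) \<Rightarrow> 'p \<Rightarrow> real^2 \<Rightarrow> 'b"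
  where "differential c f p = frechet_derivative (coord_rep c f) (at (snd c p) within coord_image c)"

definition tangent_plane :: "'p chart \<Rightarrow> ('p \<Rightarrow> complex^2) \<Rightarrow> 'p \<Rightarrow> (complex^2) set"
  where "tangent_plane c x p = range (differential c x p)"

definition immersion :: "'p chart set \<Rightarrow> ('p \<Rightarrow> complex^2) \<Rightarrow> bool"
  where "immersion \<A> x \<longleftrightarrow>
    (\<forall>c\<in>\<A>. smooth_on (coord_image c) (coord_rep c x) \<and>
            (\<forall>p\<in>fst c. inj (differential c x p)))"

definition lagrangian :: "'p chart set \<Rightarrow> ('p \<Rightarrow> complex^2) \<Rightarrow> bool"
  where "lagrangian \<A> x \<longleftrightarrow>
    (\<forall>c\<in>\<A>. \<forall>p\<in>fst c. \<J> ` tangent_plane c x p = orthogonal_comp (tangent_plane c x p))"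

definition normal_part :: "(complex^2) set \<Rightarrow> complex^2 \<Rightarrow> complex^2"
  where "normal_part T v = (THE n. n \<in> orthogonal_comp T \<and> v - n \<in> T)"

definition first_fundamental_form :: "'p chart \<Rightarrow> ('p \<Rightarrow> complex^2) \<Rightarrow> 'p \<Rightarrow> real^2^2"
  where "first_fundamental_form c x p =
    (\<chi> i j. differential c x p (axis i 1) \<bullet> differential c x p (axis j 1))"

definition second_fundamental_form ::
    "'p chart \<Rightarrow> ('p \<Rightarrow> complex^2) \<Rightarrow> 'p \<Rightarrow> real^2 \<Rightarrow> real^2 \<Rightarrow> complex^2"
  where "second_fundamental_form c x p v w =
    normal_part (tangent_plane c x p) (differential c (\<lambda>q. differential c x q w) p v)"

text \<open>Half the trace of the second fundamental form with respect to the induced metric.\<close>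

definition mean_curvature_vector :: "'p chart \<Rightarrow> ('p \<Rightarrow> complex^2) \<Rightarrow> 'p \<Rightarrow> complex^2"
  where "mean_curvature_vector c x p =
    (1/2) *\<^sub>R (\<Sum>i\<in>UNIV. \<Sum>j\<in>UNIV. matrix_inv (first_fundamental_form c x p) $ i $ j *\<^sub>R
      second_fundamental_form c x p (axis i 1) (axis j 1))"

definition minimal :: "'p chart set \<Rightarrow> ('p \<Rightarrow> complex^2) \<Rightarrow> bool"
  where "minimal \<A> x \<longleftrightarrow> (\<forall>c\<in>\<A>. \<forall>p\<in>fst c. mean_curvature_vector c x p = 0)"


text \<open>In the coordinates of a chart, the vectors tangent to the boundary are those with vanishing
  second component, and the outward pointing ones are those with negative second component.\<close>

definition legendrian_boundary :: "'p chart set \<Rightarrow> ('p \<Rightarrow> complex^2) \<Rightarrow> bool"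
  where "legendrian_boundary \<A> x \<longleftrightarrow>
    x ` surface_boundary \<A> \<subseteq> sphere 0 1 \<and>
    (\<forall>c\<in>\<A>. \<forall>p\<in>fst c \<inter> surface_boundary \<A>. \<forall>w. w $ 2 = 0 \<longrightarrow>
       orthogonal (\<J> (x p)) (differential c x p w))"

definition outward_unit_normal :: "'p chart \<Rightarrow> ('p \<Rightarrow> complex^2) \<Rightarrow> 'p \<Rightarrow> complex^2"
  where "outward_unit_normal c x p =
    (THE \<nu>. norm \<nu> = 1 \<and> (\<exists>w. w $ 2 < 0 \<and> \<nu> = differential c x p w) \<and>
            (\<forall>w. w $ 2 = 0 \<longrightarrow> orthogonal \<nu> (differential c x p w)))"

definition has_contact_angle :: "'p chart set \<Rightarrow> ('p \<Rightarrow> complex^2) \<Rightarrow> ('p \<Rightarrow> real) \<Rightarrow> bool"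
  where "has_contact_angle \<A> x \<theta> \<longleftrightarrow>
    (\<forall>c\<in>\<A>. \<forall>p\<in>fst c \<inter> surface_boundary \<A>. 0 \<le> \<theta> p \<and> \<theta> p < pi \<and>
       outward_unit_normal c x p = sin (\<theta> p) *\<^sub>R x p + cos (\<theta> p) *\<^sub>R \<J> (x p))"

definition legendrian_free_boundary :: "'p chart set \<Rightarrow> ('p \<Rightarrow> complex^2) \<Rightarrow> bool"
  where "legendrian_free_boundary \<A> x \<longleftrightarrow>
    legendrian_boundary \<A> x \<and> has_contact_angle \<A> x (\<lambda>p. pi / 2)"

end

theory Submission
  imports Defs "HOL-Complex_Analysis.Conformal_Mappings"
begin

text \<open>
  A minimal Lagrangian surface has locally constant Lagrangian angle. After a rotation, the surface
  is therefore locally a holomorphic curve \<open>\<eta> = g(\<zeta>)\<close> for a complex structure orthogonal to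
  \<open>\<J>\<close>, and the position vector is tangent to the surface exactly where the holomorphic function
  \<open>g(\<zeta>) - g'(\<zeta>) \<zeta>\<close> vanishes. The free boundary condition \<open>\<nu> = x\<close> makes the position vector
  tangent along the boundary, hence everywhere by unique continuation. So \<open>g\<close> is locally linear, the
  tangent plane is a constant plane \<open>P\<close>, and \<open>x\<close> maps the surface into \<open>P \<inter> cball 0 1\<close>. This map is open
  (also at the boundary) and locally injective, so by compactness it is a covering of a disc, and
  thus a homeomorphism.
\<close>

section \<open>Unique continuation from zeros of a continuous function\<close>

text \<open>The obstacle is the boundary. Its image under \<zeta> is merely a smooth curve, so
  neither reflection nor power series help there, and vanishing along the curve has to be turned
  into vanishing on an open set. Extension by zero across the curve yields a continuous function
  that is holomorphic off its zeros and vanishes on one side; the rotation argument below handles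
  any such function without information on the shape of its zero set. The same continuation lemma
  then serves boundary and interior points. The function g - g' \<zeta> appears because the tangent
  plane is the complex line of slope g' through the origin; once it vanishes, differentiation leaves
  g'' \<zeta> = 0, so the slope is constant. The angle is locally constant because its differential
  is a trace of the second fundamental form, that is, the mean curvature seen through \<J>.
  Injectivity over the disc uses the radial contraction of the ball and local inverses of uniform
  size in place of path lifting.\<close>

lemma root_of_unity_rotation_near:
  assumes "cmod w = cmod v" and "n > 0" and "2 * pi * cmod w / real n < e"
  shows "\<exists>k<n. cmod (cis (2 * pi * real k / real n) * w - v) < e"
proof -
  define r where "r = cmod w"
  define N where "N = real n"
  have N: "N > 0" using assms(2) by (simp add: N_def)
  obtain s where w: "w = complex_of_real r * cis s" by (metis r_def rcis_cmod_Arg rcis_def)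
  obtain t where v: "v = complex_of_real r * cis t" by (metis assms(1) r_def rcis_cmod_Arg rcis_def)
  \<comment> \<open>The number of rotation steps from angle \<open>s\<close> to angle
    \<open>t\<close>, rounded down, so that the error \<open>d\<close> is at most one step. It may
    be negative or exceed \<open>n\<close>; reduction modulo \<open>n\<close> drops full turns
    only.\<close>
  define m where "m = \<lfloor>N * (t - s) / (2 * pi)\<rfloor>"
  define k where "k = nat (m mod int n)"
  define q where "q = m div int n"
  have kn: "k < n" using assms(2) by (simp add: k_def nat_less_iff)
  have m: "real_of_int m = real k + N * real_of_int q"
  proof -
    have "m = int k + int n * q" using assms(2) by (simp add: k_def q_def)
    then show ?thesis by (simp add: N_def)
  qed
  define d where "d = 2 * pi * real_of_int m / N + s - t"
  have d: "\<bar>d\<bar> \<le> 2 * pi / N"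
  proof -
    have "real_of_int m \<le> N * (t - s) / (2 * pi)" "N * (t - s) / (2 * pi) < real_of_int m + 1"
      unfolding m_def by linarith+
    then have "real_of_int m * (2 * pi) \<le> N * (t - s)" "N * (t - s) \<le> (real_of_int m + 1) * (2 * pi)"
      by (simp_all add: field_simps)
    moreover have "d * N = 2 * pi * real_of_int m - N * (t - s)"
      using N by (simp add: d_def field_simps)
    ultimately have "\<bar>d * N\<bar> \<le> 2 * pi" by (simp add: field_simps abs_if)
    then show ?thesis using N by (simp add: abs_mult field_simps)
  qed
  have cis_d: "cis (2 * pi * real k / N + s) = cis (t + d)"
  proof -
    have "t + d = (2 * pi * real k / N + s) + 2 * pi * real_of_int q"
      using N by (simp add: d_def m field_simps)
    then have "cis (t + d) = cis (2 * pi * real k / N + s) * cis (2 * pi * real_of_int q)"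
      by (simp only: cis_mult)
    moreover have "cis (2 * pi * real_of_int q) = 1"
      by (rule cis_multiple_2pi) simp
    ultimately show ?thesis by simp
  qed
  have "cis (2 * pi * real k / N) * w - v = complex_of_real r * (cis (t + d) - cis t)"
    unfolding w v cis_d[symmetric] by (simp add: cis_mult[symmetric] algebra_simps)
  also have "\<dots> = complex_of_real r * cis t * (cis d - 1)"
    by (simp add: cis_mult[symmetric] algebra_simps)
  finally have "cmod (cis (2 * pi * real k / N) * w - v) = r * cmod (cis d - 1)"
    by (simp add: norm_mult r_def)
  also have "cmod (cis d - 1) \<le> \<bar>d\<bar>"
  proof -
    have "cmod (exp (\<i> * complex_of_real d) - 1) = 2 * \<bar>sin (d / 2)\<bar>"
      using norm_exp_i_times dist_exp_i_1[of d] by (simp add: dist_norm)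
    also have "\<dots> \<le> 2 * \<bar>d / 2\<bar>" using abs_sin_x_le_abs_x[of "d/2"] by linarith
    finally show ?thesis by (simp add: cis_conv_exp mult.commute)
  qed
  then have "r * cmod (cis d - 1) \<le> r * (2 * pi / N)"
    using d by (intro mult_left_mono) (auto simp: r_def)
  also have "\<dots> < e" using assms(3) by (simp add: r_def N_def algebra_simps)
  finally show ?thesis using kn by (auto simp: N_def)
qed

text \<open>The product of the functions \<open>z \<mapsto> f (c + \<omega>\<^sup>k (z - c))\<close> over the powers of a root of unity \<open>\<omega>\<close>
  vanishes on the whole circle as soon as \<open>f\<close> vanishes on an arc of it, and the maximum principle
  applies on the set where the product is nonzero.\<close>

lemma zero_by_rotation:
  fixes f :: "complex \<Rightarrow> complex"
  assumes cont: "continuous_on U f" and U: "open U"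
    and holo: "f holomorphic_on {z \<in> U. f z \<noteq> 0}"
    and zero: "\<And>z. z \<in> ball a e \<Longrightarrow> f z = 0" and e: "e > 0"
    and sub: "cball c (dist a c) \<subseteq> U"
  shows "f c = 0"
proof (rule ccontr)
  assume fc: "f c \<noteq> 0"
  define r where "r = dist a c"
  have "r > 0" using fc zero e by (auto simp: r_def)
  \<comment> \<open>With this many steps, the step length on the circle of radius \<open>r\<close>
    is below \<open>e\<close>, so every point of that circle is rotated into \<open>ball a e\<close>
    by some power.\<close>
  obtain n :: nat where n: "2 * pi * r / e < real n" using reals_Archimedean2 by blast
  have "n > 0" using n \<open>r > 0\<close> e by (cases n) (auto simp: divide_less_0_iff mult_less_0_iff)
  have n': "2 * pi * r / real n < e" using n e \<open>n > 0\<close> by (simp add: field_simps)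
  define R where "R k z = c + cis (2 * pi * real k / real n) * (z - c)" for k z
  define H where "H z = (\<Prod>k<n. f (R k z))" for z
  define S where "S = {z \<in> ball c r. H z \<noteq> 0}"
  have Rd: "dist c (R k z) = dist c z" for k z
    by (simp add: R_def dist_norm norm_mult norm_minus_commute)
  have contH: "continuous_on (cball c r) H"
  proof -
    have "continuous_on (cball c r) (\<lambda>z. f (R k z))" for k
    proof (rule continuous_on_compose2[OF cont])
      show "continuous_on (cball c r) (R k)" unfolding R_def by (intro continuous_intros)
      show "R k ` cball c r \<subseteq> U" using sub Rd unfolding r_def by auto
    qed
    then show ?thesis unfolding H_def by (intro continuous_intros)
  qed
  have contH': "continuous_on (ball c r) H" using contH by (rule continuous_on_subset) auto
  have "open S"
  proof -
    have "open (ball c r \<inter> H -` (- {0}))"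
      by (rule continuous_open_preimage[OF contH']) auto
    moreover have "S = ball c r \<inter> H -` (- {0})" by (auto simp: S_def)
    ultimately show ?thesis by simp
  qed
  have "H holomorphic_on S" unfolding H_def
  proof (rule holomorphic_on_prod)
    fix k assume k: "k \<in> {..<n}"
    have "f \<circ> R k holomorphic_on S"
    proof (rule holomorphic_on_compose_gen[OF _ holo])
      show "R k holomorphic_on S" unfolding R_def by (intro holomorphic_intros)
      show "R k ` S \<subseteq> {z \<in> U. f z \<noteq> 0}"
      proof clarify
        fix z assume z: "z \<in> S"
        then have "R k z \<in> U" using sub Rd[of k z] by (auto simp: S_def r_def subset_iff)
        moreover have "f (R k z) \<noteq> 0" using z k unfolding S_def H_def by auto
        ultimately show "R k z \<in> U \<and> f (R k z) \<noteq> 0" by simp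
      qed
    qed
    then show "(\<lambda>z. f (R k z)) holomorphic_on S" by (simp add: o_def)
  qed
  moreover have clS: "closure S \<subseteq> cball c r"
    by (rule closure_minimal) (auto simp: S_def)
  \<comment> \<open>On the frontier of \<open>S\<close> the product vanishes: inside the disc by
    definition of \<open>S\<close>, on the circle because one factor is evaluated in
    \<open>ball a e\<close>. At the centre all factors equal \<open>f c\<close>, since every
    rotation fixes \<open>c\<close>.\<close>
  have "cmod (H c) \<le> 0"
  proof (rule maximum_modulus_frontier[of H S])
    show "H holomorphic_on interior S" using \<open>open S\<close> calculation by (simp add: interior_open)
    show "continuous_on (closure S) H" using contH clS continuous_on_subset by blast
    show "bounded S" by (rule bounded_subset[of "ball c r"]) (auto simp: S_def)
    have "H c = f c ^ n" by (simp add: H_def R_def)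
    then show "c \<in> S" using fc \<open>r > 0\<close> by (simp add: S_def)
    fix z assume "z \<in> frontier S"
    then have z: "z \<in> closure S" "z \<notin> S" using \<open>open S\<close> by (auto simp: frontier_def interior_open)
    then have zc: "z \<in> cball c r" using clS by auto
    show "cmod (H z) \<le> 0"
    proof (cases "z \<in> ball c r")
      case True then show ?thesis using z by (simp add: S_def)
    next
      case False
      then have "cmod (z - c) = cmod (a - c)" using zc by (simp add: dist_norm norm_minus_commute r_def)
      moreover have "2 * pi * cmod (z - c) / real n < e"
        using n' calculation by (simp add: r_def dist_norm)
      ultimately obtain k where k: "k < n" "cmod (cis (2 * pi * real k / real n) * (z - c) - (a - c)) < e"
        using root_of_unity_rotation_near \<open>n > 0\<close> by blast
      then have "f (R k z) = 0"
        by (intro zero) (simp add: R_def dist_norm norm_minus_commute algebra_simps)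
      then have "H z = 0" using k(1) unfolding H_def by auto
      then show ?thesis by simp
    qed
  qed
  moreover have "H c = f c ^ n" by (simp add: H_def R_def)
  ultimately show False using fc by simp
qed

text \<open>Every point \<open>c\<close> near \<open>z0\<close> is the centre of a circle inside
  \<open>U\<close> through the centre of a zero ball. The radius obtained depends on
  \<open>U\<close> only and not on the size of that zero ball, which is what makes the interior of
  the zero set relatively closed.\<close>

lemma zero_near_limit_of_zero_balls:
  fixes f :: "complex \<Rightarrow> complex"
  assumes cont: "continuous_on U f" and U: "open U" "z0 \<in> U"
    and holo: "f holomorphic_on {z \<in> U. f z \<noteq> 0}"
    and acc: "\<And>\<delta>. \<delta> > 0 \<Longrightarrow> \<exists>a e. e > 0 \<and> a \<in> ball z0 \<delta> \<and> (\<forall>z\<in>ball a e. f z = 0)"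
  shows "\<exists>d>0. \<forall>z\<in>ball z0 d. f z = 0"
proof -
  obtain \<rho> where \<rho>: "\<rho> > 0" "ball z0 \<rho> \<subseteq> U" using U open_contains_ball by blast
  \<comment> \<open>A quarter suffices: for \<open>a\<close> and \<open>c\<close> within \<rho>/4 of
    \<open>z0\<close>, the disc about \<open>c\<close> through \<open>a\<close> stays within
    3\<rho>/4 of \<open>z0\<close>.\<close>
  obtain a e where a: "e > 0" "a \<in> ball z0 (\<rho>/4)" "\<forall>z\<in>ball a e. f z = 0"
    using acc[of "\<rho>/4"] \<rho>(1) by auto
  have "f c = 0" if c: "c \<in> ball z0 (\<rho>/4)" for c
  proof (rule zero_by_rotation[OF cont U(1) holo _ a(1)])
    show "cball c (dist a c) \<subseteq> U"
    proof
      fix z assume "z \<in> cball c (dist a c)"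
      moreover have "dist a c \<le> dist z0 a + dist z0 c" by (metis dist_commute dist_triangle)
      moreover have "dist z0 z \<le> dist z0 c + dist c z" by (rule dist_triangle)
      moreover have "dist z0 a < \<rho>/4" "dist z0 c < \<rho>/4" using a(2) c by auto
      ultimately have "dist z0 z < \<rho>" using \<rho>(1) by simp
      then show "z \<in> U" using \<rho>(2) by auto
    qed
  qed (use a in auto)
  then show ?thesis using \<rho>(1) by (intro exI[of _ "\<rho>/4"]) auto
qed

section \<open>Mixed derivatives and the inverse function theorem\<close>

text \<open>The mean value theorem is applied twice: along \<open>v\<close> to the increment of
  \<open>f\<close> in direction \<open>w\<close>, then along \<open>w\<close> to the derivative of
  \<open>f\<close> in direction \<open>v\<close>.\<close>

lemma mixed_difference_mean_value:
  fixes f :: "'a::real_normed_vector \<Rightarrow> real"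
  assumes h: "h > 0" and V: "\<And>s t. 0 \<le> s \<Longrightarrow> s \<le> h \<Longrightarrow> 0 \<le> t \<Longrightarrow> t \<le> h \<Longrightarrow> x + s *\<^sub>R v + t *\<^sub>R w \<in> V"
    and f: "\<And>u. u \<in> V \<Longrightarrow> (f has_derivative f' u) (at u)"
    and fv: "\<And>u. u \<in> V \<Longrightarrow> ((\<lambda>u. f' u v) has_derivative fv u) (at u)"
  shows "\<exists>s t. 0 < s \<and> s < h \<and> 0 < t \<and> t < h \<and>
    f (x + h *\<^sub>R v + h *\<^sub>R w) - f (x + h *\<^sub>R v) - f (x + h *\<^sub>R w) + f x =
      h * h * fv (x + s *\<^sub>R v + t *\<^sub>R w) w"
proof -
  have dv: "((\<lambda>s. f (x + s *\<^sub>R v + t *\<^sub>R w)) has_real_derivative f' (x + s *\<^sub>R v + t *\<^sub>R w) v) (at s)"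
    if "0 \<le> s" "s \<le> h" "0 \<le> t" "t \<le> h" for s t
  proof -
    have *: "((\<lambda>s. x + s *\<^sub>R v + t *\<^sub>R w) has_derivative (\<lambda>d. d *\<^sub>R v)) (at s)"
      by (auto intro!: derivative_eq_intros)
    have "((\<lambda>s. f (x + s *\<^sub>R v + t *\<^sub>R w)) has_derivative (\<lambda>d. f' (x + s *\<^sub>R v + t *\<^sub>R w) (d *\<^sub>R v))) (at s)"
      using has_derivative_compose[OF * f[OF V[OF that]]] .
    moreover have "linear (f' (x + s *\<^sub>R v + t *\<^sub>R w))"
      using f[OF V[OF that]] has_derivative_linear by blast
    ultimately show ?thesis
      by (simp add: has_field_derivative_def linear_scale mult_commute_abs)
  qed
  have dw: "((\<lambda>t. f' (x + s *\<^sub>R v + t *\<^sub>R w) v) has_real_derivative fv (x + s *\<^sub>R v + t *\<^sub>R w) w) (at t)"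
    if "0 \<le> s" "s \<le> h" "0 \<le> t" "t \<le> h" for s t
  proof -
    have *: "((\<lambda>t. x + s *\<^sub>R v + t *\<^sub>R w) has_derivative (\<lambda>d. d *\<^sub>R w)) (at t)"
      by (auto intro!: derivative_eq_intros)
    have "((\<lambda>t. f' (x + s *\<^sub>R v + t *\<^sub>R w) v) has_derivative (\<lambda>d. fv (x + s *\<^sub>R v + t *\<^sub>R w) (d *\<^sub>R w))) (at t)"
      using has_derivative_compose[OF * fv[OF V[OF that]]] .
    moreover have "linear (fv (x + s *\<^sub>R v + t *\<^sub>R w))"
      using fv[OF V[OF that]] has_derivative_linear by blast
    ultimately show ?thesis
      by (simp add: has_field_derivative_def linear_scale mult_commute_abs)
  qed
  define A where "A s = f (x + s *\<^sub>R v + h *\<^sub>R w) - f (x + s *\<^sub>R v + 0 *\<^sub>R w)" for s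
  have "\<exists>s>0. s < h \<and> A h - A 0 = (h - 0) * (f' (x + s *\<^sub>R v + h *\<^sub>R w) v - f' (x + s *\<^sub>R v + 0 *\<^sub>R w) v)"
    unfolding A_def using h by (intro MVT2 DERIV_diff dv) auto
  then obtain s where s: "0 < s" "s < h"
    "A h - A 0 = h * (f' (x + s *\<^sub>R v + h *\<^sub>R w) v - f' (x + s *\<^sub>R v + 0 *\<^sub>R w) v)" by auto
  have "\<exists>t>0. t < h \<and> f' (x + s *\<^sub>R v + h *\<^sub>R w) v - f' (x + s *\<^sub>R v + 0 *\<^sub>R w) v
      = (h - 0) * fv (x + s *\<^sub>R v + t *\<^sub>R w) w"
    using h s by (intro MVT2 dw) auto
  then obtain t where "0 < t" "t < h"
    "f' (x + s *\<^sub>R v + h *\<^sub>R w) v - f' (x + s *\<^sub>R v + 0 *\<^sub>R w) v = h * fv (x + s *\<^sub>R v + t *\<^sub>R w) w" by auto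
  then show ?thesis using s unfolding A_def by (intro exI[of _ s] exI[of _ t]) (simp add: algebra_simps)
qed

text \<open>The second difference over a small parallelogram is symmetric in \<open>v\<close> and
  \<open>w\<close>; evaluating it in both orders gives equal values of the two mixed derivatives at
  points close to \<open>x\<close>, and continuity concludes.\<close>

lemma second_derivative_symmetric_real:
  fixes f :: "'a::real_normed_vector \<Rightarrow> real"
  assumes V: "open V" "x \<in> V"
    and f: "\<And>u. u \<in> V \<Longrightarrow> (f has_derivative f' u) (at u)"
    and fv: "\<And>u. u \<in> V \<Longrightarrow> ((\<lambda>u. f' u v) has_derivative fv u) (at u)"
    and fw: "\<And>u. u \<in> V \<Longrightarrow> ((\<lambda>u. f' u w) has_derivative fw u) (at u)"
    and cv: "continuous_on V (\<lambda>u. fv u w)" and cw: "continuous_on V (\<lambda>u. fw u v)"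
  shows "fv x w = fw x v"
proof (rule ccontr)
  assume ne: "fv x w \<noteq> fw x v"
  define e where "e = \<bar>fv x w - fw x v\<bar> / 2"
  have e: "e > 0" using ne by (simp add: e_def)
  have "continuous (at x) (\<lambda>u. fv u w)" "continuous (at x) (\<lambda>u. fw u v)"
    using cv cw V continuous_on_eq_continuous_at by blast+
  then obtain d1 d2 where d: "d1 > 0" "\<And>u. dist u x < d1 \<Longrightarrow> \<bar>fv u w - fv x w\<bar> < e"
     "d2 > 0" "\<And>u. dist u x < d2 \<Longrightarrow> \<bar>fw u v - fw x v\<bar> < e"
    using e unfolding continuous_at_eps_delta dist_real_def by metis
  obtain d3 where d3: "d3 > 0" "ball x d3 \<subseteq> V" using V open_contains_ball by blast
  define d where "d = min d1 (min d2 d3)"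
  \<comment> \<open>Small enough for the whole parallelogram to lie within distance \<open>d\<close>
    of \<open>x\<close>; the summand 1 keeps the denominator positive when \<open>v\<close> and
    \<open>w\<close> are zero.\<close>
  define h where "h = d / (2 * (norm v + norm w + 1))"
  have pos: "norm v + norm w + 1 > 0" by (simp add: add_nonneg_pos)
  have h: "h > 0" using d(1,3) d3(1) pos by (simp add: h_def d_def)
  have near: "dist (x + s *\<^sub>R v + t *\<^sub>R w) x < d" if "0 \<le> s" "s \<le> h" "0 \<le> t" "t \<le> h" for s t
  proof -
    have "dist (x + s *\<^sub>R v + t *\<^sub>R w) x \<le> s * norm v + t * norm w"
      using that norm_triangle_ineq[of "s *\<^sub>R v" "t *\<^sub>R w"] by (simp add: dist_norm)
    also have "\<dots> \<le> h * norm v + h * norm w" using that by (intro add_mono mult_right_mono) auto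
    also have "\<dots> < h * (2 * (norm v + norm w + 1))"
      using h pos by (simp add: algebra_simps add_pos_nonneg add_nonneg_pos)
    also have "\<dots> = d" using pos by (simp add: h_def)
    finally show ?thesis .
  qed
  have V1: "x + s *\<^sub>R v + t *\<^sub>R w \<in> V" if "0 \<le> s" "s \<le> h" "0 \<le> t" "t \<le> h" for s t
    using near[OF that] d3(2) by (auto simp: d_def dist_commute)
  have V2: "x + s *\<^sub>R w + t *\<^sub>R v \<in> V" if "0 \<le> s" "s \<le> h" "0 \<le> t" "t \<le> h" for s t
    using V1[OF that(3,4,1,2)] by (simp add: algebra_simps)
  obtain s t where st: "0 < s" "s < h" "0 < t" "t < h"
     "f (x + h *\<^sub>R v + h *\<^sub>R w) - f (x + h *\<^sub>R v) - f (x + h *\<^sub>R w) + f x = h * h * fv (x + s *\<^sub>R v + t *\<^sub>R w) w"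
    using mixed_difference_mean_value[OF h V1 f fv] by blast
  obtain s' t' where st': "0 < s'" "s' < h" "0 < t'" "t' < h"
     "f (x + h *\<^sub>R w + h *\<^sub>R v) - f (x + h *\<^sub>R w) - f (x + h *\<^sub>R v) + f x = h * h * fw (x + s' *\<^sub>R w + t' *\<^sub>R v) v"
    using mixed_difference_mean_value[OF h V2 f fw] by blast
  have "x + h *\<^sub>R w + h *\<^sub>R v = x + h *\<^sub>R v + h *\<^sub>R w" by simp
  then have "h * h * fv (x + s *\<^sub>R v + t *\<^sub>R w) w = h * h * fw (x + s' *\<^sub>R w + t' *\<^sub>R v) v"
    using st(5) st'(5)[unfolded \<open>x + h *\<^sub>R w + h *\<^sub>R v = x + h *\<^sub>R v + h *\<^sub>R w\<close>] by linarith
  then have "fv (x + s *\<^sub>R v + t *\<^sub>R w) w = fw (x + t' *\<^sub>R v + s' *\<^sub>R w) v"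
    using h by (simp add: algebra_simps)
  moreover have "\<bar>fv (x + s *\<^sub>R v + t *\<^sub>R w) w - fv x w\<bar> < e"
    using near[of s t] st by (intro d(2)) (auto simp: d_def)
  moreover have "\<bar>fw (x + t' *\<^sub>R v + s' *\<^sub>R w) v - fw x v\<bar> < e"
    using near[of t' s'] st' by (intro d(4)) (auto simp: d_def)
  ultimately show False unfolding e_def by (simp add: abs_if split: if_splits)
qed

lemma second_derivative_symmetric:
  fixes f :: "'a::real_normed_vector \<Rightarrow> 'b::real_inner"
  assumes V: "open V" "x \<in> V"
    and f: "\<And>u. u \<in> V \<Longrightarrow> (f has_derivative f' u) (at u)"
    and fv: "\<And>u. u \<in> V \<Longrightarrow> ((\<lambda>u. f' u v) has_derivative fv u) (at u)"
    and fw: "\<And>u. u \<in> V \<Longrightarrow> ((\<lambda>u. f' u w) has_derivative fw u) (at u)"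
    and cv: "continuous_on V (\<lambda>u. fv u w)" and cw: "continuous_on V (\<lambda>u. fw u v)"
  shows "fv x w = fw x v"
proof (rule vector_eq_ldot[THEN iffD1], rule allI)
  fix b
  have "fv x w \<bullet> b = fw x v \<bullet> b"
  proof (rule second_derivative_symmetric_real[OF V, where f = "\<lambda>u. f u \<bullet> b" and f' = "\<lambda>u v. f' u v \<bullet> b"
          and fv = "\<lambda>u w. fv u w \<bullet> b" and fw = "\<lambda>u v. fw u v \<bullet> b"])
    show "continuous_on V (\<lambda>u. fv u w \<bullet> b)" using cv by (intro continuous_intros)
    show "continuous_on V (\<lambda>u. fw u v \<bullet> b)" using cw by (intro continuous_intros)
  qed (rule has_derivative_inner_left, (rule f fv fw), assumption)+
  then show "b \<bullet> fv x w = b \<bullet> fw x v" by (simp add: inner_commute)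
qed

text \<open>A linear isomorphism \<open>A\<close> of the two spaces reduces this to a map of a space
  into itself. Continuity of each directional derivative is enough, because in finite dimension
  continuity in operator norm can be tested on a basis.\<close>

lemma inverse_function_directional:
  fixes f :: "'a::euclidean_space \<Rightarrow> 'b::euclidean_space"
  assumes dim: "DIM('a) = DIM('b)" and V: "open V" "u0 \<in> V"
    and f: "\<And>u. u \<in> V \<Longrightarrow> (f has_derivative f' u) (at u)"
    and cont: "\<And>v. continuous_on V (\<lambda>u. f' u v)"
    and inj: "inj (f' u0)"
  obtains W O' g where "open W" "W \<subseteq> V" "u0 \<in> W" "open O'" "f u0 \<in> O'" "homeomorphism W O' f g"
    "\<And>y. y \<in> O' \<Longrightarrow> (g has_derivative inv (f' (g y))) (at y)" "\<And>y. y \<in> O' \<Longrightarrow> bij (f' (g y))"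
proof -
  obtain A :: "'b \<Rightarrow> 'a" and B where A: "linear A" "linear B" "\<And>x. B (A x) = x" "\<And>x. A (B x) = x"
    using isomorphisms_UNIV_UNIV[OF dim[symmetric]] by metis
  have bA: "bounded_linear A" and bB: "bounded_linear B"
    using A linear_conv_bounded_linear by auto
  have bf: "bounded_linear (f' u)" if "u \<in> V" for u using f[OF that] by (rule has_derivative_bounded_linear)
  define F where "F = (\<lambda>x. A (f x))"
  define F' where "F' u = Blinfun (\<lambda>v. A (f' u v))" for u
  have F'_apply: "blinfun_apply (F' u) = (\<lambda>v. A (f' u v))" if "u \<in> V" for u
    unfolding F'_def using bounded_linear_compose[OF bA bf[OF that]] by (rule bounded_linear_Blinfun_apply)
  have dF: "(F has_derivative blinfun_apply (F' u)) (at u)" if "u \<in> V" for u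
    unfolding F_def F'_apply[OF that] by (rule bounded_linear.has_derivative[OF bA f[OF that]])
  have contF': "continuous_on V F'"
  proof (rule continuous_on_blinfun_componentwise)
    fix i :: 'a
    have "continuous_on V (\<lambda>u. A (f' u i))"
      by (rule bounded_linear.continuous_on[OF bA cont])
    then show "continuous_on V (\<lambda>u. blinfun_apply (F' u) i)"
      by (rule continuous_on_eq) (simp add: F'_apply)
  qed
  have bij0: "inj (\<lambda>v. A (f' u0 v))"
    using inj_compose[OF inj_on_inverseI[of UNIV B A] inj] A(3) by (simp add: o_def)
  have lin0: "linear (\<lambda>v. A (f' u0 v))"
    using bounded_linear.linear[OF bounded_linear_compose[OF bA bf[OF V(2)]]] .
  obtain L where L': "linear L" "L \<circ> (\<lambda>v. A (f' u0 v)) = id"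
    using linear_injective_left_inverse[OF lin0 bij0] by blast
  then have L: "linear L" "\<And>v. L (A (f' u0 v)) = v" by (simp_all add: fun_eq_iff)
  have left_inv: "Blinfun L o\<^sub>L F' u0 = id_blinfun"
    by (rule blinfun_eqI) (use L V(2) in \<open>simp add: F'_apply bounded_linear_Blinfun_apply linear_conv_bounded_linear\<close>)
  obtain W X g g' where W: "open W" "W \<subseteq> V" "u0 \<in> W" "open X" "F u0 \<in> X" "homeomorphism W X F g"
    and g: "\<And>y. y \<in> X \<Longrightarrow> (g has_derivative (g' y)) (at y)"
    and g': "\<And>y. y \<in> X \<Longrightarrow> g' y = inv (blinfun_apply (F' (g y)))"
    and bij: "\<And>y. y \<in> X \<Longrightarrow> bij (blinfun_apply (F' (g y)))"
    by (rule inverse_function_theorem[OF V(1) dF contF' V(2) left_inv], assumption) (rule that)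
  have gW: "g y \<in> W" if "y \<in> X" for y
    using homeomorphism_image2[OF W(6)] that by blast
  have imB: "B ` X = A -` X"
  proof
    show "A -` X \<subseteq> B ` X" using A(3) by (auto simp: image_iff intro!: bexI[of _ "A _"])
  qed (use A(4) in auto)
  have bijf: "bij (f' (g y))" if "y \<in> X" for y
  proof -
    have "f' (g y) = B \<circ> blinfun_apply (F' (g y))"
      using F'_apply gW[OF that] W(2) A(3) by (auto simp: o_def)
    moreover have "bij B" by (rule o_bij[of A]) (use A(3,4) in auto)
    ultimately show ?thesis using bij[OF that] by (simp add: bij_comp)
  qed
  show ?thesis
  proof (rule that[of W "B ` X" "\<lambda>y. g (A y)"])
    show "open (B ` X)" unfolding imB
      using W(4) bA by (intro open_vimage) (auto intro: linear_continuous_on)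
    show "f u0 \<in> B ` X" using W(5) unfolding imB F_def by simp
    have h: "homeomorphism X (B ` X) B A"
      using A bA bB by (auto simp: homeomorphism_def image_image intro: linear_continuous_on)
    have "homeomorphism W (B ` X) (B \<circ> F) (g \<circ> A)"
      by (rule homeomorphism_compose[OF W(6) h])
    then show "homeomorphism W (B ` X) f (\<lambda>y. g (A y))"
      by (simp add: F_def o_def A(3))
    fix y assume "y \<in> B ` X"
    then have y: "A y \<in> X" using A(4) by auto
    show "bij (f' (g (A y)))" by (rule bijf[OF y])
    have "((\<lambda>y. g (A y)) has_derivative (\<lambda>v. g' (A y) (A v))) (at y)"
      using has_derivative_compose[OF bounded_linear.has_derivative[OF bA has_derivative_ident] g[OF y]] .
    moreover have "(\<lambda>v. g' (A y) (A v)) = inv (f' (g (A y)))"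
    proof (rule inv_equality[symmetric])
      have b: "bij (\<lambda>v. A (f' (g (A y)) v))"
        using bij[OF y] F'_apply[of "g (A y)"] gW[OF y] W(2) by auto
      have g'': "g' (A y) = inv (\<lambda>v. A (f' (g (A y)) v))"
        using g'[OF y] F'_apply[of "g (A y)"] gW[OF y] W(2) by auto
      show "g' (A y) (A (f' (g (A y)) v)) = v" for v
        unfolding g'' using inv_f_f[OF bij_is_inj[OF b], of v] .
      fix w
      have "A (f' (g (A y)) (g' (A y) (A w))) = A w"
        unfolding g'' using surj_f_inv_f[OF bij_is_surj[OF b], of "A w"] .
      then have "B (A (f' (g (A y)) (g' (A y) (A w)))) = B (A w)" by simp
      then show "f' (g (A y)) (g' (A y) (A w)) = w" by (simp only: A(3))
    qed
    ultimately show "((\<lambda>y. g (A y)) has_derivative inv (f' (g (A y)))) (at y)" by simp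
  qed (rule W)+
qed

section \<open>Holomorphic graphs over half discs\<close>

text \<open>Even at a boundary point, small positive multiples of the basis vectors stay in the set,
  and these directions determine a linear map.\<close>

lemma half_plane_derivative_unique:
  assumes C: "openin (top_of_set half_plane) C" "u \<in> C"
    and "(f has_derivative D) (at u within C)" "(f has_derivative D') (at u within C)"
  shows "D = D'"
proof (rule frechet_derivative_unique_within[OF assms(3,4)])
  fix i :: "real^2" and e :: real
  assume i: "i \<in> Basis" and e: "e > 0"
  obtain \<rho> where \<rho>: "\<rho> > 0" "ball u \<rho> \<inter> half_plane \<subseteq> C"
    using C unfolding openin_contains_ball by auto
  define d where "d = min (e/2) (\<rho>/2)"
  have d: "d > 0" "d < e" "d < \<rho>" using e \<rho> by (auto simp: d_def)
  have "u \<in> half_plane" using C openin_subset by fastforce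
  then have "u + d *\<^sub>R i \<in> half_plane"
    using i d by (auto simp: half_plane_def Basis_vec_def axis_def)
  moreover have "u + d *\<^sub>R i \<in> ball u \<rho>" using d i by (simp add: dist_norm)
  ultimately show "\<exists>d. 0 < \<bar>d\<bar> \<and> \<bar>d\<bar> < e \<and> u + d *\<^sub>R i \<in> C"
    using d \<rho>(2) by (intro exI[of _ d]) auto
qed

lemma convex_half_plane: "convex half_plane"
proof -
  have "half_plane = {u. u $ 2 \<ge> 0}" by (auto simp: half_plane_def)
  then show ?thesis
    using convex_halfspace_ge[of 0 "axis 2 1 :: real^2"] by (simp add: inner_axis_axis inner_axis' inner_real_def)
qed

text \<open>Extended by zero to the lower half-plane, \<open>\<eta> - G \<zeta>\<close> becomes a continuous function of \<open>\<zeta>\<close>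
  that is holomorphic where it does not vanish, because \<open>G = d\<eta> / d\<zeta>\<close>.\<close>

lemma half_plane_unique_continuation:
  fixes \<zeta> \<eta> G :: "real^2 \<Rightarrow> complex"
  assumes V: "open V" "u0 \<in> V"
    and d\<zeta>: "\<And>u. u \<in> V \<Longrightarrow> (\<zeta> has_derivative \<zeta>' u) (at u)"
    and cont: "\<And>v. continuous_on V (\<lambda>u. \<zeta>' u v)"
    and inj: "inj (\<zeta>' u0)"
    and d\<eta>: "\<And>u. u \<in> V \<Longrightarrow> (\<eta> has_derivative \<eta>' u) (at u)"
    and G: "continuous_on V G" "\<And>u v. u \<in> V \<inter> half_plane \<Longrightarrow> \<eta>' u v = G u * \<zeta>' u v"
    and bdry: "\<And>u. u \<in> V \<Longrightarrow> u $ 2 = 0 \<Longrightarrow> \<eta> u = G u * \<zeta> u"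
    and acc: "\<And>\<delta>. \<delta> > 0 \<Longrightarrow> \<exists>N. open N \<and> N \<noteq> {} \<and> N \<subseteq> ball u0 \<delta> \<and> (\<forall>u\<in>N \<inter> half_plane. \<eta> u = G u * \<zeta> u)"
  shows "\<exists>d>0. \<forall>u\<in>ball u0 d \<inter> half_plane. \<eta> u = G u * \<zeta> u"
proof -
  define F where "F u = (if 0 \<le> u $ 2 then \<eta> u - G u * \<zeta> u else 0)" for u
  have contF: "continuous_on V F"
  proof -
    have c: "continuous_on V (\<lambda>u. \<eta> u - G u * \<zeta> u)"
      using G(1) d\<zeta> d\<eta> by (intro continuous_intros)
        (auto intro!: continuous_at_imp_continuous_on has_derivative_continuous)
    have "continuous_on V (\<lambda>u. if - (u $ 2) \<le> 0 then \<eta> u - G u * \<zeta> u else 0)"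
      by (rule continuous_on_cases_le) (use bdry in \<open>auto intro!: continuous_on_subset[OF c] continuous_intros\<close>)
    then show ?thesis by (simp add: F_def[abs_def])
  qed
  obtain W O' g where W: "open W" "W \<subseteq> V" "u0 \<in> W" "open O'" "\<zeta> u0 \<in> O'" "homeomorphism W O' \<zeta> g"
    and dg: "\<And>y. y \<in> O' \<Longrightarrow> (g has_derivative inv (\<zeta>' (g y))) (at y)"
    and bij: "\<And>y. y \<in> O' \<Longrightarrow> bij (\<zeta>' (g y))"
    using inverse_function_directional[OF _ V d\<zeta> cont inj] by (auto simp del: mem_ball)
  have gW: "g y \<in> W" and \<zeta>g: "\<zeta> (g y) = y" if "y \<in> O'" for y
    using homeomorphism_image2[OF W(6)] homeomorphism_apply2[OF W(6)] that by blast+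
  have \<zeta>W: "\<zeta> u \<in> O'" and g\<zeta>: "g (\<zeta> u) = u" if "u \<in> W" for u
    using homeomorphism_image1[OF W(6)] homeomorphism_apply1[OF W(6)] that by blast+
  have contg: "continuous_on O' g" using W(6) by (rule homeomorphism_cont2)
  \<comment> \<open>The part of the \<zeta>-plane that comes from the open upper half-plane; complex
    differentiation is carried out only there.\<close>
  define P where "P = O' \<inter> g -` {u. 0 < u $ 2}"
  have "open P" unfolding P_def
    by (rule continuous_open_preimage[OF contg W(4)]) (rule open_halfspace_component_gt_cart)
  have d: "((\<lambda>y. \<eta> (g y)) has_field_derivative G (g y)) (at y)" if y: "y \<in> P" for y
  proof -
    have yO: "y \<in> O'" and gy: "g y \<in> V \<inter> half_plane"
      using y gW[of y] W(2) by (auto simp: P_def half_plane_def)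
    have "((\<lambda>y. \<eta> (g y)) has_derivative (\<lambda>v. \<eta>' (g y) (inv (\<zeta>' (g y)) v))) (at y)"
      by (rule has_derivative_compose[OF dg[OF yO] d\<eta>]) (use gy in auto)
    moreover have "\<eta>' (g y) (inv (\<zeta>' (g y)) v) = G (g y) * v" for v
      using G(2)[OF gy] surj_f_inv_f[OF bij_is_surj[OF bij[OF yO]]] by simp
    ultimately show ?thesis by (simp add: has_field_derivative_def)
  qed
  have holo1: "(\<lambda>y. \<eta> (g y)) holomorphic_on P"
    using d \<open>open P\<close> by (auto simp: holomorphic_on_open)
  \<comment> \<open>As the complex derivative of a holomorphic function, \<open>G \<circ> g\<close>
    is itself holomorphic, although \<open>G\<close> is only assumed continuous.\<close>
  have holo2: "(\<lambda>y. G (g y)) holomorphic_on P"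
    using holomorphic_deriv[OF holo1 \<open>open P\<close>] by (rule holomorphic_transform) (simp add: DERIV_imp_deriv[OF d])
  have holo3: "(\<lambda>y. F (g y)) holomorphic_on P"
  proof (rule holomorphic_transform)
    show "(\<lambda>y. \<eta> (g y) - G (g y) * y) holomorphic_on P"
      by (intro holomorphic_intros holo1 holo2)
    show "\<eta> (g y) - G (g y) * y = F (g y)" if "y \<in> P" for y
      using that \<zeta>g by (simp add: P_def F_def)
  qed
  \<comment> \<open>\<open>F\<close> vanishes below the line by definition and on the line by
    \<open>bdry\<close>.\<close>
  have sub: "{y \<in> O'. F (g y) \<noteq> 0} \<subseteq> P"
  proof clarify
    fix y assume y: "y \<in> O'" "F (g y) \<noteq> 0"
    have "g y $ 2 \<noteq> 0" using y bdry[of "g y"] gW[OF y(1)] W(2) by (auto simp: F_def)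
    then show "y \<in> P" using y by (auto simp: P_def F_def split: if_splits)
  qed
  have "\<exists>d>0. \<forall>y\<in>ball (\<zeta> u0) d. F (g y) = 0"
  proof (rule zero_near_limit_of_zero_balls[OF _ W(4,5)])
    show "continuous_on O' (\<lambda>y. F (g y))"
      by (rule continuous_on_compose2[OF contF contg]) (use gW W(2) in auto)
    show "(\<lambda>y. F (g y)) holomorphic_on {y \<in> O'. F (g y) \<noteq> 0}"
      using holo3 sub holomorphic_on_subset by blast
    fix \<delta> :: real assume "\<delta> > 0"
    have "continuous_on W \<zeta>" using W(6) by (rule homeomorphism_cont1)
    then have "open (W \<inter> \<zeta> -` ball (\<zeta> u0) \<delta>)" by (rule continuous_open_preimage) (use W in auto)
    moreover have "u0 \<in> W \<inter> \<zeta> -` ball (\<zeta> u0) \<delta>" using W(3) \<open>\<delta> > 0\<close> by simp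
    ultimately obtain \<delta>' where \<delta>': "\<delta>' > 0" "ball u0 \<delta>' \<subseteq> W \<inter> \<zeta> -` ball (\<zeta> u0) \<delta>"
      by (rule openE)
    obtain N where N: "open N" "N \<noteq> {}" "N \<subseteq> ball u0 \<delta>'" "\<forall>u\<in>N \<inter> half_plane. \<eta> u = G u * \<zeta> u"
      using acc[OF \<delta>'(1)] by blast
    have "N \<subseteq> W" using N(3) \<delta>'(2) by blast
    have "openin (top_of_set O') (\<zeta> ` N)"
      using homeomorphism_imp_open_map[OF W(6), of N] N(1) \<open>N \<subseteq> W\<close> by (simp add: open_subset)
    then have "open (\<zeta> ` N)" using W(4) openin_open_trans by blast
    obtain n where n: "n \<in> N" using N(2) by blast
    then obtain e where e: "e > 0" "ball (\<zeta> n) e \<subseteq> \<zeta> ` N"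
      using \<open>open (\<zeta> ` N)\<close> open_contains_ball by blast
    \<comment> \<open>A point of \<open>N\<close> in the half-plane satisfies the equation, and at
      any other point of \<open>N\<close> the extension is zero; so \<open>N\<close> may even lie
      entirely below the line.\<close>
    have "F (g y) = 0" if y: "y \<in> ball (\<zeta> n) e" for y
    proof -
      obtain u where u: "u \<in> N" "y = \<zeta> u" using y e(2) by auto
      then have "g y = u" using g\<zeta> \<open>N \<subseteq> W\<close> by auto
      then show ?thesis using N(4) u(1) by (auto simp: F_def half_plane_def)
    qed
    moreover have "\<zeta> n \<in> ball (\<zeta> u0) \<delta>" using n N(3) \<delta>'(2) by blast
    ultimately show "\<exists>a e. e > 0 \<and> a \<in> ball (\<zeta> u0) \<delta> \<and> (\<forall>y\<in>ball a e. F (g y) = 0)"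
      using e(1) by blast
  qed
  then obtain d where d: "d > 0" "\<forall>y\<in>ball (\<zeta> u0) d. F (g y) = 0" by blast
  have "continuous_on W \<zeta>" using W(6) by (rule homeomorphism_cont1)
  then have "open (W \<inter> \<zeta> -` ball (\<zeta> u0) d)" by (rule continuous_open_preimage) (use W in auto)
  moreover have "u0 \<in> W \<inter> \<zeta> -` ball (\<zeta> u0) d" using W(3) d(1) by simp
  ultimately obtain d' where d': "d' > 0" "ball u0 d' \<subseteq> W \<inter> \<zeta> -` ball (\<zeta> u0) d"
    by (rule openE)
  have "\<eta> u = G u * \<zeta> u" if u: "u \<in> ball u0 d' \<inter> half_plane" for u
  proof -
    have "u \<in> W" "\<zeta> u \<in> ball (\<zeta> u0) d" using u d'(2) by blast+
    then have "F u = 0" using d(2) g\<zeta> by metis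
    then show ?thesis using u by (simp add: F_def half_plane_def)
  qed
  then show ?thesis using d'(1) by blast
qed

text \<open>Differentiating \<eta> = G \<zeta> and subtracting d\<eta> = G d\<zeta> leaves \<zeta>
  dG = 0, so dG vanishes off the zeros of \<zeta>.\<close>

lemma half_plane_slope_constant:
  fixes \<zeta> \<eta> G :: "real^2 \<Rightarrow> complex"
  assumes C: "convex C" "openin (top_of_set half_plane) C"
    and d\<zeta>: "\<And>u. u \<in> C \<Longrightarrow> (\<zeta> has_derivative \<zeta>' u) (at u)"
    and inj: "inj_on \<zeta> C"
    and d\<eta>: "\<And>u. u \<in> C \<Longrightarrow> (\<eta> has_derivative \<eta>' u) (at u)"
    and dG: "\<And>u. u \<in> C \<Longrightarrow> (G has_derivative G' u) (at u)"
    and G: "\<And>u v. u \<in> C \<Longrightarrow> \<eta>' u v = G u * \<zeta>' u v"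
    and eq: "\<And>u. u \<in> C \<Longrightarrow> \<eta> u = G u * \<zeta> u"
    and "a \<in> C" "b \<in> C"
  shows "G a = G b"
proof -
  \<comment> \<open>By injectivity of \<zeta> there is at most one exceptional point, and a
    continuous function on a convex set stays constant if its derivative vanishes off finitely many
    points.\<close>
  define K where "K = {u \<in> C. \<zeta> u = 0}"
  have "finite K"
  proof (cases "K = {}")
    case False
    then obtain k where "k \<in> K" by blast
    then have "K \<subseteq> {k}" using inj by (auto simp: K_def inj_on_def)
    then show ?thesis using finite_subset by blast
  qed simp
  have "G' u v = 0" if u: "u \<in> C - K" for u v
  proof -
    have uC: "u \<in> C" using u by simp
    have "((\<lambda>u. \<eta> u - G u * \<zeta> u) has_derivative (\<lambda>v. \<eta>' u v - (G u * \<zeta>' u v + G' u v * \<zeta> u))) (at u within C)"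
      by (intro has_derivative_diff has_derivative_mult has_derivative_at_withinI[OF d\<eta>]
          has_derivative_at_withinI[OF dG] has_derivative_at_withinI[OF d\<zeta>] uC)
    moreover have "((\<lambda>u. \<eta> u - G u * \<zeta> u) has_derivative (\<lambda>v. 0)) (at u within C)"
      by (rule has_derivative_transform[OF uC _ has_derivative_const]) (simp add: eq)
    ultimately have "(\<lambda>v. \<eta>' u v - (G u * \<zeta>' u v + G' u v * \<zeta> u)) = (\<lambda>v. 0)"
      by (rule half_plane_derivative_unique[OF C(2) uC])
    from fun_cong[OF this, of v] have "G' u v * \<zeta> u = 0" by (simp add: G[OF uC])
    then show ?thesis using u by (simp add: K_def)
  qed
  then have "(G has_derivative (\<lambda>v. 0)) (at u within C)" if "u \<in> C - K" for u
    using has_derivative_at_withinI[OF dG, of u C] that by (metis (no_types, lifting) DiffD1 ext)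
  moreover have "continuous_on C G"
    using dG by (auto intro!: continuous_at_imp_continuous_on has_derivative_continuous)
  ultimately show ?thesis
    using has_derivative_zero_unique_strong_convex[OF C(1) \<open>finite K\<close>, of G b "G b" a] assms(9,10) by metis
qed

section \<open>Minimal Lagrangian patches\<close>

text \<open>The standard Hermitian form; its real part is the metric and its imaginary part is, up
  to sign, the Kaehler form that vanishes on Lagrangian planes.\<close>

definition hermitian :: "complex^2 \<Rightarrow> complex^2 \<Rightarrow> complex"
  where "hermitian v w = v $ 1 * cnj (w $ 1) + v $ 2 * cnj (w $ 2)"

text \<open>The holomorphic volume form of C^2. On a basis of a Lagrangian plane, its phase is the
  Lagrangian angle (up to orientation).\<close>

definition complex_det :: "complex^2 \<Rightarrow> complex^2 \<Rightarrow> complex"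
  where "complex_det v w = v $ 1 * w $ 2 - v $ 2 * w $ 1"

lemma Re_hermitian: "Re (hermitian v w) = v \<bullet> w"
  by (simp add: hermitian_def inner_vec_def sum_2 inner_complex_def)

lemma Im_hermitian: "Im (hermitian v w) = v \<bullet> \<J> w"
  by (simp add: hermitian_def inner_vec_def sum_2 inner_complex_def complex_structure_def algebra_simps)

lemma hermitian_self: "hermitian v v = of_real (v \<bullet> v)"
  by (simp add: complex_eq_iff Re_hermitian)
    (simp add: hermitian_def algebra_simps)

text \<open>Multiplicativity of the determinant: the matrix with rows \<open>a\<close>,
  \<open>b\<close> times the adjoint of the matrix with rows \<open>v\<close>, \<open>w\<close> has
  the Hermitian products as entries.\<close>

lemma complex_det_cnj:
  "complex_det a b * cnj (complex_det v w) = hermitian a v * hermitian b w - hermitian a w * hermitian b v"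
  by (simp add: complex_det_def hermitian_def algebra_simps)

lemma complex_structure_bounded_linear: "bounded_linear \<J>"
proof -
  have "linear \<J>"
    by (rule linearI) (simp_all add: complex_structure_def vec_eq_iff algebra_simps)
  then show ?thesis by (simp add: linear_conv_bounded_linear)
qed

lemma complex_structure_skew: "\<J> v \<bullet> w = - (v \<bullet> \<J> w)"
  by (simp add: complex_structure_def inner_vec_def sum_2 inner_complex_def)

lemma hermitian_eq_inner:
  assumes "v \<bullet> \<J> w = 0"
  shows "hermitian v w = of_real (v \<bullet> w)" "hermitian w v = of_real (v \<bullet> w)"
proof -
  show *: "hermitian v w = of_real (v \<bullet> w)" using assms by (simp add: complex_eq_iff Re_hermitian Im_hermitian)
  have "hermitian w v = cnj (hermitian v w)" by (simp add: hermitian_def algebra_simps)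
  then show "hermitian w v = of_real (v \<bullet> w)" using * by simp
qed

text \<open>Here \<open>a\<close> and \<open>b\<close> stand for derivatives of the basis vectors
  \<open>v\<close> and \<open>w\<close>. The result contracts the adjugate of the metric with the
  \<J>-normal components of \<open>a\<close> and \<open>b\<close>, which is the combination that
  minimality kills.\<close>

lemma Im_complex_det_derivative:
  assumes "v \<bullet> \<J> w = 0"
  shows "Im ((complex_det a w + complex_det v b) * cnj (complex_det v w)) =
    (w \<bullet> w) * (a \<bullet> \<J> v) - (v \<bullet> w) * (a \<bullet> \<J> w) + (v \<bullet> v) * (b \<bullet> \<J> w) - (v \<bullet> w) * (b \<bullet> \<J> v)"
  unfolding distrib_right complex_det_cnj hermitian_self hermitian_eq_inner[OF assms]
  by (simp add: Im_hermitian algebra_simps)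

text \<open>The imaginary part is the real determinant of \<open>L\<close>; in this form its
  continuity in the base point is immediate.\<close>

lemma inj_plane_to_complex_iff:
  fixes L :: "real^2 \<Rightarrow> complex"
  assumes L: "linear L"
  shows "inj L \<longleftrightarrow> Im (cnj (L (axis 1 1)) * L (axis 2 1)) \<noteq> 0"
proof -
  define a where "a = L (axis 1 1)"
  define b where "b = L (axis 2 1)"
  have v: "v = v $ 1 *\<^sub>R axis 1 1 + v $ 2 *\<^sub>R axis 2 1" for v :: "real^2"
    by (simp add: vec_eq_iff forall_2 axis_def)
  have Lv: "L v = v $ 1 *\<^sub>R a + v $ 2 *\<^sub>R b" for v
    unfolding a_def b_def by (subst v) (simp only: linear_add[OF L] linear_scale[OF L])
  show ?thesis unfolding a_def[symmetric] b_def[symmetric]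
  proof
    assume inj: "inj L"
    show "Im (cnj a * b) \<noteq> 0"
    proof
      assume im: "Im (cnj a * b) = 0"
        define t where "t = Re (cnj a * b)"
      \<comment> \<open>If \<open>cnj a * b\<close> equals the real number \<open>t\<close>, then
        multiplying by \<open>a\<close> gives |a|^2 b = t a, so this vector lies in the
        kernel.\<close>
      define w :: "real^2" where "w = (\<chi> i. if i = 1 then - t else (cmod a)^2)"
      have ab: "cnj a * b = of_real t" using im by (simp add: complex_eq_iff t_def)
      have "L w = of_real ((cmod a)^2) * b - of_real t * a"
        unfolding Lv w_def by (simp add: scaleR_conv_of_real)
      also have "\<dots> = (a * cnj a) * b - (cnj a * b) * a"
        by (simp only: ab[symmetric] complex_norm_square)
      finally have "L w = L 0" by (simp add: linear_0[OF L] algebra_simps)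
      then have "w = 0" using inj by (simp add: inj_eq)
      then have "a = 0" by (simp add: w_def vec_eq_iff forall_2)
      then have "L (axis 1 1) = L 0" by (simp add: a_def linear_0[OF L])
      then show False using inj by (simp add: inj_eq axis_eq_0_iff)
    qed
  next
    assume im: "Im (cnj a * b) \<noteq> 0"
    then have a: "a \<noteq> 0" by auto
    show "inj L" unfolding linear_injective_0[OF L]
    proof (intro allI impI)
      fix v assume "L v = 0"
      then have 0: "v $ 1 *\<^sub>R a + v $ 2 *\<^sub>R b = 0" by (simp add: Lv)
      then have "Im (cnj a * (v $ 1 *\<^sub>R a + v $ 2 *\<^sub>R b)) = 0" by simp
      then have "v $ 2 * Im (cnj a * b) = 0" by (simp add: algebra_simps scaleR_conv_of_real)
      then have "v $ 2 = 0" using im by simp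
      then have "v $ 1 = 0" using 0 a by simp
      then show "v = 0" using \<open>v $ 2 = 0\<close> by (simp add: vec_eq_iff forall_2)
    qed
  qed
qed

text \<open>The vector |E2|^2 E1 - (E1, E2) E2, a multiple of the component of \<open>E1\<close>
  orthogonal to \<open>E2\<close>, has squared length |E2|^2 times the Gram determinant.\<close>

lemma gram_determinant_nonzero:
  fixes L :: "real^2 \<Rightarrow> 'b::real_inner"
  assumes lin: "linear L" and inj: "inj L"
  defines "E1 \<equiv> L (axis 1 1)" and "E2 \<equiv> L (axis 2 1)"
  shows "(E1 \<bullet> E1) * (E2 \<bullet> E2) - (E1 \<bullet> E2) * (E1 \<bullet> E2) \<noteq> 0"
proof
  assume 0: "(E1 \<bullet> E1) * (E2 \<bullet> E2) - (E1 \<bullet> E2) * (E1 \<bullet> E2) = 0"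
  define w :: "real^2" where "w = (E2 \<bullet> E2) *\<^sub>R axis 1 1 - (E1 \<bullet> E2) *\<^sub>R axis 2 1"
  have Lw: "L w = (E2 \<bullet> E2) *\<^sub>R E1 - (E1 \<bullet> E2) *\<^sub>R E2"
    by (simp add: w_def linear_diff[OF lin] linear_scale[OF lin] E1_def E2_def)
  have "L w \<bullet> L w = (E2 \<bullet> E2) * ((E1 \<bullet> E1) * (E2 \<bullet> E2) - (E1 \<bullet> E2) * (E1 \<bullet> E2))"
    unfolding Lw by (simp add: inner_diff_left inner_diff_right inner_commute algebra_simps)
  then have "L w = L 0" using 0 by (simp add: linear_0[OF lin])
  then have "w = 0" using inj by (simp add: inj_eq)
  then have "w $ 1 = 0" by simp
  then have "E2 = L 0" by (simp add: w_def axis_def linear_0[OF lin])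
  then have "axis 2 1 = (0 :: real^2)" using inj by (simp add: inj_eq E2_def)
  then show False by (simp add: axis_eq_0_iff)
qed

text \<open>With z_k = x_k + i y_k, put \<zeta> = x_1 + i x_2 and \<eta> = y_1 - i y_2. Up to signs,
  the real and imaginary parts of d\<zeta> \<and> d\<eta> are the Kaehler form and the imaginary
  part of dz_1 \<and> dz_2. Planes on which both vanish are therefore complex lines in the
  coordinates (\<zeta>, \<eta>).\<close>

lemma rotated_complex_linear_dependence:
  assumes "Im (a * cnj c + b * cnj d) = 0" "Im (a * d - b * c) = 0"
  shows "Complex (Re a) (Re b) * Complex (Im c) (- Im d) = Complex (Re c) (Re d) * Complex (Im a) (- Im b)"
  using assms by (simp add: complex_eq_iff algebra_simps)

text \<open>\<open>Y\<close> extends the immersion in a chart to a full disc, so that ordinary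
  derivatives exist at boundary points; the geometric conditions hold on the half-plane only.
  \<open>minimal_eq\<close> is the vanishing of the mean curvature, multiplied by twice the
  determinant of the metric and tested against the normal vectors
  \<open>\<J> (Y' u w)\<close>.\<close>

locale minimal_lagrangian_patch =
  fixes Y :: "real^2 \<Rightarrow> complex^2" and Y' :: "real^2 \<Rightarrow> real^2 \<Rightarrow> complex^2"
    and Y'' :: "real^2 \<Rightarrow> real^2 \<Rightarrow> real^2 \<Rightarrow> complex^2" and u0 :: "real^2" and \<rho> :: real
  assumes \<rho>: "\<rho> > 0" and u0: "u0 \<in> half_plane"
    and dY: "\<And>u. u \<in> ball u0 \<rho> \<Longrightarrow> (Y has_derivative Y' u) (at u)"
    and dY': "\<And>u w. u \<in> ball u0 \<rho> \<Longrightarrow> ((\<lambda>u. Y' u w) has_derivative (\<lambda>v. Y'' u v w)) (at u)"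
    and contY'': "\<And>v w. continuous_on (ball u0 \<rho>) (\<lambda>u. Y'' u v w)"
    and immersed: "\<And>u. u \<in> ball u0 \<rho> \<inter> half_plane \<Longrightarrow> inj (Y' u)"
    and isotropic: "\<And>u v w. u \<in> ball u0 \<rho> \<inter> half_plane \<Longrightarrow> Y' u v \<bullet> \<J> (Y' u w) = 0"
    and minimal_eq: "\<And>u w. u \<in> ball u0 \<rho> \<inter> half_plane \<Longrightarrow>
      (Y' u (axis 2 1) \<bullet> Y' u (axis 2 1)) * (Y'' u (axis 1 1) (axis 1 1) \<bullet> \<J> (Y' u w))
      - 2 * (Y' u (axis 1 1) \<bullet> Y' u (axis 2 1)) * (Y'' u (axis 1 1) (axis 2 1) \<bullet> \<J> (Y' u w))
      + (Y' u (axis 1 1) \<bullet> Y' u (axis 1 1)) * (Y'' u (axis 2 1) (axis 2 1) \<bullet> \<J> (Y' u w)) = 0"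
begin

abbreviation "C \<equiv> ball u0 \<rho> \<inter> half_plane"
abbreviation "E1 u \<equiv> Y' u (axis 1 1)"
abbreviation "E2 u \<equiv> Y' u (axis 2 1)"

lemma convex_C: "convex C"
  by (intro convex_Int convex_half_plane) simp

lemma openin_C: "openin (top_of_set half_plane) C"
  by (simp add: openin_open_Int inf_commute)

lemma linear_Y': "u \<in> ball u0 \<rho> \<Longrightarrow> linear (Y' u)"
  using dY has_derivative_linear by blast

lemma Y''_commute:
  assumes "u \<in> ball u0 \<rho>" shows "Y'' u v w = Y'' u w v"
  by (rule second_derivative_symmetric[OF open_ball assms dY dY' dY' contY'' contY'', symmetric])

text \<open>Together with the symmetry of second derivatives this makes the trilinear form \<open>\<langle>Y''(a,b), \<J> Y'(c)\<rangle>\<close>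
  totally symmetric, so that its trace controls the derivative of the Lagrangian angle.\<close>

lemma cubic_form_symmetric:
  assumes u: "u \<in> C"
  shows "Y'' u v a \<bullet> \<J> (Y' u b) = Y'' u v b \<bullet> \<J> (Y' u a)"
proof -
  have uB: "u \<in> ball u0 \<rho>" using u by simp
  \<comment> \<open>Isotropy is known on \<open>C\<close> only, so the derivative is taken within
    \<open>C\<close> and compared there.\<close>
  have "((\<lambda>u. Y' u a \<bullet> \<J> (Y' u b)) has_derivative
      (\<lambda>v. Y' u a \<bullet> \<J> (Y'' u v b) + Y'' u v a \<bullet> \<J> (Y' u b))) (at u within C)"
    by (rule has_derivative_at_withinI)
      (intro has_derivative_inner bounded_linear.has_derivative[OF complex_structure_bounded_linear] dY' uB)
  moreover have "((\<lambda>u. Y' u a \<bullet> \<J> (Y' u b)) has_derivative (\<lambda>v. 0)) (at u within C)"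
    by (rule has_derivative_transform[OF u _ has_derivative_const]) (simp add: isotropic)
  ultimately have "(\<lambda>v. Y' u a \<bullet> \<J> (Y'' u v b) + Y'' u v a \<bullet> \<J> (Y' u b)) = (\<lambda>v. 0)"
    by (rule half_plane_derivative_unique[OF openin_C u])
  from fun_cong[OF this, of v] show ?thesis
    using complex_structure_skew[of "Y' u a" "Y'' u v b"] by (simp add: inner_commute)
qed

text \<open>On an isotropic plane the Hermitian products are real, so the squared modulus of the
  determinant is the Gram determinant.\<close>

lemma complex_det_nonzero:
  assumes u: "u \<in> C"
  shows "complex_det (E1 u) (E2 u) \<noteq> 0"
proof
  assume "complex_det (E1 u) (E2 u) = 0"
  then have "hermitian (E1 u) (E1 u) * hermitian (E2 u) (E2 u) - hermitian (E1 u) (E2 u) * hermitian (E2 u) (E1 u) = 0"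
    using complex_det_cnj[of "E1 u" "E2 u" "E1 u" "E2 u"] by simp
  then have "complex_of_real ((E1 u \<bullet> E1 u) * (E2 u \<bullet> E2 u) - (E1 u \<bullet> E2 u) * (E1 u \<bullet> E2 u)) = 0"
    unfolding hermitian_self hermitian_eq_inner[OF isotropic[OF u, of "axis 1 1" "axis 2 1"]] by simp
  then show False using gram_determinant_nonzero[OF linear_Y'[OF IntD1[OF u]] immersed[OF u]] by (simp only: of_real_eq_0_iff)
qed

text \<open>With \<open>D\<close> the determinant of the coordinate frame, the derivative of its
  phase is governed by Im(D' cnj D), which is the trace of the cubic form and vanishes by
  minimality.\<close>

lemma lagrangian_angle_constant:
  obtains e where "cmod e = 1" "\<And>u. u \<in> C \<Longrightarrow> Im (cnj e * cnj e * complex_det (E1 u) (E2 u)) = 0"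
proof -
  define D where "D u = complex_det (E1 u) (E2 u)" for u
  define D' where "D' u v = complex_det (Y'' u v (axis 1 1)) (E2 u) + complex_det (E1 u) (Y'' u v (axis 2 1))" for u v
  have comp: "((\<lambda>u. Y' u w $ k) has_derivative (\<lambda>v. Y'' u v w $ k)) (at u)" if "u \<in> C" for u w k
    using bounded_linear.has_derivative[OF bounded_linear_vec_nth dY'] that by auto
  have dD: "(D has_derivative D' u) (at u)" if "u \<in> C" for u
  proof -
    have "((\<lambda>u. E1 u $ 1 * E2 u $ 2 - E1 u $ 2 * E2 u $ 1) has_derivative
      (\<lambda>v. (E1 u $ 1 * Y'' u v (axis 2 1) $ 2 + Y'' u v (axis 1 1) $ 1 * E2 u $ 2)
        - (E1 u $ 2 * Y'' u v (axis 2 1) $ 1 + Y'' u v (axis 1 1) $ 2 * E2 u $ 1))) (at u)"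
      by (intro has_derivative_diff has_derivative_mult comp that)
    then show ?thesis by (simp add: D_def[abs_def] D'_def[abs_def] complex_det_def algebra_simps)
  qed
  have Im0: "Im (D' u v * cnj (D u)) = 0" if u: "u \<in> C" for u v
  proof -
    have uB: "u \<in> ball u0 \<rho>" using u by simp
    let ?c = "\<lambda>a b w. Y'' u a b \<bullet> \<J> (Y' u w)"
    have s: "?c a b w = ?c b a w" "?c a b w = ?c a w b" for a b w
      using Y''_commute[OF uB] cubic_form_symmetric[OF u] by auto
    \<comment> \<open>Total symmetry moves the direction \<open>v\<close> of differentiation into
      the last slot, where \<open>minimal_eq\<close> tests the trace.\<close>
    have "?c v (axis 1 1) (axis 1 1) = ?c (axis 1 1) (axis 1 1) v"
      "?c v (axis 1 1) (axis 2 1) = ?c (axis 1 1) (axis 2 1) v"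
      "?c v (axis 2 1) (axis 1 1) = ?c (axis 1 1) (axis 2 1) v"
      "?c v (axis 2 1) (axis 2 1) = ?c (axis 2 1) (axis 2 1) v"
      using s by metis+
    then show ?thesis
      unfolding D_def D'_def Im_complex_det_derivative[OF isotropic[OF u, of "axis 1 1" "axis 2 1"]]
      using minimal_eq[OF u, of v] by simp
  qed
  \<comment> \<open>This quotient is the exponential of twice the angle, so no continuous choice of
    argument is required.\<close>
  have "((\<lambda>u. D u / cnj (D u)) has_derivative (\<lambda>v. 0)) (at u within C)" if u: "u \<in> C" for u
  proof (rule has_derivative_at_withinI)
    have n: "cnj (D u) \<noteq> 0" using complex_det_nonzero[OF u] by (simp add: D_def)
    have "((\<lambda>u. D u / cnj (D u)) has_derivative
       (\<lambda>v. (D' u v * cnj (D u) - D u * cnj (D' u v)) / (cnj (D u) * cnj (D u)))) (at u)"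
      by (rule has_derivative_divide'[OF dD[OF u] bounded_linear.has_derivative[OF bounded_linear_cnj dD[OF u]] n])
    moreover have "D' u v * cnj (D u) - D u * cnj (D' u v) = 0" for v
      using Im0[OF u, of v] by (simp add: complex_eq_iff algebra_simps)
    ultimately show "((\<lambda>u. D u / cnj (D u)) has_derivative (\<lambda>v. 0)) (at u)" by simp
  qed
  then have "\<exists>k. \<forall>u\<in>C. D u / cnj (D u) = k"
    by (rule has_derivative_zero_constant[OF convex_C])
  then obtain k where k: "\<And>u. u \<in> C \<Longrightarrow> D u / cnj (D u) = k" by auto
  have u0C: "u0 \<in> C" using u0 \<rho> by simp
  define c where "c = D u0 / of_real (cmod (D u0))"
  have D0: "D u0 \<noteq> 0" using complex_det_nonzero[OF u0C] by (simp add: D_def)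
  then have c1: "cmod c = 1" by (simp add: c_def norm_divide)
  \<comment> \<open>Scaling both complex coordinates multiplies the determinant by the square of the
    factor; a square root of the phase is therefore what makes it real.\<close>
  define e where "e = csqrt c"
  have ee: "e * e = c" by (simp add: e_def power2_eq_square[symmetric])
  have "cmod e * cmod e = 1" using c1 ee by (metis norm_mult)
  then have e1: "cmod e = 1" using abs_square_eq_1[of "cmod e"] by (simp add: power2_eq_square)
  have "Im (cnj e * cnj e * D u) = 0" if u: "u \<in> C" for u
  proof -
    have "D u \<noteq> 0" using complex_det_nonzero[OF u] by (simp add: D_def)
    have "D u / cnj (D u) = D u0 / cnj (D u0)" using k[OF u] k[OF u0C] by simp
    then have "D u * cnj (D u0) = D u0 * cnj (D u)" using D0 \<open>D u \<noteq> 0\<close> by (simp add: frac_eq_eq)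
    then have "Im (D u * cnj (D u0)) = 0" by (simp add: complex_eq_iff)
    moreover have "cnj e * cnj e * D u = (D u * cnj (D u0)) / of_real (cmod (D u0))"
      unfolding complex_cnj_mult[symmetric] ee by (simp add: c_def)
    ultimately show ?thesis by simp
  qed
  with that e1 show ?thesis by (simp add: D_def)
qed

text \<open>\<open>P\<close> and \<open>Q\<close> are the coordinates \<zeta> and \<eta> after
  multiplication by \<open>cnj e\<close>. Tangent planes are complex lines in them, and the two
  coordinates are swapped if necessary so that \<open>P\<close> is injective on the tangent plane at
  \<open>u0\<close>.\<close>

lemma rotated_coordinates:
  obtains P Q :: "complex^2 \<Rightarrow> complex" where "bounded_linear P" "bounded_linear Q"
    "\<And>v. P v = 0 \<Longrightarrow> Q v = 0 \<Longrightarrow> v = 0"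
    "\<And>u. u \<in> C \<Longrightarrow> P (E1 u) * Q (E2 u) = P (E2 u) * Q (E1 u)"
    "inj (\<lambda>v. P (Y' u0 v))"
proof -
  obtain e where e: "cmod e = 1" "\<And>u. u \<in> C \<Longrightarrow> Im (cnj e * cnj e * complex_det (E1 u) (E2 u)) = 0"
    using lagrangian_angle_constant by blast
  define P where "P v = Complex (Re (cnj e * v $ 1)) (Re (cnj e * v $ 2))" for v :: "complex^2"
  define Q where "Q v = Complex (Im (cnj e * v $ 1)) (- Im (cnj e * v $ 2))" for v :: "complex^2"
  have "linear P" "linear Q"
    by (auto intro!: linearI simp: P_def Q_def complex_eq_iff algebra_simps)
  then have bl: "bounded_linear P" "bounded_linear Q" by (simp_all add: linear_conv_bounded_linear)
  have e0: "cnj e \<noteq> 0" using e(1) by auto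
  have joint: "v = 0" if "P v = 0" "Q v = 0" for v
  proof -
    have "cnj e * v $ 1 = 0" "cnj e * v $ 2 = 0" using that by (simp_all only: P_def Q_def complex_eq_iff) auto
    then show ?thesis using e0 by (simp add: vec_eq_iff forall_2)
  qed
  have rel: "P (E1 u) * Q (E2 u) = P (E2 u) * Q (E1 u)" if u: "u \<in> C" for u
    unfolding P_def Q_def
  proof (rule rotated_complex_linear_dependence)
    have "cnj e * e = 1" using complex_norm_square[of e] e(1) by (simp add: mult.commute)
    have "cnj e * E1 u $ 1 * cnj (cnj e * E2 u $ 1) + cnj e * E1 u $ 2 * cnj (cnj e * E2 u $ 2)
       = (cnj e * e) * hermitian (E1 u) (E2 u)"
      by (simp add: hermitian_def algebra_simps)
    then show "Im (cnj e * E1 u $ 1 * cnj (cnj e * E2 u $ 1) + cnj e * E1 u $ 2 * cnj (cnj e * E2 u $ 2)) = 0"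
      using \<open>cnj e * e = 1\<close> isotropic[OF u] by (simp add: Im_hermitian)
    have "cnj e * E1 u $ 1 * (cnj e * E2 u $ 2) - cnj e * E1 u $ 2 * (cnj e * E2 u $ 1)
       = cnj e * cnj e * complex_det (E1 u) (E2 u)"
      by (simp add: complex_det_def algebra_simps)
    then show "Im (cnj e * E1 u $ 1 * (cnj e * E2 u $ 2) - cnj e * E1 u $ 2 * (cnj e * E2 u $ 1)) = 0"
      using e(2)[OF u] by simp
  qed
  have u0C: "u0 \<in> C" using u0 \<rho> by simp
  have lin: "linear (Y' u0)" and inj: "inj (Y' u0)" using u0C linear_Y' immersed by auto
  have linP: "linear (\<lambda>v. P (Y' u0 v))" and linQ: "linear (\<lambda>v. Q (Y' u0 v))"
    using linear_compose[OF lin \<open>linear P\<close>] linear_compose[OF lin \<open>linear Q\<close>] by (simp_all add: o_def)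
  \<comment> \<open>If both determinants vanished, one of the coordinates would give a real ratio
    between the two basis vectors, and the relation \<open>a * d = b * c\<close> would transfer it
    to the other, making \<open>E1\<close> and \<open>E2\<close> dependent.\<close>
  have "inj (\<lambda>v. P (Y' u0 v)) \<or> inj (\<lambda>v. Q (Y' u0 v))"
  proof (rule ccontr)
    define a where "a = P (E1 u0)"
    define b where "b = P (E2 u0)"
    define c where "c = Q (E1 u0)"
    define d where "d = Q (E2 u0)"
    assume "\<not> (inj (\<lambda>v. P (Y' u0 v)) \<or> inj (\<lambda>v. Q (Y' u0 v)))"
    then have ab: "Im (cnj a * b) = 0" and cd: "Im (cnj c * d) = 0"
      unfolding inj_plane_to_complex_iff[OF linP] inj_plane_to_complex_iff[OF linQ]
      by (auto simp: a_def b_def c_def d_def)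
    have r: "a * d = b * c" using rel[OF u0C] by (simp add: a_def b_def c_def d_def)
    have *: "w = 0" if "P (Y' u0 w) = 0" "Q (Y' u0 w) = 0" for w
      using joint[OF that] inj lin by (metis injD linear_0)
    have e1: "\<not> (a = 0 \<and> c = 0)" using *[of "axis 1 1"] by (auto simp: a_def c_def axis_eq_0_iff)
    have e2: "\<not> (b = t *\<^sub>R a \<and> d = t *\<^sub>R c)" for t
    proof
      assume t: "b = t *\<^sub>R a \<and> d = t *\<^sub>R c"
      have "axis 2 1 - t *\<^sub>R axis 1 1 = (0 :: real^2)"
        using t by (intro *) (simp_all add: linear_diff[OF linP] linear_scale[OF linP] linear_diff[OF linQ]
            linear_scale[OF linQ] a_def b_def c_def d_def)
      then have "(axis 2 1 - t *\<^sub>R axis 1 1 :: real^2) $ 2 = 0" by simp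
      then show False by (simp add: axis_def)
    qed
    have scale: "y = (Re (cnj x * y) / (cmod x)^2) *\<^sub>R x" if "Im (cnj x * y) = 0" "x \<noteq> 0" for x y
    proof -
      have "of_real (Re (cnj x * y)) = cnj x * y" using that(1) by (simp add: complex_eq_iff)
      then have "of_real (Re (cnj x * y)) * x = of_real ((cmod x)^2) * y"
        using complex_norm_square[of x] by (simp add: mult.commute mult.left_commute)
      then show ?thesis using that(2) by (simp add: scaleR_conv_of_real field_simps)
    qed
    show False
    proof (cases "a = 0")
      case False
      define t where "t = Re (cnj a * b) / (cmod a)^2"
      have "b = t *\<^sub>R a" unfolding t_def by (rule scale[OF ab False])
      moreover have "d = t *\<^sub>R c" using r False calculation by (simp add: scaleR_conv_of_real)
      ultimately show False using e2 by blast
    next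
      case True
      then have "c \<noteq> 0" using e1 by simp
      moreover have "b = 0" using r True \<open>c \<noteq> 0\<close> by simp
      ultimately show False using e2[of "Re (cnj c * d) / (cmod c)^2"] scale[OF cd] True by simp
    qed
  qed
  then show ?thesis
  proof
    assume "inj (\<lambda>v. P (Y' u0 v))"
    then show ?thesis using that[OF bl joint rel] by simp
  next
    assume "inj (\<lambda>v. Q (Y' u0 v))"
    moreover have "Q (E1 u) * P (E2 u) = Q (E2 u) * P (E1 u)" if "u \<in> C" for u
      using rel[OF that] by (simp add: mult.commute)
    ultimately show ?thesis using that[OF bl(2) bl(1)] joint by blast
  qed
qed

text \<open>On a smaller disc \<zeta> = \<open>P \<circ> Y\<close> is a coordinate and the tangent
  plane is the complex line of slope \<open>G\<close>, the derivative g' of the overview. Tangency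
  of the position vector thereby becomes the scalar equation \<eta> = G \<zeta>.\<close>

lemma tangent_graph:
  obtains P Q :: "complex^2 \<Rightarrow> complex" and G :: "real^2 \<Rightarrow> complex" and G' r where "bounded_linear P" "bounded_linear Q" "0 < r" "r \<le> \<rho>"
    "inj (\<lambda>v. P (Y' u0 v))" "inj_on (\<lambda>u. P (Y u)) (ball u0 r)"
    "\<And>u. u \<in> ball u0 r \<Longrightarrow> (G has_derivative G' u) (at u)"
    "\<And>u v. u \<in> ball u0 r \<inter> half_plane \<Longrightarrow> Q (Y' u v) = G u * P (Y' u v)"
    "\<And>u. u \<in> ball u0 r \<inter> half_plane \<Longrightarrow> range (Y' u) = {x. Q x = G u * P x}"
proof -
  obtain P Q :: "complex^2 \<Rightarrow> complex" where P: "bounded_linear P" and Q: "bounded_linear Q"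
    and joint: "\<And>v. P v = 0 \<Longrightarrow> Q v = 0 \<Longrightarrow> v = 0"
    and rel: "\<And>u. u \<in> C \<Longrightarrow> P (E1 u) * Q (E2 u) = P (E2 u) * Q (E1 u)"
    and inj: "inj (\<lambda>v. P (Y' u0 v))" using rotated_coordinates by blast
  have u0B: "u0 \<in> ball u0 \<rho>" using \<rho> by simp
  have linPY: "linear (\<lambda>v. P (Y' u v))" and linQY: "linear (\<lambda>v. Q (Y' u v))" if "u \<in> ball u0 \<rho>" for u
    using linear_compose[OF linear_Y'[OF that] bounded_linear.linear[OF P]]
      linear_compose[OF linear_Y'[OF that] bounded_linear.linear[OF Q]] by (simp_all add: o_def)
  have dP: "((\<lambda>u. P (Y' u w)) has_derivative (\<lambda>v. P (Y'' u v w))) (at u)"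
   and dQ: "((\<lambda>u. Q (Y' u w)) has_derivative (\<lambda>v. Q (Y'' u v w))) (at u)" if "u \<in> ball u0 \<rho>" for u w
    using bounded_linear.has_derivative[OF P dY'[OF that]] bounded_linear.has_derivative[OF Q dY'[OF that]] by auto
  have contP: "continuous_on (ball u0 \<rho>) (\<lambda>u. P (Y' u w))" for w
    using dP by (auto intro!: continuous_at_imp_continuous_on has_derivative_continuous)
  \<comment> \<open>The Jacobian determinant of \<open>P \<circ> Y\<close>: nonzero at
    \<open>u0\<close>, hence on a neighbourhood.\<close>
  define j where "j u = Im (cnj (P (E1 u)) * P (E2 u))" for u
  have "continuous_on (ball u0 \<rho>) j" unfolding j_def by (intro continuous_intros contP)
  then have "open (ball u0 \<rho> \<inter> j -` (- {0}))" by (rule continuous_open_preimage) auto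
  moreover have "u0 \<in> ball u0 \<rho> \<inter> j -` (- {0})"
    using inj u0B unfolding inj_plane_to_complex_iff[OF linPY[OF u0B]] by (simp add: j_def)
  ultimately obtain r1 where r1: "r1 > 0" "ball u0 r1 \<subseteq> ball u0 \<rho> \<inter> j -` (- {0})" by (rule openE)
  obtain W O' g where W: "open W" "W \<subseteq> ball u0 \<rho>" "u0 \<in> W" "homeomorphism W O' (\<lambda>u. P (Y u)) g"
    by (rule inverse_function_directional[OF _ open_ball u0B bounded_linear.has_derivative[OF P dY] contP inj])
      (simp, assumption, blast)
  obtain r2 where r2: "r2 > 0" "ball u0 r2 \<subseteq> W" using W(1,3) openE by blast
  define r where "r = min \<rho> (min r1 r2)"
  have r: "0 < r" "r \<le> \<rho>" "ball u0 r \<subseteq> ball u0 r1" "ball u0 r \<subseteq> ball u0 r2" using \<rho> r1 r2 by (auto simp: r_def)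
  have rB: "u \<in> ball u0 \<rho>" if "u \<in> ball u0 r" for u using that r(2) by auto
  have injP: "inj (\<lambda>v. P (Y' u v))" if "u \<in> ball u0 r" for u
    unfolding inj_plane_to_complex_iff[OF linPY[OF rB[OF that]]]
    using subsetD[OF r1(2) subsetD[OF r(3) that]] by (simp add: j_def)
  have P0: "P (E1 u) \<noteq> 0" if "u \<in> ball u0 r" for u
    using injP[OF that] unfolding inj_plane_to_complex_iff[OF linPY[OF rB[OF that]]] by auto
  define G where "G u = Q (E1 u) / P (E1 u)" for u
  define G' where "G' u v = (Q (Y'' u v (axis 1 1)) * P (E1 u) - Q (E1 u) * P (Y'' u v (axis 1 1)))
      / (P (E1 u) * P (E1 u))" for u v
  have dG: "(G has_derivative G' u) (at u)" if "u \<in> ball u0 r" for u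
    unfolding G_def[abs_def] G'_def[abs_def]
    by (rule has_derivative_divide'[OF dQ dP P0]) (use that rB in auto)
  have v: "v = v $ 1 *\<^sub>R axis 1 1 + v $ 2 *\<^sub>R axis 2 1" for v :: "real^2"
    by (simp add: vec_eq_iff forall_2 axis_def)
  have G: "Q (Y' u v) = G u * P (Y' u v)" if u: "u \<in> ball u0 r \<inter> half_plane" for u v
  proof -
    have uB: "u \<in> ball u0 \<rho>" and uC: "u \<in> C" and ur: "u \<in> ball u0 r" using u rB by auto
    have 1: "Q (E1 u) = G u * P (E1 u)" using P0[OF ur] by (simp add: G_def)
    have 2: "Q (E2 u) = G u * P (E2 u)"
      using P0[OF ur] rel[OF uC] by (simp add: G_def field_simps)
    have "Q (Y' u v) = v $ 1 *\<^sub>R Q (E1 u) + v $ 2 *\<^sub>R Q (E2 u)"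
      by (subst v) (simp only: linear_add[OF linQY[OF uB]] linear_scale[OF linQY[OF uB]])
    moreover have "P (Y' u v) = v $ 1 *\<^sub>R P (E1 u) + v $ 2 *\<^sub>R P (E2 u)"
      by (subst v) (simp only: linear_add[OF linPY[OF uB]] linear_scale[OF linPY[OF uB]])
    ultimately show ?thesis using 1 2 by (simp add: algebra_simps)
  qed
  have T: "range (Y' u) = {x. Q x = G u * P x}" if u: "u \<in> ball u0 r \<inter> half_plane" for u
  proof
    show "range (Y' u) \<subseteq> {x. Q x = G u * P x}" using G[OF u] by auto
    \<comment> \<open>A tangent vector with the same \<open>P\<close> value exists because
      \<open>P\<close> is onto from the plane; the difference is then killed by both
      \<open>P\<close> and \<open>Q\<close>.\<close>
    show "{x. Q x = G u * P x} \<subseteq> range (Y' u)"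
    proof clarify
      fix x assume x: "Q x = G u * P x"
      have ur: "u \<in> ball u0 r" using u by simp
      have "surj (\<lambda>v. P (Y' u v))"
        using linear_injective_imp_surjective[OF linPY[OF rB[OF ur]] injP[OF ur]] by simp
      then obtain v where "P x = P (Y' u v)" by (rule surjE)
      then have "P (x - Y' u v) = 0" "Q (x - Y' u v) = 0"
        using G[OF u, of v] x by (simp_all add: linear_diff[OF bounded_linear.linear[OF P]] linear_diff[OF bounded_linear.linear[OF Q]])
      then have "x - Y' u v = 0" by (rule joint)
      then show "x \<in> range (Y' u)" by auto
    qed
  qed
  have "inj_on (\<lambda>u. P (Y u)) (ball u0 r)"
    using homeomorphism_apply1[OF W(4)] subset_trans[OF r(4) r2(2)] by (intro inj_on_inverseI[where g = g]) blast
  then show ?thesis by (rule that[OF P Q r(1,2) inj _ dG G T])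
qed

text \<open>In the coordinates of \<open>tangent_graph\<close>, this is
  \<open>half_plane_unique_continuation\<close> for \<eta> - G \<zeta>.\<close>

lemma tangent_position_propagates:
  assumes bdry: "\<And>u. u \<in> ball u0 \<rho> \<Longrightarrow> u $ 2 = 0 \<Longrightarrow> Y u \<in> range (Y' u)"
    and acc: "\<And>\<delta>. \<delta> > 0 \<Longrightarrow> \<exists>N. open N \<and> N \<noteq> {} \<and> N \<subseteq> ball u0 \<delta> \<and> (\<forall>u\<in>N \<inter> half_plane. Y u \<in> range (Y' u))"
  shows "\<exists>d>0. d \<le> \<rho> \<and> (\<forall>u\<in>ball u0 d \<inter> half_plane. Y u \<in> range (Y' u))"
proof -
  obtain P Q :: "complex^2 \<Rightarrow> complex" and G :: "real^2 \<Rightarrow> complex" and G' r where P: "bounded_linear P" and Q: "bounded_linear Q" and r: "0 < r" "r \<le> \<rho>"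
    and inj: "inj (\<lambda>v. P (Y' u0 v))" and inj_on: "inj_on (\<lambda>u. P (Y u)) (ball u0 r)"
    and dG: "\<And>u. u \<in> ball u0 r \<Longrightarrow> (G has_derivative G' u) (at u)"
    and G: "\<And>u v. u \<in> ball u0 r \<inter> half_plane \<Longrightarrow> Q (Y' u v) = G u * P (Y' u v)"
    and T: "\<And>u. u \<in> ball u0 r \<inter> half_plane \<Longrightarrow> range (Y' u) = {x. Q x = G u * P x}"
    by (rule tangent_graph) (rule that)
  have rB: "u \<in> ball u0 \<rho>" if "u \<in> ball u0 r" for u using that r(2) by auto
  have "\<exists>d>0. \<forall>u\<in>ball u0 d \<inter> half_plane. Q (Y u) = G u * P (Y u)"
  proof (rule half_plane_unique_continuation[OF open_ball, where \<zeta>' = "\<lambda>u v. P (Y' u v)" and \<eta>' = "\<lambda>u v. Q (Y' u v)"])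
    show "u0 \<in> ball u0 r" using r by simp
    show "((\<lambda>u. P (Y u)) has_derivative (\<lambda>v. P (Y' u v))) (at u)"
      "((\<lambda>u. Q (Y u)) has_derivative (\<lambda>v. Q (Y' u v))) (at u)" if "u \<in> ball u0 r" for u
      using bounded_linear.has_derivative[OF P dY] bounded_linear.has_derivative[OF Q dY] rB[OF that] by auto
    show "continuous_on (ball u0 r) (\<lambda>u. P (Y' u v))" for v
    proof (rule continuous_at_imp_continuous_on, rule ballI)
      fix u assume "u \<in> ball u0 r"
      from has_derivative_continuous[OF bounded_linear.has_derivative[OF P dY'[OF rB[OF this]]]]
      show "isCont (\<lambda>u. P (Y' u v)) u" .
    qed
    show "continuous_on (ball u0 r) G"
      using dG by (auto intro!: continuous_at_imp_continuous_on has_derivative_continuous)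
    show "Q (Y u) = G u * P (Y u)" if "u \<in> ball u0 r" "u $ 2 = 0" for u
      using bdry[OF rB[OF that(1)] that(2)] T[of u] that by (auto simp: half_plane_def)
    show "\<exists>N. open N \<and> N \<noteq> {} \<and> N \<subseteq> ball u0 \<delta> \<and> (\<forall>u\<in>N \<inter> half_plane. Q (Y u) = G u * P (Y u))"
      if \<delta>: "\<delta> > 0" for \<delta>
    proof -
      obtain N where N: "open N" "N \<noteq> {}" "N \<subseteq> ball u0 (min \<delta> r)" "\<forall>u\<in>N \<inter> half_plane. Y u \<in> range (Y' u)"
        using acc[of "min \<delta> r"] \<delta> r by auto
      then have "Q (Y u) = G u * P (Y u)" if "u \<in> N \<inter> half_plane" for u
      proof -
        have "u \<in> ball u0 r" using subsetD[OF N(3), of u] that by simp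
        then show ?thesis using T[of u] N(4) that by auto
      qed
      then show ?thesis using N by (intro exI[of _ N]) auto
    qed
  qed (use inj G in auto)
  then obtain d where d: "d > 0" "\<forall>u\<in>ball u0 d \<inter> half_plane. Q (Y u) = G u * P (Y u)" by blast
  then have "\<forall>u\<in>ball u0 (min d r) \<inter> half_plane. Y u \<in> range (Y' u)" using T by auto
  then show ?thesis using d r by (intro exI[of _ "min d r"]) auto
qed

text \<open>The tangent plane is determined by the slope \<open>G\<close>, which
  \<open>half_plane_slope_constant\<close> shows to be constant.\<close>

lemma tangent_plane_constant_if_tangent_position:
  assumes "d > 0" and tan: "\<And>u. u \<in> ball u0 d \<inter> half_plane \<Longrightarrow> Y u \<in> range (Y' u)"
  shows "\<exists>s>0. s \<le> \<rho> \<and> (\<forall>u\<in>ball u0 s \<inter> half_plane. range (Y' u) = range (Y' u0))"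
proof -
  obtain P Q :: "complex^2 \<Rightarrow> complex" and G :: "real^2 \<Rightarrow> complex" and G' r where P: "bounded_linear P" and Q: "bounded_linear Q" and r: "0 < r" "r \<le> \<rho>"
    and inj: "inj (\<lambda>v. P (Y' u0 v))" and inj_on: "inj_on (\<lambda>u. P (Y u)) (ball u0 r)"
    and dG: "\<And>u. u \<in> ball u0 r \<Longrightarrow> (G has_derivative G' u) (at u)"
    and G: "\<And>u v. u \<in> ball u0 r \<inter> half_plane \<Longrightarrow> Q (Y' u v) = G u * P (Y' u v)"
    and T: "\<And>u. u \<in> ball u0 r \<inter> half_plane \<Longrightarrow> range (Y' u) = {x. Q x = G u * P x}"
    by (rule tangent_graph) (rule that)
  define s where "s = min d r"
  have s: "0 < s" "s \<le> d" "s \<le> r" using assms(1) r by (auto simp: s_def)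
  have sB: "u \<in> ball u0 \<rho>" "u \<in> ball u0 r" "u \<in> ball u0 r \<inter> half_plane" "u \<in> ball u0 d \<inter> half_plane"
    if "u \<in> ball u0 s \<inter> half_plane" for u
    using that s r by auto
  have "G u = G u0" if u: "u \<in> ball u0 s \<inter> half_plane" for u
  proof (rule half_plane_slope_constant[where \<zeta> = "\<lambda>u. P (Y u)" and \<eta> = "\<lambda>u. Q (Y u)" and
        \<zeta>' = "\<lambda>u v. P (Y' u v)" and \<eta>' = "\<lambda>u v. Q (Y' u v)" and G' = G'])
    show "convex (ball u0 s \<inter> half_plane)" by (intro convex_Int convex_half_plane) simp
    show "openin (top_of_set half_plane) (ball u0 s \<inter> half_plane)" by (simp add: openin_open_Int inf_commute)
    show "inj_on (\<lambda>u. P (Y u)) (ball u0 s \<inter> half_plane)" by (rule inj_on_subset[OF inj_on]) (use sB in blast)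
    show "((\<lambda>u. P (Y u)) has_derivative (\<lambda>v. P (Y' u v))) (at u)"
      "((\<lambda>u. Q (Y u)) has_derivative (\<lambda>v. Q (Y' u v))) (at u)" if "u \<in> ball u0 s \<inter> half_plane" for u
      using bounded_linear.has_derivative[OF P dY] bounded_linear.has_derivative[OF Q dY] sB[OF that] by auto
    show "Q (Y u) = G u * P (Y u)" if "u \<in> ball u0 s \<inter> half_plane" for u
      using tan[OF sB(4)[OF that]] T[OF sB(3)[OF that]] by auto
    show "u0 \<in> ball u0 s \<inter> half_plane" using u0 s by simp
  qed (use u dG G sB in \<open>auto simp del: mem_ball\<close>)
  then have "range (Y' u) = range (Y' u0)" if u: "u \<in> ball u0 s \<inter> half_plane" for u
    using T[OF sB(3)[OF u]] T[of u0] u0 r u by auto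
  then show ?thesis using s r by (intro exI[of _ s]) auto
qed

end

section \<open>Charts\<close>

text \<open>Cramer's rule: the determinant turns the inverse into the adjugate and so clears the
  denominators in the mean curvature.\<close>

lemma matrix_inv_2_contraction:
  fixes g :: "real^2^2" and b :: "2 \<Rightarrow> 2 \<Rightarrow> real"
  assumes det: "g $ 1 $ 1 * g $ 2 $ 2 - g $ 1 $ 2 * g $ 2 $ 1 \<noteq> 0"
  shows "(g $ 1 $ 1 * g $ 2 $ 2 - g $ 1 $ 2 * g $ 2 $ 1) * (\<Sum>i\<in>UNIV. \<Sum>j\<in>UNIV. matrix_inv g $ i $ j * b i j) =
    g $ 2 $ 2 * b 1 1 - g $ 1 $ 2 * b 1 2 - g $ 2 $ 1 * b 2 1 + g $ 1 $ 1 * b 2 2"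
proof -
  define d where "d = g $ 1 $ 1 * g $ 2 $ 2 - g $ 1 $ 2 * g $ 2 $ 1"
  define A :: "real^2^2" where
    "A = (\<chi> i j. (if i = j then (if i = 1 then g $ 2 $ 2 else g $ 1 $ 1) else - (g $ i $ j)) / d)"
  have "d \<noteq> 0" using det by (simp add: d_def)
  then have "g ** A = mat 1 \<and> A ** g = mat 1"
    by (simp add: vec_eq_iff forall_2 matrix_matrix_mult_def sum_2 A_def mat_def divide_simps) (simp add: d_def algebra_simps)
  then have "g ** matrix_inv g = mat 1"
    unfolding matrix_inv_def by (rule someI2) simp
  then have eqs: "g $ 1 $ 1 * matrix_inv g $ 1 $ 1 + g $ 1 $ 2 * matrix_inv g $ 2 $ 1 = 1"
    "g $ 1 $ 1 * matrix_inv g $ 1 $ 2 + g $ 1 $ 2 * matrix_inv g $ 2 $ 2 = 0"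
    "g $ 2 $ 1 * matrix_inv g $ 1 $ 1 + g $ 2 $ 2 * matrix_inv g $ 2 $ 1 = 0"
    "g $ 2 $ 1 * matrix_inv g $ 1 $ 2 + g $ 2 $ 2 * matrix_inv g $ 2 $ 2 = 1"
    by (simp_all add: vec_eq_iff forall_2 matrix_matrix_mult_def sum_2 mat_def)
  have "d * matrix_inv g $ 1 $ 1 = g $ 2 $ 2 * (g $ 1 $ 1 * matrix_inv g $ 1 $ 1 + g $ 1 $ 2 * matrix_inv g $ 2 $ 1)
      - g $ 1 $ 2 * (g $ 2 $ 1 * matrix_inv g $ 1 $ 1 + g $ 2 $ 2 * matrix_inv g $ 2 $ 1)"
    "d * matrix_inv g $ 1 $ 2 = g $ 2 $ 2 * (g $ 1 $ 1 * matrix_inv g $ 1 $ 2 + g $ 1 $ 2 * matrix_inv g $ 2 $ 2)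
      - g $ 1 $ 2 * (g $ 2 $ 1 * matrix_inv g $ 1 $ 2 + g $ 2 $ 2 * matrix_inv g $ 2 $ 2)"
    "d * matrix_inv g $ 2 $ 1 = g $ 1 $ 1 * (g $ 2 $ 1 * matrix_inv g $ 1 $ 1 + g $ 2 $ 2 * matrix_inv g $ 2 $ 1)
      - g $ 2 $ 1 * (g $ 1 $ 1 * matrix_inv g $ 1 $ 1 + g $ 1 $ 2 * matrix_inv g $ 2 $ 1)"
    "d * matrix_inv g $ 2 $ 2 = g $ 1 $ 1 * (g $ 2 $ 1 * matrix_inv g $ 1 $ 2 + g $ 2 $ 2 * matrix_inv g $ 2 $ 2)
      - g $ 2 $ 1 * (g $ 1 $ 1 * matrix_inv g $ 1 $ 2 + g $ 1 $ 2 * matrix_inv g $ 2 $ 2)"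
    by (simp_all add: d_def algebra_simps)
  then have "d * matrix_inv g $ 1 $ 1 = g $ 2 $ 2" "d * matrix_inv g $ 1 $ 2 = - g $ 1 $ 2"
    "d * matrix_inv g $ 2 $ 1 = - g $ 2 $ 1" "d * matrix_inv g $ 2 $ 2 = g $ 1 $ 1"
    unfolding eqs by simp_all
  then show ?thesis unfolding d_def[symmetric]
    by (simp add: sum_2 distrib_left mult.assoc[symmetric])
qed

text \<open>The definite description denotes: orthogonal decomposition gives existence, and a
  subspace meets its complement only in 0.\<close>

lemma normal_part_works:
  assumes "subspace T"
  shows "normal_part T v \<in> orthogonal_comp T" "v - normal_part T v \<in> T"
proof -
  have "\<exists>!n. n \<in> orthogonal_comp T \<and> v - n \<in> T"
  proof (rule ex_ex1I)
    obtain y z where yz: "y \<in> span T" "\<And>w. w \<in> span T \<Longrightarrow> orthogonal z w" "v = y + z"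
      using orthogonal_subspace_decomp_exists by blast
    have "span T = T" using assms by (simp add: span_eq_iff)
    then show "\<exists>n. n \<in> orthogonal_comp T \<and> v - n \<in> T"
      using yz(1)[unfolded \<open>span T = T\<close>] yz(3) yz(2)[unfolded \<open>span T = T\<close>]
      by (intro exI[of _ z]) (auto simp: orthogonal_comp_def orthogonal_commute)
  next
    fix n m assume n: "n \<in> orthogonal_comp T \<and> v - n \<in> T" and m: "m \<in> orthogonal_comp T \<and> v - m \<in> T"
    have "(v - m) - (v - n) \<in> T" using subspace_diff[OF assms] n m by blast
    then have "n - m \<in> T" by simp
    moreover have "n - m \<in> orthogonal_comp T" using subspace_diff[OF subspace_orthogonal_comp] n m by blast
    ultimately have "orthogonal (n - m) (n - m)" by (simp add: orthogonal_comp_def)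
    then show "n = m" by (simp add: orthogonal_self)
  qed
  from theI'[OF this] show "normal_part T v \<in> orthogonal_comp T" "v - normal_part T v \<in> T"
    unfolding normal_part_def by auto
qed

section \<open>From charts to smooth local extensions\<close>

lemma Ck_on_subset: "Ck_on k f V \<Longrightarrow> U \<subseteq> V \<Longrightarrow> Ck_on k f U"
  by (induction k arbitrary: f) (auto intro: continuous_on_subset)

text \<open>\<open>frechet_derivative\<close> within a set is a choice; uniqueness on relatively
  open subsets of the half-plane identifies it with the derivative of any local extension.\<close>

lemma half_plane_frechet_derivative:
  assumes W: "openin (top_of_set half_plane) W" "u \<in> W"
    and g: "(g has_derivative D) (at u)"
    and eq: "d > 0" "\<And>u'. u' \<in> W \<Longrightarrow> dist u' u < d \<Longrightarrow> f u' = g u'"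
  shows "frechet_derivative f (at u within W) = D"
proof -
  have f: "(f has_derivative D) (at u within W)"
    by (rule has_derivative_transform_within[OF has_derivative_at_withinI[OF g] eq(1) W(2)]) (simp add: eq(2))
  then have "(f has_derivative frechet_derivative f (at u within W)) (at u within W)"
    using frechet_derivative_works differentiable_def by blast
  from half_plane_derivative_unique[OF W this f] show ?thesis .
qed

lemma smooth_surface_chart:
  assumes "smooth_surface S \<A>" "c \<in> \<A>"
  shows "openin S (fst c)" "openin (top_of_set half_plane) (coord_image c)"
    "inj_on (snd c) (fst c)"
    "\<And>U. openin S U \<Longrightarrow> U \<subseteq> fst c \<Longrightarrow> openin (top_of_set half_plane) (snd c ` U)"
    "\<And>N. openin (top_of_set half_plane) N \<Longrightarrow> openin S {q \<in> fst c. snd c q \<in> N}"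
proof -
  have c: "openin S (fst c)" "openin (top_of_set half_plane) (coord_image c)"
    "homeomorphic_map (subtopology S (fst c)) (top_of_set (coord_image c)) (snd c)"
    using assms unfolding smooth_surface_def surface_chart_def by auto
  have ts: "topspace (subtopology S (fst c)) = fst c" using openin_subset[OF c(1)] by auto
  show "openin S (fst c)" "openin (top_of_set half_plane) (coord_image c)" by fact+
  show "inj_on (snd c) (fst c)" using homeomorphic_imp_injective_map[OF c(3)] unfolding ts .
  show "openin (top_of_set half_plane) (snd c ` U)" if "openin S U" "U \<subseteq> fst c" for U
  proof -
    have "openin (subtopology S (fst c)) U" using that by (simp add: openin_open_subtopology[OF c(1)])
    then have "openin (top_of_set (coord_image c)) (snd c ` U)"
      using homeomorphic_imp_open_map[OF c(3)] by (simp add: open_map_def)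
    then show ?thesis using openin_trans c(2) by blast
  qed
  show "openin S {q \<in> fst c. snd c q \<in> N}" if N: "openin (top_of_set half_plane) N" for N
  proof -
    have "openin (top_of_set (coord_image c)) (coord_image c \<inter> N)"
      using N openin_subset[OF c(2)] by (auto simp: openin_open)
    then have "openin (subtopology S (fst c)) {q \<in> topspace (subtopology S (fst c)). snd c q \<in> coord_image c \<inter> N}"
      using homeomorphic_imp_continuous_map[OF c(3)] openin_continuous_map_preimage by blast
    moreover have "{q \<in> topspace (subtopology S (fst c)). snd c q \<in> coord_image c \<inter> N} = {q \<in> fst c. snd c q \<in> N}"
      unfolding ts by (auto simp: coord_image_def)
    ultimately show ?thesis using c(1) openin_trans_full by force
  qed
qed

lemma coord_rep_apply:
  assumes "smooth_surface S \<A>" "c \<in> \<A>" "q \<in> fst c"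
  shows "coord_rep c f (snd c q) = f q"
  using smooth_surface_chart(3)[OF assms(1,2)] assms(3) by (simp add: coord_rep_def)

text \<open>Replaces derivatives within the coordinate image by ordinary derivatives of one smooth
  map on a full ball, uniformly for all nearby points, so that they can be differentiated
  again.\<close>

lemma immersion_local_extension:
  assumes S: "smooth_surface S \<A>" and imm: "immersion \<A> x" and c: "c \<in> \<A>" and p: "p \<in> fst c"
  obtains Y \<rho> where "\<rho> > 0" "\<And>k. Ck_on k Y (ball (snd c p) \<rho>)"
    "\<And>u. u \<in> ball (snd c p) \<rho> \<inter> half_plane \<Longrightarrow> u \<in> coord_image c"
    "\<And>u. u \<in> ball (snd c p) \<rho> \<inter> half_plane \<Longrightarrow> coord_rep c x u = Y u"
    "\<And>q. q \<in> fst c \<Longrightarrow> snd c q \<in> ball (snd c p) \<rho> \<Longrightarrow> x q = Y (snd c q)"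
    "\<And>q. q \<in> fst c \<Longrightarrow> snd c q \<in> ball (snd c p) \<rho> \<Longrightarrow>
      differential c x q = frechet_derivative Y (at (snd c q))"
proof -
  let ?u0 = "snd c p"
  have W: "openin (top_of_set half_plane) (coord_image c)" by (rule smooth_surface_chart(2)[OF S c])
  have u0: "?u0 \<in> coord_image c" using p by (simp add: coord_image_def)
  have "smooth_on (coord_image c) (coord_rep c x)" using imm c by (simp add: immersion_def)
  then obtain V Y where V: "open V" "?u0 \<in> V" "\<And>k. Ck_on k Y V" "\<And>u. u \<in> coord_image c \<inter> V \<Longrightarrow> Y u = coord_rep c x u"
    using u0 unfolding smooth_on_def by metis
  obtain r1 where r1: "r1 > 0" "ball ?u0 r1 \<subseteq> V" using V(1,2) by (rule openE)
  obtain r2 where r2: "r2 > 0" "ball ?u0 r2 \<inter> half_plane \<subseteq> coord_image c"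
    using W u0 unfolding openin_contains_ball by blast
  define \<rho> where "\<rho> = min r1 r2"
  have \<rho>: "\<rho> > 0" "ball ?u0 \<rho> \<subseteq> V" "ball ?u0 \<rho> \<inter> half_plane \<subseteq> coord_image c"
    using r1 r2 by (auto simp: \<rho>_def)
  have hp: "coord_image c \<subseteq> half_plane" using openin_subset[OF W] by simp
  show ?thesis
  proof (rule that[OF \<rho>(1)])
    show "Ck_on k Y (ball ?u0 \<rho>)" for k using Ck_on_subset[OF V(3) \<rho>(2)] .
    show in_c: "u \<in> coord_image c" if "u \<in> ball ?u0 \<rho> \<inter> half_plane" for u using \<rho>(3) that by blast
    show "coord_rep c x u = Y u" if "u \<in> ball ?u0 \<rho> \<inter> half_plane" for u
      using V(4)[of u] in_c[OF that] \<rho>(2) that by auto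
    fix q assume q: "q \<in> fst c" "snd c q \<in> ball ?u0 \<rho>"
    have qc: "snd c q \<in> coord_image c" using q by (simp add: coord_image_def)
    show "x q = Y (snd c q)"
      using V(4)[of "snd c q"] qc q \<rho>(2) coord_rep_apply[OF S c q(1), of x] by auto
    have "\<forall>u\<in>V. Y differentiable at u" using V(3)[of 1] by simp
    then have dY: "(Y has_derivative frechet_derivative Y (at (snd c q))) (at (snd c q))"
      using q(2) \<rho>(2) frechet_derivative_works by blast
    obtain d where d: "d > 0" "ball (snd c q) d \<subseteq> ball ?u0 \<rho>" using q(2) open_ball openE by blast
    show "differential c x q = frechet_derivative Y (at (snd c q))"
      unfolding differential_def
    proof (rule half_plane_frechet_derivative[OF W qc dY d(1)])
      fix u' assume "u' \<in> coord_image c" "dist u' (snd c q) < d"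
      moreover from this have "u' \<in> V" using d(2) \<rho>(2) by (metis dist_commute mem_ball subsetD)
      ultimately show "coord_rep c x u' = Y u'" using V(4)[of u'] by simp
    qed
  qed
qed

text \<open>The chain rule for the transition map \<tau>, since \<open>Y\<close> and
  \<open>Z \<circ> \<tau>\<close> agree on the overlap. Exchanging the charts gives the reverse
  inclusion.\<close>

lemma tangent_plane_subset_of_chart_change:
  assumes S: "smooth_surface S \<A>" and imm: "immersion \<A> x"
    and c: "c \<in> \<A>" "p \<in> fst c" and d: "d \<in> \<A>" "p \<in> fst d"
  shows "tangent_plane c x p \<subseteq> tangent_plane d x p"
proof -
  let ?u = "snd c p" and ?w = "snd d p"
  obtain Y \<rho> where Y: "\<rho> > 0" "\<And>k. Ck_on k Y (ball ?u \<rho>)"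
    "\<And>u. u \<in> ball ?u \<rho> \<inter> half_plane \<Longrightarrow> coord_rep c x u = Y u"
    "\<And>q. q \<in> fst c \<Longrightarrow> snd c q \<in> ball ?u \<rho> \<Longrightarrow> x q = Y (snd c q)"
    "\<And>q. q \<in> fst c \<Longrightarrow> snd c q \<in> ball ?u \<rho> \<Longrightarrow> differential c x q = frechet_derivative Y (at (snd c q))"
    using immersion_local_extension[OF S imm c] by metis
  obtain Z \<sigma> where Z: "\<sigma> > 0" "\<And>k. Ck_on k Z (ball ?w \<sigma>)"
    "\<And>q. q \<in> fst d \<Longrightarrow> snd d q \<in> ball ?w \<sigma> \<Longrightarrow> x q = Z (snd d q)"
    "\<And>q. q \<in> fst d \<Longrightarrow> snd d q \<in> ball ?w \<sigma> \<Longrightarrow> differential d x q = frechet_derivative Z (at (snd d q))"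
    using immersion_local_extension[OF S imm d] by metis
  define O1 where "O1 = snd c ` (fst c \<inter> fst d)"
  have O1: "openin (top_of_set half_plane) O1" unfolding O1_def
    using smooth_surface_chart(1)[OF S c(1)] smooth_surface_chart(1)[OF S d(1)]
    by (intro smooth_surface_chart(4)[OF S c(1)] openin_Int) auto
  have uO1: "?u \<in> O1" using c d by (auto simp: O1_def)
  have "smooth_on O1 (coord_rep c (snd d))"
    using S c(1) d(1) unfolding smooth_surface_def smoothly_compatible_def O1_def by blast
  then obtain V \<tau> where V: "open V" "?u \<in> V" "\<And>k. Ck_on k \<tau> V" "\<And>u. u \<in> O1 \<inter> V \<Longrightarrow> \<tau> u = coord_rep c (snd d) u"
    using uO1 unfolding smooth_on_def by metis
  have \<tau>q: "\<tau> (snd c q) = snd d q" if "q \<in> fst c \<inter> fst d" "snd c q \<in> V" for q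
    using V(4)[of "snd c q"] that coord_rep_apply[OF S c(1), of q] by (auto simp: O1_def)
  have "\<forall>u\<in>V. \<tau> differentiable at u" using V(3)[of 1] by simp
  then have d\<tau>: "(\<tau> has_derivative frechet_derivative \<tau> (at ?u)) (at ?u)"
    using V(2) frechet_derivative_works by blast
  have \<tau>u: "\<tau> ?u = ?w" using \<tau>q[of p] c d V(2) by simp
  have "\<forall>u\<in>ball ?u \<rho>. Y differentiable at u" using Y(2)[of 1] by simp
  then have dY: "(Y has_derivative frechet_derivative Y (at ?u)) (at ?u)"
    using Y(1) frechet_derivative_works by (meson centre_in_ball)
  have "\<forall>u\<in>ball ?w \<sigma>. Z differentiable at u" using Z(2)[of 1] by simp
  then have dZ: "(Z has_derivative frechet_derivative Z (at ?w)) (at (\<tau> ?u))"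
    using Z(1) frechet_derivative_works \<tau>u by (metis centre_in_ball)
  have comp: "((\<lambda>u. Z (\<tau> u)) has_derivative (\<lambda>v. frechet_derivative Z (at ?w) (frechet_derivative \<tau> (at ?u) v))) (at ?u)"
    using has_derivative_compose[OF d\<tau> dZ] .
  have "isCont \<tau> ?u" using d\<tau> has_derivative_continuous by blast
  then obtain e1 where e1: "e1 > 0" "\<And>u. dist u ?u < e1 \<Longrightarrow> dist (\<tau> u) ?w < \<sigma>"
    using Z(1) \<tau>u unfolding continuous_at_eps_delta by metis
  obtain e2 where e2: "e2 > 0" "ball ?u e2 \<subseteq> V" using V(1,2) by (rule openE)
  define e where "e = min \<rho> (min e1 e2)"
  have e: "e > 0" using Y(1) e1 e2 by (simp add: e_def)
  have "(Y has_derivative (\<lambda>v. frechet_derivative Z (at ?w) (frechet_derivative \<tau> (at ?u) v))) (at ?u within O1)"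
  proof (rule has_derivative_transform_within[OF has_derivative_at_withinI[OF comp] e uO1])
    fix u assume u: "u \<in> O1" "dist u ?u < e"
    then obtain q where q: "q \<in> fst c" "q \<in> fst d" "u = snd c q" by (auto simp: O1_def)
    have uV: "u \<in> V" using u(2) e2(2) by (auto simp: e_def dist_commute)
    have "\<tau> u = snd d q" using \<tau>q[of q] q uV by simp
    moreover have "dist (\<tau> u) ?w < \<sigma>" using e1(2)[of u] u(2) by (simp add: e_def)
    ultimately have "x q = Z (\<tau> u)" using Z(3)[OF q(2)] by (simp add: dist_commute)
    moreover have "x q = Y u" using Y(4)[OF q(1)] q(3) u(2) by (simp add: e_def dist_commute)
    ultimately show "Z (\<tau> u) = Y u" by simp
  qed
  from half_plane_derivative_unique[OF O1 uO1 has_derivative_at_withinI[OF dY] this]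
  have "frechet_derivative Y (at ?u) = (\<lambda>v. frechet_derivative Z (at ?w) (frechet_derivative \<tau> (at ?u) v))" .
  then show ?thesis
    using Y(5)[OF c(2)] Z(4)[OF d(2)] Y(1) Z(1) by (auto simp: tangent_plane_def)
qed

lemma tangent_plane_chart_independent:
  assumes "smooth_surface S \<A>" "immersion \<A> x" "c \<in> \<A>" "p \<in> fst c" "d \<in> \<A>" "p \<in> fst d"
  shows "tangent_plane c x p = tangent_plane d x p"
  using tangent_plane_subset_of_chart_change[OF assms(1,2)] assms(3-) by blast

text \<open>Translates the chart hypotheses into the locale. All smaller radii are offered as well,
  because at an interior point the disc is later shrunk away from the boundary line.\<close>

lemma minimal_lagrangian_local_patch:
  assumes S: "smooth_surface S \<A>" and imm: "immersion \<A> x" and min: "minimal \<A> x" and lag: "lagrangian \<A> x"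
    and c: "c \<in> \<A>" and p: "p \<in> fst c"
  obtains Y Y' Y'' \<rho> where "\<rho> > 0" "\<And>r. 0 < r \<Longrightarrow> r \<le> \<rho> \<Longrightarrow> minimal_lagrangian_patch Y Y' Y'' (snd c p) r"
    "\<And>u. u \<in> ball (snd c p) \<rho> \<inter> half_plane \<Longrightarrow> u \<in> coord_image c"
    "\<And>q. q \<in> fst c \<Longrightarrow> snd c q \<in> ball (snd c p) \<rho> \<Longrightarrow> x q = Y (snd c q)"
    "\<And>q. q \<in> fst c \<Longrightarrow> snd c q \<in> ball (snd c p) \<rho> \<Longrightarrow> tangent_plane c x q = range (Y' (snd c q))"
proof -
  let ?u0 = "snd c p"
  obtain Y \<rho> where Y: "\<rho> > 0" "\<And>k. Ck_on k Y (ball ?u0 \<rho>)"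
    "\<And>u. u \<in> ball ?u0 \<rho> \<inter> half_plane \<Longrightarrow> u \<in> coord_image c"
    "\<And>u. u \<in> ball ?u0 \<rho> \<inter> half_plane \<Longrightarrow> coord_rep c x u = Y u"
    "\<And>q. q \<in> fst c \<Longrightarrow> snd c q \<in> ball ?u0 \<rho> \<Longrightarrow> x q = Y (snd c q)"
    "\<And>q. q \<in> fst c \<Longrightarrow> snd c q \<in> ball ?u0 \<rho> \<Longrightarrow> differential c x q = frechet_derivative Y (at (snd c q))"
    using immersion_local_extension[OF S imm c p] by metis
  define Y' where "Y' u = frechet_derivative Y (at u)" for u
  define Y'' where "Y'' u v w = frechet_derivative (\<lambda>u. Y' u w) (at u) v" for u v w
  have W: "openin (top_of_set half_plane) (coord_image c)" by (rule smooth_surface_chart(2)[OF S c])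
  have C2: "Ck_on 2 Y (ball ?u0 \<rho>)" by (rule Y(2))
  have dY: "(Y has_derivative Y' u) (at u)"
    and dY': "((\<lambda>u. Y' u w) has_derivative (\<lambda>v. Y'' u v w)) (at u)" if "u \<in> ball ?u0 \<rho>" for u w
    using C2 that unfolding Y'_def Y''_def numeral_2_eq_2 Ck_on.simps by (auto simp: frechet_derivative_works[symmetric] simp del: mem_ball)
  have cY'': "continuous_on (ball ?u0 \<rho>) (\<lambda>u. Y'' u v w)" for v w
    using C2 unfolding Y'_def Y''_def numeral_2_eq_2 Ck_on.simps by auto
  have ex_q: "\<exists>q. q \<in> fst c \<and> snd c q = u" if "u \<in> ball ?u0 \<rho> \<inter> half_plane" for u
    using Y(3)[OF that] by (auto simp: coord_image_def)
  have diff: "differential c x q = Y' (snd c q)" if "q \<in> fst c" "snd c q \<in> ball ?u0 \<rho>" for q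
    using Y(6)[OF that] by (simp add: Y'_def)
  have tp: "tangent_plane c x q = range (Y' (snd c q))" if "q \<in> fst c" "snd c q \<in> ball ?u0 \<rho>" for q
    using diff[OF that] by (simp add: tangent_plane_def)
  have inj: "inj (Y' u)" if u: "u \<in> ball ?u0 \<rho> \<inter> half_plane" for u
  proof -
    obtain q where q: "q \<in> fst c" "snd c q = u" using ex_q[OF u] by blast
    then have "inj (differential c x q)" using imm c by (auto simp: immersion_def)
    then show ?thesis using diff[OF q(1)] q u by simp
  qed
  have J_normal: "\<J> (Y' u w) \<in> orthogonal_comp (range (Y' u))" if u: "u \<in> ball ?u0 \<rho> \<inter> half_plane" for u w
  proof -
    obtain q where q: "q \<in> fst c" "snd c q = u" using ex_q[OF u] by blast
    then have "\<J> ` tangent_plane c x q = orthogonal_comp (tangent_plane c x q)"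
      using lag c by (auto simp: lagrangian_def)
    then show ?thesis using tp[OF q(1)] q u by auto
  qed
  have iso: "Y' u v \<bullet> \<J> (Y' u w) = 0" if u: "u \<in> ball ?u0 \<rho> \<inter> half_plane" for u v w
    using J_normal[OF u, of w] by (auto simp: orthogonal_comp_def orthogonal_def)
  have min_eq: "(Y' u (axis 2 1) \<bullet> Y' u (axis 2 1)) * (Y'' u (axis 1 1) (axis 1 1) \<bullet> \<J> (Y' u w))
      - (Y' u (axis 1 1) \<bullet> Y' u (axis 2 1)) * (Y'' u (axis 1 1) (axis 2 1) \<bullet> \<J> (Y' u w))
      - (Y' u (axis 2 1) \<bullet> Y' u (axis 1 1)) * (Y'' u (axis 2 1) (axis 1 1) \<bullet> \<J> (Y' u w))
      + (Y' u (axis 1 1) \<bullet> Y' u (axis 1 1)) * (Y'' u (axis 2 1) (axis 2 1) \<bullet> \<J> (Y' u w)) = 0"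
    if u: "u \<in> ball ?u0 \<rho> \<inter> half_plane" for u w
  proof -
    obtain q where q: "q \<in> fst c" "snd c q = u" using ex_q[OF u] by blast
    have uB: "u \<in> ball ?u0 \<rho>" and uc: "u \<in> coord_image c" using u Y(3) by auto
    have dq: "differential c x q = Y' u" using diff[OF q(1)] q(2) uB by simp
    have T: "tangent_plane c x q = range (Y' u)" using tp[OF q(1)] q(2) uB by simp
    have linY': "linear (Y' u)" using dY[OF uB] has_derivative_linear by blast
    have sub: "subspace (range (Y' u))" using linear_subspace_image[OF linY' subspace_UNIV] .
    obtain d where d: "d > 0" "ball u d \<subseteq> ball ?u0 \<rho>" using uB open_ball openE by blast
    \<comment> \<open>The first differential is again known through the extension on a whole
      neighbourhood, so it can be differentiated at \<open>u\<close>.\<close>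
    have second: "differential c (\<lambda>q. differential c x q b) q a = Y'' u a b" for a b
    proof -
      have "frechet_derivative (coord_rep c (\<lambda>q. differential c x q b)) (at u within coord_image c) = (\<lambda>v. Y'' u v b)"
      proof (rule half_plane_frechet_derivative[OF W uc dY'[OF uB] d(1)])
        fix u' assume u': "u' \<in> coord_image c" "dist u' u < d"
        then obtain q' where q': "q' \<in> fst c" "u' = snd c q'" by (auto simp: coord_image_def)
        have "u' \<in> ball ?u0 \<rho>" using u'(2) d(2) by (metis dist_commute mem_ball subsetD)
        then show "coord_rep c (\<lambda>q. differential c x q b) u' = Y' u' b"
          using coord_rep_apply[OF S c q'(1), of "\<lambda>q. differential c x q b"] diff[OF q'(1)] q'(2) by simp
      qed
      then show ?thesis unfolding differential_def[of c "\<lambda>q. differential c x q b"] q(2) by simp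
    qed
    let ?z = "\<J> (Y' u w)"
    \<comment> \<open>Since \<open>?z\<close> is normal, pairing with it makes the normal projection
      disappear from the second fundamental form.\<close>
    have np: "normal_part (range (Y' u)) v \<bullet> ?z = v \<bullet> ?z" for v
    proof -
      have "v - normal_part (range (Y' u)) v \<in> range (Y' u)" by (rule normal_part_works(2)[OF sub])
      then have "(v - normal_part (range (Y' u)) v) \<bullet> ?z = 0"
        using J_normal[OF u, of w] by (auto simp: orthogonal_comp_def orthogonal_def)
      then show ?thesis by (simp add: inner_diff_left)
    qed
    have sff: "second_fundamental_form c x q a b \<bullet> ?z = Y'' u a b \<bullet> ?z" for a b
      unfolding second_fundamental_form_def T second np ..
    define g where "g = first_fundamental_form c x q"
    have g: "g $ i $ j = Y' u (axis i 1) \<bullet> Y' u (axis j 1)" for i j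
      by (simp add: g_def first_fundamental_form_def dq)
    have "mean_curvature_vector c x q \<bullet> ?z = 0" using min c q(1) by (simp add: minimal_def)
    then have 0: "(\<Sum>i\<in>UNIV. \<Sum>j\<in>UNIV. matrix_inv g $ i $ j * (Y'' u (axis i 1) (axis j 1) \<bullet> ?z)) = 0"
      unfolding mean_curvature_vector_def g_def[symmetric] by (simp add: inner_sum_left sff)
    have det: "g $ 1 $ 1 * g $ 2 $ 2 - g $ 1 $ 2 * g $ 2 $ 1 \<noteq> 0"
      using gram_determinant_nonzero[OF linY' inj[OF u]] by (simp add: g inner_commute)
    show ?thesis
      using matrix_inv_2_contraction[OF det, of "\<lambda>i j. Y'' u (axis i 1) (axis j 1) \<bullet> ?z"] unfolding 0 by (simp add: g)
  qed
  show ?thesis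
  proof (rule that[OF Y(1) _ Y(3) Y(5) tp])
    fix r :: real assume r: "0 < r" "r \<le> \<rho>"
    have B: "u \<in> ball ?u0 \<rho>" if "u \<in> ball ?u0 r" for u using that r by auto
    have BC: "u \<in> ball ?u0 \<rho> \<inter> half_plane" if "u \<in> ball ?u0 r \<inter> half_plane" for u using that r by auto
    show "minimal_lagrangian_patch Y Y' Y'' ?u0 r"
    proof
      show "?u0 \<in> half_plane" using openin_subset[OF W] p by (auto simp: coord_image_def)
      show "continuous_on (ball ?u0 r) (\<lambda>u. Y'' u v w)" for v w
        using cY'' by (rule continuous_on_subset) (use r in auto)
      fix u w assume u: "u \<in> ball ?u0 r \<inter> half_plane"
      have "Y'' u (axis 2 1) (axis 1 1) = Y'' u (axis 1 1) (axis 2 1)"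
        by (rule second_derivative_symmetric[OF open_ball _ dY dY' dY' cY'' cY'', symmetric]) (use BC[OF u] in auto)
      then show "(Y' u (axis 2 1) \<bullet> Y' u (axis 2 1)) * (Y'' u (axis 1 1) (axis 1 1) \<bullet> \<J> (Y' u w))
      - 2 * (Y' u (axis 1 1) \<bullet> Y' u (axis 2 1)) * (Y'' u (axis 1 1) (axis 2 1) \<bullet> \<J> (Y' u w))
      + (Y' u (axis 1 1) \<bullet> Y' u (axis 1 1)) * (Y'' u (axis 2 1) (axis 2 1) \<bullet> \<J> (Y' u w)) = 0"
        using min_eq[OF BC[OF u], of w] by (simp add: inner_commute)
    qed (use r dY dY' inj iso B BC in \<open>auto simp del: mem_ball\<close>)
  qed
qed

text \<open>For the angle \<pi>/2 the contact condition reads x = \<nu>. It yields tangency once the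
  description of \<nu> is shown to denote, that is, once a unique outward unit normal
  exists.\<close>

lemma position_tangent_on_boundary:
  assumes S: "smooth_surface S \<A>" and imm: "immersion \<A> x" and fb: "legendrian_free_boundary \<A> x"
    and c: "c \<in> \<A>" and p: "p \<in> fst c" "snd c p $ 2 = 0"
  shows "x p \<in> tangent_plane c x p" "norm (x p) = 1"
proof -
  have pb: "p \<in> surface_boundary \<A>" using c p by (auto simp: surface_boundary_def)
  have "x ` surface_boundary \<A> \<subseteq> sphere 0 1"
    using fb by (simp add: legendrian_free_boundary_def legendrian_boundary_def)
  then show "norm (x p) = 1" using pb by auto
  have xn: "x p = outward_unit_normal c x p"
    using fb c p pb by (auto simp: legendrian_free_boundary_def has_contact_angle_def)
  define D where "D = differential c x p"
  obtain Y \<rho> where Y: "\<rho> > 0" "\<And>k. Ck_on k Y (ball (snd c p) \<rho>)"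
    "\<And>q. q \<in> fst c \<Longrightarrow> snd c q \<in> ball (snd c p) \<rho> \<Longrightarrow> differential c x q = frechet_derivative Y (at (snd c q))"
    using immersion_local_extension[OF S imm c p(1)] by metis
  have DY: "D = frechet_derivative Y (at (snd c p))" using Y(3)[OF p(1)] Y(1) by (simp add: D_def)
  have "Y differentiable at (snd c p)" using Y(2)[of 1] Y(1) by simp
  then have lin: "linear D" unfolding DY by (rule linear_frechet_derivative)
  have inj: "inj D" using imm c p(1) by (auto simp: immersion_def D_def)
  define E1 where "E1 = D (axis 1 1)"
  define E2 where "E2 = D (axis 2 1)"
  have Dw: "D w = w $ 1 *\<^sub>R E1 + w $ 2 *\<^sub>R E2" for w
  proof -
    have "w = w $ 1 *\<^sub>R axis 1 1 + w $ 2 *\<^sub>R axis 2 1" by (simp add: vec_eq_iff forall_2 axis_def)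
    then have "D w = D (w $ 1 *\<^sub>R axis 1 1 + w $ 2 *\<^sub>R axis 2 1)" by simp
    then show ?thesis by (simp add: linear_add[OF lin] linear_scale[OF lin] E1_def E2_def)
  qed
  have E1: "E1 \<noteq> 0"
  proof
    assume "E1 = 0"
    then have "D (axis 1 1) = D 0" by (simp add: E1_def linear_0[OF lin])
    then have "axis 1 1 = (0 :: real^2)" using inj by (simp add: inj_eq)
    then show False by (simp add: axis_eq_0_iff)
  qed
  define k where "k = (E1 \<bullet> E2) / (E1 \<bullet> E1)"
  \<comment> \<open>The Gram-Schmidt step: \<open>D w0\<close> is k E1 - E2, orthogonal to the
    boundary direction \<open>E1\<close>, and the component -1 makes it point outward.\<close>
  define w0 :: "real^2" where "w0 = (\<chi> i. if i = 1 then k else - 1)"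
  have w0: "w0 $ 1 = k" "w0 $ 2 = - 1" by (simp_all add: w0_def)
  have orth: "D w0 \<bullet> E1 = 0" using E1 by (simp add: Dw w0 k_def inner_diff_left inner_commute[of E2])
  have "D w0 \<noteq> 0"
  proof
    assume "D w0 = 0"
    then have "D w0 = D 0" by (simp add: linear_0[OF lin])
    then have "w0 = 0" using inj by (simp add: inj_eq)
    then show False using w0(2) by simp
  qed
  define P where "P \<nu> \<longleftrightarrow> norm \<nu> = 1 \<and> (\<exists>w. w $ 2 < 0 \<and> \<nu> = D w) \<and> (\<forall>w. w $ 2 = 0 \<longrightarrow> orthogonal \<nu> (D w))" for \<nu>
  have "\<exists>!\<nu>. P \<nu>"
  proof (rule ex1I)
    let ?n = "(1 / norm (D w0)) *\<^sub>R D w0"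
    have "?n = D ((1 / norm (D w0)) *\<^sub>R w0)" by (simp add: linear_scale[OF lin])
    moreover have "((1 / norm (D w0)) *\<^sub>R w0) $ 2 < 0" using \<open>D w0 \<noteq> 0\<close> by (simp add: w0)
    moreover have "orthogonal ?n (D w)" if "w $ 2 = 0" for w
      using orth that by (simp add: orthogonal_def Dw[of w])
    moreover have "norm ?n = 1" using \<open>D w0 \<noteq> 0\<close> by simp
    ultimately show "P ?n" unfolding P_def by blast
    fix \<nu> assume "P \<nu>"
    then obtain w where w: "norm \<nu> = 1" "w $ 2 < 0" "\<nu> = D w" "\<And>w. w $ 2 = 0 \<Longrightarrow> orthogonal \<nu> (D w)"
      unfolding P_def by blast
    \<comment> \<open>Adding this multiple of \<open>w0\<close> cancels the second component; the
      image is then both parallel and orthogonal to \<open>E1\<close>, hence zero.\<close>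
    define y where "y = w + (w $ 2) *\<^sub>R w0"
    have "y $ 2 = 0" by (simp add: y_def w0)
    have "D y = \<nu> + (w $ 2) *\<^sub>R D w0" by (simp add: y_def linear_add[OF lin] linear_scale[OF lin] w(3))
    moreover have "D y = y $ 1 *\<^sub>R E1" using Dw[of y] \<open>y $ 2 = 0\<close> by simp
    moreover have "\<nu> \<bullet> E1 = 0" using w(4)[of "axis 1 1"] by (simp add: orthogonal_def E1_def axis_def)
    ultimately have "y $ 1 * (E1 \<bullet> E1) = 0" using orth by (metis add.right_neutral inner_add_left inner_scaleR_left mult_zero_right)
    then have "D y = 0" using \<open>D y = y $ 1 *\<^sub>R E1\<close> E1 by simp
    then have \<nu>: "\<nu> = (- (w $ 2)) *\<^sub>R D w0" using \<open>D y = \<nu> + (w $ 2) *\<^sub>R D w0\<close> by (simp add: eq_neg_iff_add_eq_0)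
    then have "- (w $ 2) * norm (D w0) = 1" using w(1,2) by simp
    then have "- (w $ 2) = 1 / norm (D w0)" using \<open>D w0 \<noteq> 0\<close> by (simp add: field_simps)
    then show "\<nu> = ?n" using \<nu> by simp
  qed
  from theI'[OF this] have "P (THE \<nu>. P \<nu>)" .
  moreover have "outward_unit_normal c x p = (THE \<nu>. P \<nu>)"
    unfolding outward_unit_normal_def P_def D_def ..
  ultimately show "x p \<in> tangent_plane c x p"
    using xn unfolding P_def tangent_plane_def D_def[symmetric] by auto
qed

section \<open>Local homeomorphisms onto a ball\<close>

lemma locally_constant_on_connected_space:
  assumes "connected_space S" and p: "p \<in> topspace S" and q: "q \<in> topspace S"
    and loc: "\<And>a. a \<in> topspace S \<Longrightarrow> \<exists>N. openin S N \<and> a \<in> N \<and> (\<forall>b\<in>N. f b = f a)"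
  shows "f p = f q"
proof -
  let ?A = "{a \<in> topspace S. f a = f p}" and ?B = "{a \<in> topspace S. f a \<noteq> f p}"
  have "openin S ?A"
  proof (subst openin_subopen, clarify)
    fix a assume a: "a \<in> topspace S" "f a = f p"
    obtain N where "openin S N" "a \<in> N" "\<forall>b\<in>N. f b = f a" using loc[OF a(1)] by blast
    then show "\<exists>T. openin S T \<and> a \<in> T \<and> T \<subseteq> ?A"
      using a openin_subset by (intro exI[of _ N]) fastforce
  qed
  moreover have "openin S ?B"
  proof (subst openin_subopen, clarify)
    fix a assume a: "a \<in> topspace S" "f a \<noteq> f p"
    obtain N where "openin S N" "a \<in> N" "\<forall>b\<in>N. f b = f a" using loc[OF a(1)] by blast
    then show "\<exists>T. openin S T \<and> a \<in> T \<and> T \<subseteq> ?B"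
      using a openin_subset by (intro exI[of _ N]) fastforce
  qed
  moreover have "?A \<inter> ?B = {}" "topspace S \<subseteq> ?A \<union> ?B" "?A \<noteq> {}" using p by auto
  ultimately have "?B = {}"
    using assms(1) unfolding connected_space_def by blast
  then show ?thesis using q by auto
qed

text \<open>The set where the lifts agree is closed by the Hausdorff property and open by local
  injectivity of \<open>f\<close>.\<close>

lemma lift_unique_of_locally_injective:
  fixes C :: "'b::topological_space set"
  assumes S: "Hausdorff_space S" and C: "connected C"
    and g: "continuous_map (top_of_set C) S g" and h: "continuous_map (top_of_set C) S h"
    and fgh: "\<And>y. y \<in> C \<Longrightarrow> f (g y) = f (h y)"
    and loc: "\<And>p. p \<in> topspace S \<Longrightarrow> \<exists>U. openin S U \<and> p \<in> U \<and> inj_on f U"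
    and a: "a \<in> C" "g a = h a" and y: "y \<in> C"
  shows "g y = h y"
proof -
  let ?E = "{y \<in> C. g y = h y}"
  have "closedin (top_of_set C) ?E"
    using closedin_continuous_maps_eq[OF S g h] by simp
  moreover have "openin (top_of_set C) ?E"
  proof (subst openin_subopen, clarify)
    fix b assume b: "b \<in> C" "g b = h b"
    then have "g b \<in> topspace S" using continuous_map_image_subset_topspace[OF g] by auto
    then obtain U where U: "openin S U" "g b \<in> U" "inj_on f U" using loc by blast
    let ?T = "{y \<in> C. g y \<in> U} \<inter> {y \<in> C. h y \<in> U}"
    have "openin (top_of_set C) ?T"
      using openin_continuous_map_preimage[OF g U(1)] openin_continuous_map_preimage[OF h U(1)]
      by (intro openin_Int) auto
    moreover have "?T \<subseteq> ?E" using fgh U(3) by (auto dest: inj_onD)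
    ultimately show "\<exists>T. openin (top_of_set C) T \<and> b \<in> T \<and> T \<subseteq> ?E"
      using b U(2) by (intro exI[of _ ?T]) auto
  qed
  ultimately have "?E = {} \<or> ?E = C" using C connected_clopen by blast
  then show ?thesis using a y by auto
qed

text \<open>A Lebesgue number argument: local inverses exist over balls of varying radius, and
  compactness leaves finitely many of them.\<close>

lemma uniform_local_inverse_radius:
  fixes f :: "'p \<Rightarrow> 'b::real_normed_vector"
  assumes comp: "compact_space S" and f: "continuous_map S euclidean f" and D: "f ` topspace S \<subseteq> D"
    and op: "\<And>U. openin S U \<Longrightarrow> openin (top_of_set D) (f ` U)"
    and loc: "\<And>p. p \<in> topspace S \<Longrightarrow> \<exists>U. openin S U \<and> p \<in> U \<and> inj_on f U"
  shows "\<exists>r>0. \<forall>p\<in>topspace S. \<exists>U. openin S U \<and> p \<in> U \<and> inj_on f U \<and> D \<inter> ball (f p) r \<subseteq> f ` U"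
proof -
  have "\<exists>U \<rho>. openin S U \<and> p \<in> U \<and> inj_on f U \<and> \<rho> > 0 \<and> D \<inter> ball (f p) (2 * \<rho>) \<subseteq> f ` U"
    if p: "p \<in> topspace S" for p
  proof -
    obtain U where U: "openin S U" "p \<in> U" "inj_on f U" using loc[OF p] by blast
    obtain e where "e > 0" "ball (f p) e \<inter> D \<subseteq> f ` U"
      using op[OF U(1)] U(2) by (meson imageI openin_contains_ball)
    then show ?thesis using U by (intro exI[of _ U] exI[of _ "e/2"]) auto
  qed
  then obtain U \<rho> where U: "\<And>p. p \<in> topspace S \<Longrightarrow>
      openin S (U p) \<and> p \<in> U p \<and> inj_on f (U p) \<and> \<rho> p > 0 \<and> D \<inter> ball (f p) (2 * \<rho> p) \<subseteq> f ` U p"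
    by metis
  \<comment> \<open>Points of \<open>V p\<close> map within \<rho> of \<open>f p\<close>, so balls
    of radius at most \<rho> around their images fit into the ball of radius 2\<rho> over which
    \<open>U p\<close> provides an inverse.\<close>
  define V where "V p = U p \<inter> {q \<in> topspace S. f q \<in> ball (f p) (\<rho> p)}" for p
  have "openin S (V p)" if "p \<in> topspace S" for p
    unfolding V_def using U[OF that] openin_continuous_map_preimage[OF f, of "ball (f p) (\<rho> p)"]
    by (intro openin_Int) auto
  then have "\<forall>W\<in>V ` topspace S. openin S W" by auto
  moreover have "topspace S \<subseteq> \<Union>(V ` topspace S)" using U by (auto simp: V_def)
  ultimately obtain F where F: "finite F" "F \<subseteq> V ` topspace S" "topspace S \<subseteq> \<Union>F"
    using comp unfolding compact_space_alt by metis
  obtain K where K: "finite K" "K \<subseteq> topspace S" "F = V ` K"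
    using F(1,2) by (metis finite_subset_image)
  \<comment> \<open>The inserted 1 keeps the minimum meaningful when the cover is empty.\<close>
  define r where "r = Min (insert 1 (\<rho> ` K))"
  have r: "r > 0" "\<And>p. p \<in> K \<Longrightarrow> r \<le> \<rho> p"
    using K U by (auto simp: r_def subset_iff)
  have "\<exists>U. openin S U \<and> q \<in> U \<and> inj_on f U \<and> D \<inter> ball (f q) r \<subseteq> f ` U"
    if q: "q \<in> topspace S" for q
  proof -
    obtain p where p: "p \<in> K" "q \<in> V p" using q F(3) K(3) by auto
    have "ball (f q) r \<subseteq> ball (f p) (2 * \<rho> p)"
    proof
      fix y assume "y \<in> ball (f q) r"
      moreover have "dist (f p) y \<le> dist (f p) (f q) + dist (f q) y" by (rule dist_triangle)
      ultimately show "y \<in> ball (f p) (2 * \<rho> p)" using p r(2)[OF p(1)] by (auto simp: V_def)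
    qed
    then show ?thesis using U[of p] p K(2) by (intro exI[of _ "U p"]) (auto simp: V_def)
  qed
  then show ?thesis using r(1) by blast
qed

text \<open>Local inverses of uniform radius lift the contraction \<open>y \<mapsto> (1 - r/2) y\<close> of the ball to a map
  \<open>\<phi>\<close> of the space that is injective on fibres. Some iterate of \<open>\<phi>\<close> has its image over a small
  ball around the centre, hence, by connectedness, in a single sheet.\<close>

lemma homeomorphic_map_of_local_homeomorphism_onto_ball:
  fixes f :: "'p \<Rightarrow> 'b::euclidean_space"
  assumes comp: "compact_space S" and haus: "Hausdorff_space S" and conn: "connected_space S"
    and ne: "topspace S \<noteq> {}"
    and f: "continuous_map S euclidean f" and D: "f ` topspace S \<subseteq> cball 0 1"
    and op: "\<And>U. openin S U \<Longrightarrow> openin (top_of_set (cball 0 1)) (f ` U)"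
    and loc: "\<And>p. p \<in> topspace S \<Longrightarrow> \<exists>U. openin S U \<and> p \<in> U \<and> inj_on f U"
  shows "homeomorphic_map S (top_of_set (cball 0 1)) f"
proof -
  let ?D = "cball (0::'b) 1"
  have f': "continuous_map S (top_of_set ?D) f"
    using f D by (auto simp: continuous_map_in_subtopology)
  \<comment> \<open>The image is closed by compactness and relatively open, hence the whole
    connected ball.\<close>
  have onto: "f ` topspace S = ?D"
  proof -
    have "compactin euclidean (f ` topspace S)"
      using comp f image_compactin unfolding compact_space_def by blast
    then have "closedin (top_of_set ?D) (f ` topspace S)"
      using D by (intro closed_subset) (auto intro: compact_imp_closed)
    moreover have "openin (top_of_set ?D) (f ` topspace S)" by (rule op) simp
    moreover have "connected ?D" by simp
    ultimately have "f ` topspace S = {} \<or> f ` topspace S = ?D"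
      unfolding connected_clopen by blast
    then show ?thesis using ne by simp
  qed
  obtain r0 where r0: "r0 > 0" and
    r0': "\<forall>p\<in>topspace S. \<exists>U. openin S U \<and> p \<in> U \<and> inj_on f U \<and> ?D \<inter> ball (f p) r0 \<subseteq> f ` U"
    using uniform_local_inverse_radius[OF comp f D op loc] by auto
  \<comment> \<open>The bound 1 keeps the contraction factor 1 - r/2 positive.\<close>
  define r where "r = min r0 1"
  have r: "0 < r" "r \<le> 1" using r0 by (auto simp: r_def)
  have "\<forall>p\<in>topspace S. \<exists>U. openin S U \<and> p \<in> U \<and> inj_on f U \<and> ?D \<inter> ball (f p) r \<subseteq> f ` U"
  proof
    fix p assume "p \<in> topspace S"
    then obtain V where V: "openin S V" "p \<in> V" "inj_on f V" "?D \<inter> ball (f p) r0 \<subseteq> f ` V"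
      using r0' by (elim ballE exE conjE) auto
    have "ball (f p) r \<subseteq> ball (f p) r0" by (auto simp: r_def)
    then have "?D \<inter> ball (f p) r \<subseteq> f ` V" using V(4) by (rule_tac subset_trans[OF Int_mono[OF subset_refl]])
    then show "\<exists>U. openin S U \<and> p \<in> U \<and> inj_on f U \<and> ?D \<inter> ball (f p) r \<subseteq> f ` U"
      using V by (intro exI[of _ V] conjI)
  qed
  then have "\<exists>U. \<forall>p\<in>topspace S. openin S (U p) \<and> p \<in> U p \<and> inj_on f (U p) \<and> ?D \<inter> ball (f p) r \<subseteq> f ` U p"
    by (rule bchoice)
  then obtain U where U': "\<forall>p\<in>topspace S. openin S (U p) \<and> p \<in> U p \<and> inj_on f (U p) \<and> ?D \<inter> ball (f p) r \<subseteq> f ` U p" ..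
  have U: "openin S (U p)" "p \<in> U p" "inj_on f (U p)" "?D \<inter> ball (f p) r \<subseteq> f ` U p"
    if "p \<in> topspace S" for p
    using bspec[OF U' that] by simp_all
  have USub: "U p \<subseteq> topspace S" if "p \<in> topspace S" for p
    using U(1)[OF that] openin_subset by blast
  \<comment> \<open>The local section of \<open>f\<close> with \<open>s p (f p) = p\<close>,
    available at all points of the ball within \<open>r\<close> of \<open>f p\<close>.\<close>
  define s where "s p = inv_into (U p) f" for p
  have s_in: "s p y \<in> U p" and fs: "f (s p y) = y" if "p \<in> topspace S" "y \<in> ?D \<inter> ball (f p) r" for p y
  proof -
    have "y \<in> f ` U p" using U(4)[OF that(1)] that(2) by blast
    then show "s p y \<in> U p" "f (s p y) = y"
      unfolding s_def by (auto intro: inv_into_into f_inv_into_f)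
  qed
  have sf: "s p (f q) = q" if "p \<in> topspace S" "q \<in> U p" for p q
    unfolding s_def using U(3)[OF that(1)] that(2) by simp
  have s_cont: "continuous_map (top_of_set (?D \<inter> ball (f p) r)) S (s p)" if p: "p \<in> topspace S" for p
    unfolding continuous_map_def
  proof (intro conjI allI impI)
    show "s p \<in> topspace (top_of_set (?D \<inter> ball (f p) r)) \<rightarrow> topspace S"
      using s_in[OF p] USub[OF p] by (auto simp del: mem_ball mem_cball)
    fix W assume W: "openin S W"
    \<comment> \<open>Openness of \<open>f\<close> is continuity of its local inverse.\<close>
    have "{y \<in> topspace (top_of_set (?D \<inter> ball (f p) r)). s p y \<in> W} = (?D \<inter> ball (f p) r) \<inter> f ` (W \<inter> U p)"
      using s_in[OF p] fs[OF p] sf[OF p] by (auto simp del: mem_ball mem_cball) (metis IntI image_eqI)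
    moreover have "openin (top_of_set ?D) (f ` (W \<inter> U p))"
      using W U(1)[OF p] by (intro op openin_Int)
    ultimately show "openin (top_of_set (?D \<inter> ball (f p) r))
        {y \<in> topspace (top_of_set (?D \<inter> ball (f p) r)). s p y \<in> W}"
      by (auto simp: openin_open simp del: mem_ball mem_cball)
  qed
  \<comment> \<open>The domains of two sections meet in a convex, hence connected, set, so agreement
    at one point spreads to all of it.\<close>
  have agree: "s p y = s q y"
    if "p \<in> topspace S" "q \<in> topspace S" and b: "b \<in> ?D \<inter> ball (f p) r \<inter> ball (f q) r" "s p b = s q b"
      and y: "y \<in> ?D \<inter> ball (f p) r \<inter> ball (f q) r" for p q b y
  proof (rule lift_unique_of_locally_injective[where f = f and g = "s p" and h = "s q", OF haus _ _ _ _ loc b y])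
    let ?C = "?D \<inter> ball (f p) r \<inter> ball (f q) r"
    show "connected ?C" by (intro convex_connected convex_Int) auto
    show "continuous_map (top_of_set ?C) S (s p)"
      by (rule continuous_map_from_subtopology_mono[OF s_cont[OF that(1)]]) auto
    show "continuous_map (top_of_set ?C) S (s q)"
      by (rule continuous_map_from_subtopology_mono[OF s_cont[OF that(2)]]) auto
    show "f (s p y) = f (s q y)" if "y \<in> ?C" for y
      using fs[OF \<open>p \<in> topspace S\<close>, of y] fs[OF \<open>q \<in> topspace S\<close>, of y] that by auto
  qed
  \<comment> \<open>The contraction moves points by at most r/2, so the target remains in the domain
    of the section at the starting point.\<close>
  define c where "c y = (1 - r/2) *\<^sub>R y" for y :: 'b
  have c: "c y \<in> ?D" "dist y (c y) < r" "norm (c y) = (1 - r/2) * norm y" if "y \<in> ?D" for y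
  proof -
    show "norm (c y) = (1 - r/2) * norm y" using r by (simp add: c_def)
    moreover have "(1 - r/2) * norm y \<le> 1 * 1" using r that by (intro mult_mono) auto
    ultimately show "c y \<in> ?D" by simp
    have "dist y (c y) = r/2 * norm y" using r by (simp add: c_def dist_norm algebra_simps)
    also have "\<dots> \<le> r/2 * 1" using r that by (intro mult_left_mono) auto
    finally show "dist y (c y) < r" using r by simp
  qed
  have cr: "dist y (c y) \<le> r/2" if "y \<in> ?D" for y
  proof -
    have "dist y (c y) = r/2 * norm y" using r by (simp add: c_def dist_norm algebra_simps)
    also have "\<dots> \<le> r/2 * 1" using r that by (intro mult_left_mono) auto
    finally show ?thesis by simp
  qed
  have fD: "f p \<in> ?D" if "p \<in> topspace S" for p using D that by auto
  define \<phi> where "\<phi> p = s p (c (f p))" for p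
  have cball': "c (f p) \<in> ?D \<inter> ball (f p) r" if "p \<in> topspace S" for p
    using c[OF fD[OF that]] by auto
  have \<phi>S: "\<phi> p \<in> topspace S" and f\<phi>: "f (\<phi> p) = c (f p)" if "p \<in> topspace S" for p
    using s_in[OF that cball'[OF that]] fs[OF that cball'[OF that]] USub[OF that]
    by (auto simp: \<phi>_def)
  have self: "f p \<in> ?D \<inter> ball (f p) r" if "p \<in> topspace S" for p using fD[OF that] r by auto
  have \<phi>cont: "continuous_map S S \<phi>"
    unfolding continuous_map_def
  proof (intro conjI allI impI)
    show "\<phi> \<in> topspace S \<rightarrow> topspace S" using \<phi>S by auto
    fix W assume W: "openin S W"
    show "openin S {q \<in> topspace S. \<phi> q \<in> W}"
    proof (subst openin_subopen, clarify)
      fix p assume p: "p \<in> topspace S" "\<phi> p \<in> W"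
      \<comment> \<open>Radius r/2 leaves room for the displacement by \<open>c\<close>: both
        \<open>f q\<close> and \<open>c (f q)\<close> lie in the domain of \<open>s p\<close>, and
        \<phi> is given near \<open>p\<close> by this single section.\<close>
      define N where "N = U p \<inter> {q \<in> topspace S. f q \<in> ball (f p) (r/2)}"
      have N: "openin S N" unfolding N_def
        using U(1)[OF p(1)] openin_continuous_map_preimage[OF f, of "ball (f p) (r/2)"]
        by (intro openin_Int) auto
      have cin: "c (f q) \<in> ?D \<inter> ball (f p) r" if "q \<in> N" for q
      proof -
        have "dist (f p) (c (f q)) \<le> dist (f p) (f q) + dist (f q) (c (f q))" by (rule dist_triangle)
        then show ?thesis using that cr[of "f q"] c(1)[of "f q"] fD[of q] by (auto simp: N_def)
      qed
      have eq: "\<phi> q = s p (c (f q))" if q: "q \<in> N" for q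
      proof -
        have qS: "q \<in> topspace S" and "q \<in> U p" and "f q \<in> ball (f p) r"
          using q r by (auto simp: N_def)
        then have "s q (f q) = s p (f q)" using sf[OF qS U(2)[OF qS]] sf[OF p(1)] by simp
        then show ?thesis unfolding \<phi>_def
          using agree[OF qS p(1), of "f q" "c (f q)"] self[OF qS] cin[OF q] cball'[OF qS] \<open>f q \<in> ball (f p) r\<close>
          by auto
      qed
      have "continuous_map (subtopology S N) (top_of_set (?D \<inter> ball (f p) r)) (\<lambda>q. c (f q))"
        unfolding continuous_map_in_subtopology
      proof
        show "continuous_map (subtopology S N) euclidean (\<lambda>q. c (f q))"
        proof -
          have "continuous_map euclidean euclidean c"
            unfolding c_def continuous_map_iff_continuous2 by (intro continuous_intros)
          with continuous_map_from_subtopology[OF f] show ?thesis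
            using continuous_map_compose[of "subtopology S N" euclidean f euclidean c] by (simp add: o_def)
        qed
        show "(\<lambda>q. c (f q)) \<in> topspace (subtopology S N) \<rightarrow> ?D \<inter> ball (f p) r"
          using cin by (auto simp del: mem_ball mem_cball)
      qed
      then have "continuous_map (subtopology S N) S (s p \<circ> (\<lambda>q. c (f q)))"
        using s_cont[OF p(1)] continuous_map_compose by blast
      then have "openin (subtopology S N) {q \<in> topspace (subtopology S N). (s p \<circ> (\<lambda>q. c (f q))) q \<in> W}"
        using W openin_continuous_map_preimage by blast
      then have "openin S {q \<in> topspace (subtopology S N). (s p \<circ> (\<lambda>q. c (f q))) q \<in> W}"
        using N openin_trans_full by blast
      moreover have "{q \<in> topspace (subtopology S N). (s p \<circ> (\<lambda>q. c (f q))) q \<in> W} = {q \<in> N. \<phi> q \<in> W}"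
        using openin_subset[OF N] eq by auto
      ultimately have "openin S {q \<in> N. \<phi> q \<in> W}" by simp
      then show "\<exists>T. openin S T \<and> p \<in> T \<and> T \<subseteq> {q \<in> topspace S. \<phi> q \<in> W}"
        using p U(2)[OF p(1)] r openin_subset[OF N]
        by (intro exI[of _ "{q \<in> N. \<phi> q \<in> W}"]) (auto simp: N_def)
    qed
  qed
  have pull_back: "p = q" if p: "p \<in> topspace S" and q: "q \<in> topspace S" and "f p = f q" "\<phi> p = \<phi> q" for p q
  proof -
    \<comment> \<open>The section at \<open>\<phi> a\<close>, evaluated at \<open>f a\<close>,
      recovers \<open>a\<close>: it agrees with the section at \<open>a\<close> over
      \<open>f (\<phi> a)\<close>. Thus \<open>a\<close> depends only on \<open>\<phi> a\<close> and
      \<open>f a\<close>.\<close>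
    have *: "a = s (\<phi> a) (f a)" if a: "a \<in> topspace S" for a
    proof -
      have "s a (f (\<phi> a)) = s (\<phi> a) (f (\<phi> a))"
        using f\<phi>[OF a] sf[OF \<phi>S[OF a] U(2)[OF \<phi>S[OF a]]] by (simp add: \<phi>_def)
      moreover have "f (\<phi> a) \<in> ?D \<inter> ball (f a) r \<inter> ball (f (\<phi> a)) r"
        using cball'[OF a] f\<phi>[OF a] r by auto
      moreover have "f a \<in> ?D \<inter> ball (f a) r \<inter> ball (f (\<phi> a)) r"
        using cball'[OF a] self[OF a] f\<phi>[OF a] by (auto simp: dist_commute)
      ultimately have "s a (f a) = s (\<phi> a) (f a)"
        using agree[OF a \<phi>S[OF a]] by blast
      then show ?thesis using sf[OF a U(2)[OF a]] by simp
    qed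
    show ?thesis using *[OF p] *[OF q] that(3,4) by simp
  qed
  have iter: "continuous_map S S (\<phi> ^^ n)" for n
  proof (induction n)
    case 0 then show ?case by (simp add: id_def[symmetric])
  next
    case (Suc n)
    then have "continuous_map S S (\<phi> \<circ> (\<phi> ^^ n))" using \<phi>cont continuous_map_compose by blast
    then show ?case by (simp add: o_def)
  qed
  then have iterS: "(\<phi> ^^ n) p \<in> topspace S" if "p \<in> topspace S" for n p
    using that by (meson continuous_map_image_subset_topspace image_subset_iff)
  have f_iter: "f ((\<phi> ^^ n) p) = (c ^^ n) (f p)" if "p \<in> topspace S" for n p
    by (induction n) (auto simp: f\<phi> iterS[OF that])
  have norm_iter: "norm (f ((\<phi> ^^ n) p)) \<le> (1 - r/2) ^ n" if "p \<in> topspace S" for n p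
  proof (induction n)
    case 0 then show ?case using fD[OF that] by simp
  next
    case (Suc n)
    then have "(1 - r/2) * norm (f ((\<phi> ^^ n) p)) \<le> (1 - r/2) * (1 - r/2) ^ n"
      using r by (intro mult_left_mono) auto
    then show ?case using c(3) fD iterS[OF that] by (simp add: f\<phi>)
  qed
  \<comment> \<open>After this many contractions all images lie within \<open>r\<close> of the
    centre, so the sections there are defined at 0.\<close>
  obtain n where n: "(1 - r/2) ^ n < r"
    using real_arch_pow_inv[of r "1 - r/2"] r by auto
  define \<omega> where "\<omega> = \<phi> ^^ n"
  have \<omega>S: "\<omega> p \<in> topspace S" and near: "0 \<in> ?D \<inter> ball (f (\<omega> p)) r"
    if "p \<in> topspace S" for p
    using iterS[OF that] norm_iter[OF that, of n] n by (auto simp: \<omega>_def)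
  \<comment> \<open>The point over the centre in the sheet through \<open>\<omega> p\<close>. It
    varies locally constantly, so connectedness leaves a single such point and a single
    sheet.\<close>
  define \<psi> where "\<psi> p = s (\<omega> p) 0" for p
  have \<psi>S: "\<psi> p \<in> topspace S" and f\<psi>: "f (\<psi> p) = 0" if "p \<in> topspace S" for p
    using s_in[OF \<omega>S near] fs[OF \<omega>S near] USub[OF \<omega>S] that by (auto simp: \<psi>_def)
  have \<psi>const: "\<psi> p = \<psi> q" if "p \<in> topspace S" "q \<in> topspace S" for p q
  proof (rule locally_constant_on_connected_space[OF conn that])
    fix a assume a: "a \<in> topspace S"
    define N where "N = {b \<in> topspace S. \<omega> b \<in> U (\<omega> a)} \<inter> {b \<in> topspace S. (f \<circ> \<omega>) b \<in> ball (f (\<omega> a)) r}"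
    have "continuous_map S S \<omega>" using iter by (simp add: \<omega>_def)
    moreover from this f have "continuous_map S euclidean (f \<circ> \<omega>)" by (rule continuous_map_compose)
    ultimately have "openin S N" unfolding N_def
      using openin_continuous_map_preimage U(1)[OF \<omega>S[OF a]]
      by (intro openin_Int openin_continuous_map_preimage[of S euclidean "f \<circ> \<omega>"]
          openin_continuous_map_preimage[of S S \<omega>]) auto
    moreover have "a \<in> N" using a U(2)[OF \<omega>S[OF a]] r by (simp add: N_def)
    moreover have "\<psi> b = \<psi> a" if "b \<in> N" for b
    proof -
      have b: "b \<in> topspace S" "\<omega> b \<in> U (\<omega> a)" "f (\<omega> b) \<in> ball (f (\<omega> a)) r" using that by (auto simp: N_def)
      have "s (\<omega> b) (f (\<omega> b)) = s (\<omega> a) (f (\<omega> b))"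
        using sf[OF \<omega>S[OF a] b(2)] sf[OF \<omega>S U(2)[OF \<omega>S]] b(1) by simp
      then show ?thesis unfolding \<psi>_def
        using agree[OF \<omega>S[OF b(1)] \<omega>S[OF a], of "f (\<omega> b)" 0] self[OF \<omega>S[OF b(1)]] b(3) near[OF a] near[OF b(1)]
        by auto
    qed
    ultimately show "\<exists>N. openin S N \<and> a \<in> N \<and> (\<forall>b\<in>N. \<psi> b = \<psi> a)" by blast
  qed
  have \<omega>_eq: "\<omega> p = s (\<psi> p) (f (\<omega> p))" if p: "p \<in> topspace S" for p
  proof -
    have "s (\<omega> p) 0 = s (\<psi> p) 0"
      using sf[OF \<psi>S[OF p] U(2)[OF \<psi>S[OF p]]] f\<psi>[OF p] by (simp add: \<psi>_def)
    then have "s (\<omega> p) (f (\<omega> p)) = s (\<psi> p) (f (\<omega> p))"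
      using agree[OF \<omega>S[OF p] \<psi>S[OF p], of 0 "f (\<omega> p)"] near[OF p] self[OF \<omega>S[OF p]] r f\<psi>[OF p]
      by (auto simp: dist_commute)
    then show ?thesis using sf[OF \<omega>S[OF p] U(2)[OF \<omega>S[OF p]]] by simp
  qed
  have inj: "inj_on f (topspace S)"
  proof (rule inj_onI)
    fix p q assume pq: "p \<in> topspace S" "q \<in> topspace S" "f p = f q"
    have "\<omega> p = \<omega> q"
      using \<omega>_eq[OF pq(1)] \<omega>_eq[OF pq(2)] \<psi>const[OF pq(1,2)] f_iter[OF pq(1), of n] f_iter[OF pq(2), of n] pq(3)
      by (simp add: \<omega>_def)
    \<comment> \<open>Equal fibres stay equal under the iteration, so \<open>pull_back\<close>
      removes one application of \<phi> at a time.\<close>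
    moreover have "(\<phi> ^^ m) p = (\<phi> ^^ m) q \<Longrightarrow> p = q" for m
    proof (induction m)
      case (Suc m)
      have "(\<phi> ^^ m) p = (\<phi> ^^ m) q"
        by (rule pull_back) (use Suc.prems pq in \<open>auto simp: iterS f_iter\<close>)
      then show ?case by (rule Suc.IH)
    qed simp
    ultimately show "p = q" by (simp add: \<omega>_def)
  qed
  show ?thesis
  proof (rule bijective_open_imp_homeomorphic_map[OF f'])
    show "open_map S (top_of_set ?D) f" using op by (simp add: open_map_def)
    show "f ` topspace S = topspace (top_of_set ?D)" using onto by simp
  qed (rule inj)
qed

section \<open>The equatorial disc\<close>

text \<open>At a boundary point, a small ball meets the open unit ball in a connected set
  \<open>D\<close>. Its preimage avoids the boundary line, which maps to the unit sphere, and
  contains a point above it, so it lies above it entirely; points on the sphere follow by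
  closure.\<close>

lemma half_disc_image_contains_relative_ball:
  fixes F :: "real^2 \<Rightarrow> 'b::euclidean_space"
  assumes F: "homeomorphism (ball u0 \<sigma>) B' F g" and B': "open B'" and \<sigma>: "\<sigma> > 0" and u0: "u0 \<in> half_plane"
    and op: "\<And>N. open N \<Longrightarrow> N \<subseteq> ball u0 \<sigma> \<Longrightarrow> open (F ` N)"
    and disc: "\<And>u. u \<in> ball u0 \<sigma> \<inter> half_plane \<Longrightarrow> norm (F u) \<le> 1"
    and circle: "\<And>u. u \<in> ball u0 \<sigma> \<Longrightarrow> u $ 2 = 0 \<Longrightarrow> norm (F u) = 1"
  shows "\<exists>e>0. ball (F u0) e \<inter> cball 0 1 \<subseteq> F ` (ball u0 \<sigma> \<inter> half_plane)"
proof -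
  \<comment> \<open>An open image contained in the closed unit ball lies in its interior.\<close>
  have interior: "norm (F u) < 1" if u: "u \<in> ball u0 \<sigma>" "0 < u $ 2" for u
  proof -
    let ?N = "ball u0 \<sigma> \<inter> {u. 0 < u $ 2}"
    have "open ?N" by (intro open_Int open_ball open_halfspace_component_gt_cart)
    then have "open (F ` ?N)" by (rule op) auto
    moreover have "F ` ?N \<subseteq> cball 0 1" using disc by (auto simp: half_plane_def)
    ultimately have "F ` ?N \<subseteq> interior (cball 0 1)" by (rule interior_maximal[rotated])
    moreover have "F u \<in> F ` ?N" using u by blast
    ultimately show ?thesis by auto
  qed
  show ?thesis
  proof (cases "u0 $ 2 = 0")
    case False
    then have pos: "u0 $ 2 > 0" using u0 by (simp add: half_plane_def)
    let ?N = "ball u0 \<sigma> \<inter> {u. 0 < u $ 2}"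
    have "open ?N" by (intro open_Int open_ball open_halfspace_component_gt_cart)
    then have "open (F ` ?N)" by (rule op) auto
    moreover have "F u0 \<in> F ` ?N" using pos \<sigma> by auto
    ultimately obtain e where e: "e > 0" "ball (F u0) e \<subseteq> F ` ?N" by (rule openE)
    have "F ` ?N \<subseteq> F ` (ball u0 \<sigma> \<inter> half_plane)" by (rule image_mono) (auto simp: half_plane_def)
    then show ?thesis using e by blast
  next
    case True
    have "F u0 \<in> B'" using homeomorphism_image1[OF F] \<sigma> by auto
    then obtain e where e: "e > 0" "ball (F u0) e \<subseteq> B'" using B' openE by blast
    define D where "D = ball (F u0) e \<inter> ball 0 1"
    have gin: "g y \<in> ball u0 \<sigma>" and Fg: "F (g y) = y" if "y \<in> B'" for y
      using homeomorphism_image2[OF F] homeomorphism_apply2[OF F] that by blast+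
    have contg: "continuous_on B' g" using F by (rule homeomorphism_cont2)
    have DB: "D \<subseteq> B'" using e(2) by (auto simp: D_def)
    have "connected D" unfolding D_def by (intro convex_connected convex_Int) auto
    then have conn: "connected (g ` D)"
      by (rule connected_continuous_image[rotated]) (rule continuous_on_subset[OF contg DB])
    have nz: "u $ 2 \<noteq> 0" if "u \<in> g ` D" for u
    proof
      assume 0: "u $ 2 = 0"
      obtain y where y: "y \<in> D" "u = g y" using \<open>u \<in> g ` D\<close> by blast
      then have "norm (F u) = 1" using circle[of u] gin[of y] DB 0 by auto
      then show False using y Fg[of y] DB by (auto simp: D_def)
    qed
    have "\<exists>u\<in>g ` D. 0 < u $ 2"
    proof -
      have "open (F -` ball (F u0) e \<inter> ball u0 \<sigma>)"
        using continuous_open_preimage[OF homeomorphism_cont1[OF F] open_ball open_ball, of "F u0" e]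
        by (simp add: Int_commute)
      moreover have "u0 \<in> F -` ball (F u0) e \<inter> ball u0 \<sigma>" using e(1) \<sigma> by simp
      ultimately obtain s where s: "s > 0" "ball u0 s \<subseteq> F -` ball (F u0) e \<inter> ball u0 \<sigma>" by (rule openE)
      \<comment> \<open>A small step inward from the boundary point; half the radius keeps it inside
        the ball.\<close>
      define u where "u = u0 + (s/2) *\<^sub>R axis 2 1"
      have "u \<in> ball u0 s" using s(1) by (simp add: u_def dist_norm norm_axis_1)
      then have u: "u \<in> ball u0 \<sigma>" "F u \<in> ball (F u0) e" using s(2) by auto
      have u2: "0 < u $ 2" using s(1) True by (simp add: u_def)
      have "F u \<in> D" using u interior[OF u(1) u2] by (simp add: D_def)
      moreover have "g (F u) = u" using homeomorphism_apply1[OF F u(1)] .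
      ultimately show ?thesis using u2 by (metis imageI)
    qed
    then obtain a where a: "a \<in> g ` D" "0 < a $ 2" by blast
    have pos: "0 < u $ 2" if u: "u \<in> g ` D" for u
    proof (rule ccontr)
      assume "\<not> 0 < u $ 2"
      then have "u $ 2 \<le> 0" by simp
      then obtain w where "w \<in> g ` D" "w $ 2 = 0"
        using connected_ivt_component_cart[OF conn u a(1), of 2 0] a(2) by (meson less_imp_le)
      then show False using nz by blast
    qed
    have "y \<in> F ` (ball u0 \<sigma> \<inter> half_plane)" if y: "y \<in> ball (F u0) e \<inter> cball 0 1" for y
    proof -
      have yB: "y \<in> B'" using y e(2) by auto
      \<comment> \<open>The open ball around \<open>F u0\<close> meets the closed unit ball only in
        limit points of \<open>D\<close>, so the weak inequality for the second component of
        \<open>g\<close> passes to the limit.\<close>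
      have "y \<in> closure D"
        using y open_Int_closure_subset[of "ball (F u0) e" "ball 0 1"] unfolding D_def by auto
      have "0 \<le> g y $ 2"
      proof -
        have "closedin (top_of_set B') (B' \<inter> (\<lambda>y. g y $ 2) -` {0..})"
          by (rule continuous_closedin_preimage[OF _ closed_atLeast]) (intro continuous_intros contg)
        then obtain K where K: "closed K" "B' \<inter> (\<lambda>y. g y $ 2) -` {0..} = B' \<inter> K"
          by (auto simp: closedin_closed)
        have "D \<subseteq> K" using K(2) DB pos by (force intro: less_imp_le)
        then have "y \<in> K" using \<open>y \<in> closure D\<close> K(1) closure_minimal by blast
        then show ?thesis using K(2) yB by auto
      qed
      then show ?thesis using Fg[OF yB] gin[OF yB] by (metis IntI half_plane_def image_eqI mem_Collect_eq)
    qed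
    then show ?thesis using e(1) by blast
  qed
qed

section \<open>The global argument: tangency everywhere, one common plane, and the disc\<close>

locale free_boundary_minimal_lagrangian =
  fixes S :: "'p topology" and \<A> :: "'p chart set" and x :: "'p \<Rightarrow> complex^2"
  assumes surface: "smooth_surface S \<A>" and compact: "compact_space S" and connected: "connected_space S"
    and boundary: "surface_boundary \<A> \<noteq> {}"
    and imm: "immersion \<A> x" and ball: "x ` topspace S \<subseteq> cball 0 1"
    and min: "minimal \<A> x" and lag: "lagrangian \<A> x"
    and free_boundary: "legendrian_free_boundary \<A> x"
begin

definition chart_at :: "'p \<Rightarrow> 'p chart"
  where "chart_at p = (SOME c. c \<in> \<A> \<and> p \<in> fst c)"

lemma chart_at: "p \<in> topspace S \<Longrightarrow> chart_at p \<in> \<A> \<and> p \<in> fst (chart_at p)"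
proof -
  assume "p \<in> topspace S"
  then have "p \<in> (\<Union>c\<in>\<A>. fst c)" using surface by (simp add: smooth_surface_def)
  then have "\<exists>c. c \<in> \<A> \<and> p \<in> fst c" by blast
  then show ?thesis unfolding chart_at_def by (rule someI_ex)
qed

definition tangent_at :: "'p \<Rightarrow> (complex^2) set"
  where "tangent_at p = tangent_plane (chart_at p) x p"

lemma chart_subset:
  assumes "c \<in> \<A>" "p \<in> fst c" shows "p \<in> topspace S"
  using openin_subset[OF smooth_surface_chart(1)[OF surface assms(1)]] assms(2) by blast

lemma tangent_at_eq:
  assumes "c \<in> \<A>" "p \<in> fst c" shows "tangent_at p = tangent_plane c x p"
  unfolding tangent_at_def using chart_at[OF chart_subset[OF assms]] assms
  by (elim conjE) (rule tangent_plane_chart_independent[OF surface imm])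

lemma patch:
  assumes c: "c \<in> \<A>" "p \<in> fst c"
  obtains Y Y' Y'' \<rho> where "\<rho> > 0" "\<And>r. 0 < r \<Longrightarrow> r \<le> \<rho> \<Longrightarrow> minimal_lagrangian_patch Y Y' Y'' (snd c p) r"
    "\<And>u. u \<in> ball (snd c p) \<rho> \<inter> half_plane \<Longrightarrow> u \<in> snd c ` fst c"
    "\<And>q. q \<in> fst c \<Longrightarrow> snd c q \<in> ball (snd c p) \<rho> \<Longrightarrow> x q = Y (snd c q)"
    "\<And>q. q \<in> fst c \<Longrightarrow> snd c q \<in> ball (snd c p) \<rho> \<Longrightarrow> tangent_at q = range (Y' (snd c q))"
proof -
  obtain Y Y' Y'' \<rho> where Y: "\<rho> > 0" "\<And>r. 0 < r \<Longrightarrow> r \<le> \<rho> \<Longrightarrow> minimal_lagrangian_patch Y Y' Y'' (snd c p) r"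
    "\<And>u. u \<in> ball (snd c p) \<rho> \<inter> half_plane \<Longrightarrow> u \<in> coord_image c"
    "\<And>q. q \<in> fst c \<Longrightarrow> snd c q \<in> ball (snd c p) \<rho> \<Longrightarrow> x q = Y (snd c q)"
    "\<And>q. q \<in> fst c \<Longrightarrow> snd c q \<in> ball (snd c p) \<rho> \<Longrightarrow> tangent_plane c x q = range (Y' (snd c q))"
    by (rule minimal_lagrangian_local_patch[OF surface imm min lag c]) (rule that)
  show ?thesis
    by (rule that[OF Y(1,2)]) (use Y(3-5) tangent_at_eq[OF c(1)] in \<open>auto simp: coord_image_def simp del: mem_ball\<close>)
qed

lemma in_half_plane:
  assumes "c \<in> \<A>" "q \<in> fst c" shows "snd c q \<in> half_plane"
proof -
  have "coord_image c \<subseteq> half_plane" using openin_subset[OF smooth_surface_chart(2)[OF surface assms(1)]] by simp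
  then show ?thesis using assms(2) unfolding coord_image_def by blast
qed

lemma openin_chart_ball:
  assumes "c \<in> \<A>" "open N" shows "openin S {q \<in> fst c. snd c q \<in> N}"
proof -
  have "openin S {q \<in> fst c. snd c q \<in> half_plane \<inter> N}"
    by (rule smooth_surface_chart(5)[OF surface assms(1)]) (simp add: openin_open_Int assms(2))
  moreover have "{q \<in> fst c. snd c q \<in> half_plane \<inter> N} = {q \<in> fst c. snd c q \<in> N}"
    using in_half_plane[OF assms(1)] by auto
  ultimately show ?thesis by simp
qed

text \<open>Tangency is required on a neighbourhood: the set is then open by construction, and its
  closure points supply the open seeds that unique continuation asks for.\<close>

definition tangency_locus :: "'p set"
  where "tangency_locus = {p. \<exists>N. openin S N \<and> p \<in> N \<and> (\<forall>q\<in>N. x q \<in> tangent_at q)}"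

lemma openin_tangency_locus: "openin S tangency_locus"
proof (subst openin_subopen, rule ballI)
  fix p assume "p \<in> tangency_locus"
  then obtain N where N: "openin S N" "p \<in> N" "\<forall>q\<in>N. x q \<in> tangent_at q" unfolding tangency_locus_def by blast
  then have "N \<subseteq> tangency_locus" unfolding tangency_locus_def by blast
  then show "\<exists>N. openin S N \<and> p \<in> N \<and> N \<subseteq> tangency_locus" using N by blast
qed

text \<open>At an interior point an open seed comes from nearby points of the locus; at a boundary
  point the lower half disc serves, which is why accumulation is demanded only off the boundary
  line.\<close>

lemma in_tangency_locus_if_accumulated:
  assumes c: "c \<in> \<A>" "p \<in> fst c"
    and acc: "snd c p $ 2 \<noteq> 0 \<Longrightarrow> p \<in> S closure_of tangency_locus"
  shows "p \<in> tangency_locus"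
proof -
  let ?u0 = "snd c p"
  obtain Y Y' Y'' \<rho> where Y: "\<rho> > 0" "\<And>r. 0 < r \<Longrightarrow> r \<le> \<rho> \<Longrightarrow> minimal_lagrangian_patch Y Y' Y'' ?u0 r"
    "\<And>u. u \<in> ball ?u0 \<rho> \<inter> half_plane \<Longrightarrow> u \<in> snd c ` fst c"
    "\<And>q. q \<in> fst c \<Longrightarrow> snd c q \<in> ball ?u0 \<rho> \<Longrightarrow> x q = Y (snd c q)"
    "\<And>q. q \<in> fst c \<Longrightarrow> snd c q \<in> ball ?u0 \<rho> \<Longrightarrow> tangent_at q = range (Y' (snd c q))"
    by (rule patch[OF c]) (rule that)
  have u0: "?u0 \<in> half_plane" using in_half_plane[OF c] .
  \<comment> \<open>For a point off the boundary line, the radius is at most its height, so the disc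
    lies in the open upper half-plane.\<close>
  define r where "r = (if ?u0 $ 2 = 0 then \<rho> else min \<rho> (?u0 $ 2))"
  have r: "0 < r" "r \<le> \<rho>" using Y(1) u0 by (auto simp: r_def half_plane_def)
  interpret minimal_lagrangian_patch Y Y' Y'' ?u0 r by (rule Y(2)[OF r])
  have up: "0 < u $ 2" if "u \<in> ball ?u0 r" "?u0 $ 2 \<noteq> 0" for u
  proof -
    have "\<bar>(?u0 - u) $ 2\<bar> \<le> norm (?u0 - u)" by (rule component_le_norm_cart)
    also have "\<dots> < ?u0 $ 2" using that by (simp add: dist_norm r_def)
    finally show ?thesis by simp
  qed
  have bdry: "Y u \<in> range (Y' u)" if u: "u \<in> ball ?u0 r" "u $ 2 = 0" for u
  proof -
    have "u \<in> ball ?u0 \<rho> \<inter> half_plane" using u r by (auto simp: half_plane_def)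
    then obtain q where q: "q \<in> fst c" "snd c q = u" using Y(3) by blast
    have "x q \<in> tangent_at q"
      using position_tangent_on_boundary(1)[OF surface imm free_boundary c(1) q(1)] q u tangent_at_eq[OF c(1) q(1)] by simp
    then show ?thesis using Y(4,5)[OF q(1)] q u r by auto
  qed
  have "\<exists>N. open N \<and> N \<noteq> {} \<and> N \<subseteq> ball ?u0 \<delta> \<and> (\<forall>u\<in>N \<inter> half_plane. Y u \<in> range (Y' u))" if \<delta>: "\<delta> > 0" for \<delta>
  proof (cases "?u0 $ 2 = 0")
    case True
    \<comment> \<open>The condition is vacuous here because the set misses the half-plane; the
      extension by zero supplies the zeros.\<close>
    let ?N = "ball ?u0 \<delta> \<inter> {u. u $ 2 < 0}"
    have "open ?N" by (intro open_Int open_ball open_halfspace_component_lt_cart)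
    have "?u0 - (\<delta>/2) *\<^sub>R axis 2 1 \<in> ?N"
      using True \<open>\<delta> > 0\<close> by (simp add: dist_norm norm_axis_1)
    then have "?N \<noteq> {}" by blast
    moreover have "?N \<inter> half_plane = {}" by (auto simp: half_plane_def)
    ultimately show ?thesis using \<open>open ?N\<close> by (intro exI[of _ ?N]) blast
  next
    case False
    define s where "s = min \<delta> r"
    have s: "s > 0" "s \<le> \<delta>" "s \<le> r" using \<open>\<delta> > 0\<close> r by (auto simp: s_def)
    define A where "A = {q \<in> fst c. snd c q \<in> ball ?u0 s}"
    have A: "openin S A" "p \<in> A"
      unfolding A_def using openin_chart_ball[OF c(1) open_ball] c s by simp_all
    have "\<forall>N. p \<in> N \<and> openin S N \<longrightarrow> (\<exists>y. y \<in> tangency_locus \<and> y \<in> N)"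
      using acc[OF False] by (simp add: in_closure_of)
    then obtain q where q: "q \<in> tangency_locus" "q \<in> A" using A by blast
    obtain N' where N': "openin S N'" "q \<in> N'" "\<forall>a\<in>N'. x a \<in> tangent_at a" using q(1) by (auto simp: tangency_locus_def)
    define M where "M = N' \<inter> A"
    have "openin S M" unfolding M_def by (intro openin_Int N'(1) A(1))
    then have "openin (top_of_set half_plane) (snd c ` M)"
      by (rule smooth_surface_chart(4)[OF surface c(1)]) (auto simp: M_def A_def)
    then obtain K where K: "open K" "snd c ` M = half_plane \<inter> K" by (auto simp: openin_open)
    let ?N = "K \<inter> ball ?u0 s"
    have sub: "?N \<subseteq> snd c ` M"
    proof
      fix u assume u: "u \<in> ?N"
      then have "0 < u $ 2" using up[of u] False s by auto
      then show "u \<in> snd c ` M" using K(2) u by (auto simp: half_plane_def)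
    qed
    have "Y u \<in> range (Y' u)" if "u \<in> ?N" for u
    proof -
      obtain a where a: "a \<in> M" "u = snd c a" using sub \<open>u \<in> ?N\<close> by blast
      then have "x a \<in> tangent_at a" "a \<in> fst c" "snd c a \<in> ball ?u0 \<rho>" using N'(3) s r by (auto simp: M_def A_def)
      then show ?thesis using Y(4,5)[of a] a(2) by auto
    qed
    moreover have "snd c q \<in> ?N" using imageI[of q M "snd c"] K(2) q N'(2) by (auto simp: M_def A_def)
    moreover have "open ?N" using K(1) by auto
    ultimately show ?thesis using s by (intro exI[of _ ?N]) auto
  qed
  from tangent_position_propagates[OF bdry this]
  obtain d where d: "d > 0" "d \<le> r" "\<forall>u\<in>ball ?u0 d \<inter> half_plane. Y u \<in> range (Y' u)" by blast
  have "x q \<in> tangent_at q" if "q \<in> fst c" "snd c q \<in> ball ?u0 d" for q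
    using Y(4,5)[OF that(1)] d r that in_half_plane[OF c(1) that(1)] by auto
  then have "\<forall>q\<in>{q \<in> fst c. snd c q \<in> ball ?u0 d}. x q \<in> tangent_at q" by blast
  moreover have "openin S {q \<in> fst c. snd c q \<in> ball ?u0 d}" by (rule openin_chart_ball[OF c(1) open_ball])
  moreover have "p \<in> {q \<in> fst c. snd c q \<in> ball ?u0 d}" using c d by simp
  ultimately show ?thesis unfolding tangency_locus_def by blast
qed

text \<open>The locus is clopen in a connected space, and any boundary point shows that it is
  nonempty.\<close>

lemma tangency_locus_eq: "tangency_locus = topspace S"
proof -
  have "closedin S tangency_locus"
  proof -
    have "S closure_of tangency_locus \<subseteq> tangency_locus"
    proof
      fix p assume p: "p \<in> S closure_of tangency_locus"
      then have "p \<in> topspace S" by (simp add: in_closure_of)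
      then show "p \<in> tangency_locus" using in_tangency_locus_if_accumulated[of "chart_at p" p] chart_at p by blast
    qed
    then show ?thesis using closure_of_subset_eq[of tangency_locus S] openin_subset[OF openin_tangency_locus] by blast
  qed
  moreover obtain p c where "c \<in> \<A>" "p \<in> fst c" "snd c p $ 2 = 0"
    using boundary by (auto simp: surface_boundary_def)
  then have "p \<in> tangency_locus" by (intro in_tangency_locus_if_accumulated) auto
  ultimately show ?thesis
    using connected openin_tangency_locus connected_space_clopen_in by blast
qed

lemma tangent_at_locally_constant:
  assumes p: "p \<in> topspace S"
  shows "\<exists>N. openin S N \<and> p \<in> N \<and> (\<forall>q\<in>N. tangent_at q = tangent_at p)"
proof -
  define c where "c = chart_at p"
  have c: "c \<in> \<A>" "p \<in> fst c" using chart_at[OF p] by (auto simp: c_def)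
  let ?u0 = "snd c p"
  obtain Y Y' Y'' \<rho> where Y: "\<rho> > 0" "\<And>r. 0 < r \<Longrightarrow> r \<le> \<rho> \<Longrightarrow> minimal_lagrangian_patch Y Y' Y'' ?u0 r"
    "\<And>u. u \<in> ball ?u0 \<rho> \<inter> half_plane \<Longrightarrow> u \<in> snd c ` fst c"
    "\<And>q. q \<in> fst c \<Longrightarrow> snd c q \<in> ball ?u0 \<rho> \<Longrightarrow> x q = Y (snd c q)"
    "\<And>q. q \<in> fst c \<Longrightarrow> snd c q \<in> ball ?u0 \<rho> \<Longrightarrow> tangent_at q = range (Y' (snd c q))"
    by (rule patch[OF c]) (rule that)
  interpret minimal_lagrangian_patch Y Y' Y'' ?u0 \<rho> by (rule Y(2)[OF Y(1) order_refl])
  have "Y u \<in> range (Y' u)" if u: "u \<in> ball ?u0 \<rho> \<inter> half_plane" for u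
  proof -
    obtain q where q: "q \<in> fst c" "snd c q = u" using Y(3)[OF u] by blast
    then have "q \<in> tangency_locus" using tangency_locus_eq chart_subset[OF c(1)] by blast
    then have "x q \<in> tangent_at q" by (auto simp: tangency_locus_def)
    then show ?thesis using Y(4,5)[OF q(1)] q u by auto
  qed
  from tangent_plane_constant_if_tangent_position[OF Y(1) this]
  obtain s where s: "s > 0" "s \<le> \<rho>" "\<forall>u\<in>ball ?u0 s \<inter> half_plane. range (Y' u) = range (Y' ?u0)" by blast
  have "tangent_at q = tangent_at p" if "q \<in> fst c" "snd c q \<in> ball ?u0 s" for q
    using Y(5)[OF that(1)] Y(5)[OF c(2)] s(1,2) bspec[OF s(3), of "snd c q"] that in_half_plane[OF c(1) that(1)] Y(1)
    by simp
  moreover have "openin S {q \<in> fst c. snd c q \<in> ball ?u0 s}" by (rule openin_chart_ball[OF c(1) open_ball])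
  moreover have "p \<in> {q \<in> fst c. snd c q \<in> ball ?u0 s}" using c s by simp
  ultimately show ?thesis by (intro exI[of _ "{q \<in> fst c. snd c q \<in> ball ?u0 s}"]) blast
qed

lemma equatorial_disc:
  "S homeomorphic_space top_of_set (cball (0::real^2) 1) \<and>
    (\<exists>P :: (complex^2) set. subspace P \<and> dim P = 2 \<and> x ` topspace S = P \<inter> cball 0 1)"
proof -
  obtain p0 where p0: "p0 \<in> topspace S"
    using boundary chart_subset by (auto simp: surface_boundary_def)
  define P where "P = tangent_at p0"
  have TP: "tangent_at p = P" if "p \<in> topspace S" for p
    unfolding P_def by (rule locally_constant_on_connected_space[OF connected that p0 tangent_at_locally_constant])
  have xP: "x p \<in> P" if "p \<in> topspace S" for p
    using that TP[OF that] tangency_locus_eq by (auto simp: tangency_locus_def)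
  have P: "subspace P" "dim P = 2"
  proof -
    define c where "c = chart_at p0"
    have c: "c \<in> \<A>" "p0 \<in> fst c" using chart_at[OF p0] by (auto simp: c_def)
    obtain Y Y' Y'' \<rho> where Y: "\<rho> > 0" "\<And>r. 0 < r \<Longrightarrow> r \<le> \<rho> \<Longrightarrow> minimal_lagrangian_patch Y Y' Y'' (snd c p0) r"
      "\<And>u. u \<in> ball (snd c p0) \<rho> \<inter> half_plane \<Longrightarrow> u \<in> snd c ` fst c"
      "\<And>q. q \<in> fst c \<Longrightarrow> snd c q \<in> ball (snd c p0) \<rho> \<Longrightarrow> x q = Y (snd c q)"
      "\<And>q. q \<in> fst c \<Longrightarrow> snd c q \<in> ball (snd c p0) \<rho> \<Longrightarrow> tangent_at q = range (Y' (snd c q))"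
      by (rule patch[OF c]) (rule that)
    interpret minimal_lagrangian_patch Y Y' Y'' "snd c p0" \<rho> by (rule Y(2)[OF Y(1) order_refl])
    have lin: "linear (Y' (snd c p0))" and inj: "inj (Y' (snd c p0))"
      using linear_Y' minimal_lagrangian_patch.immersed[OF Y(2)[OF Y(1) order_refl]] Y(1) in_half_plane[OF c] by auto
    have eq: "P = range (Y' (snd c p0))" using Y(5)[OF c(2)] Y(1) by (simp add: P_def)
    show "subspace P" unfolding eq using linear_subspace_image[OF lin subspace_UNIV] .
    show "dim P = 2" unfolding eq using dim_image_eq[OF lin, of UNIV] inj by (simp add: dim_UNIV)
  qed
  have "dim P = dim (UNIV :: (real^2) set)" using P(2) by (simp add: dim_UNIV)
  \<comment> \<open>A linear isometry identifies the plane with \<open>real^2\<close>, so that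
    \<open>f\<close> becomes a map between planes and the target is the standard disc.\<close>
  then obtain L :: "complex^2 \<Rightarrow> real^2" and M where L: "linear L" "linear M" "L ` P = UNIV" "M ` UNIV = P"
    "\<And>v. v \<in> P \<Longrightarrow> norm (L v) = norm v" "\<And>v. v \<in> P \<Longrightarrow> M (L v) = v" "\<And>w. L (M w) = w" "\<And>w. norm (M w) = norm w"
    using isometries_subspaces[OF P(1) subspace_UNIV] by (metis UNIV_I)
  have bL: "bounded_linear L" using L(1) by (simp add: linear_conv_bounded_linear)
  define f where "f p = L (x p)" for p
  have norm_f: "norm (f p) = norm (x p)" if "p \<in> topspace S" for p
    using L(5) xP[OF that] by (simp add: f_def)
  have fD: "f ` topspace S \<subseteq> cball 0 1" using norm_f ball by auto
  \<comment> \<open>In a chart, \<open>f\<close> is the restriction of \<open>L \<circ> Y\<close>,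
    which is a homeomorphism of open planar sets because \<open>Y'\<close> at the point has range
    \<open>P\<close> and \<open>L\<close> is injective on \<open>P\<close>.\<close>
  have local_f: "\<exists>F g W B'. open W \<and> snd c p \<in> W \<and> open B' \<and> homeomorphism W B' F g \<and>
      (\<forall>q\<in>fst c. snd c q \<in> W \<longrightarrow> f q = F (snd c q)) \<and> W \<inter> half_plane \<subseteq> snd c ` fst c"
    if c: "c \<in> \<A>" "p \<in> fst c" for c p
  proof -
    let ?u0 = "snd c p"
    obtain Y Y' Y'' \<rho> where Y: "\<rho> > 0" "\<And>r. 0 < r \<Longrightarrow> r \<le> \<rho> \<Longrightarrow> minimal_lagrangian_patch Y Y' Y'' ?u0 r"
      "\<And>u. u \<in> ball ?u0 \<rho> \<inter> half_plane \<Longrightarrow> u \<in> snd c ` fst c"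
      "\<And>q. q \<in> fst c \<Longrightarrow> snd c q \<in> ball ?u0 \<rho> \<Longrightarrow> x q = Y (snd c q)"
      "\<And>q. q \<in> fst c \<Longrightarrow> snd c q \<in> ball ?u0 \<rho> \<Longrightarrow> tangent_at q = range (Y' (snd c q))"
      by (rule patch[OF c]) (rule that)
    interpret patch: minimal_lagrangian_patch Y Y' Y'' ?u0 \<rho> by (rule Y(2)[OF Y(1) order_refl])
    have u0B: "?u0 \<in> ball ?u0 \<rho>" using Y(1) by simp
    have range: "range (Y' ?u0) = P" using Y(5)[OF c(2) u0B] TP[OF chart_subset[OF c]] by simp
    have inj: "inj (\<lambda>v. L (Y' ?u0 v))"
    proof (rule injI)
      fix v w assume "L (Y' ?u0 v) = L (Y' ?u0 w)"
      then have "M (L (Y' ?u0 v)) = M (L (Y' ?u0 w))" by simp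
      then have "Y' ?u0 v = Y' ?u0 w" using L(6) range by (metis rangeI)
      then show "v = w" using patch.immersed[of ?u0] u0B in_half_plane[OF c] by (simp add: inj_eq)
    qed
    have contL: "continuous_on (ball ?u0 \<rho>) (\<lambda>u. L (Y' u v))" for v
    proof (rule continuous_at_imp_continuous_on, rule ballI)
      fix u assume "u \<in> ball ?u0 \<rho>"
      from has_derivative_continuous[OF bounded_linear.has_derivative[OF bL patch.dY'[OF this]]]
      show "isCont (\<lambda>u. L (Y' u v)) u" .
    qed
    obtain W B' g where W: "open W" "W \<subseteq> ball ?u0 \<rho>" "?u0 \<in> W" "open B'" "homeomorphism W B' (\<lambda>u. L (Y u)) g"
      by (rule inverse_function_directional[OF _ open_ball u0B bounded_linear.has_derivative[OF bL patch.dY] contL inj])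
        (simp, assumption, blast)
    then show ?thesis
      using Y(3,4) by (intro exI[of _ "\<lambda>u. L (Y u)"] exI[of _ g] exI[of _ W] exI[of _ B'])
        (auto simp: f_def simp del: mem_ball)
  qed
  have cont_f: "continuous_map S euclidean f"
    unfolding continuous_map_def
  proof (intro conjI allI impI)
    fix O' :: "(real^2) set" assume "openin euclidean O'"
    then have O': "open O'" by simp
    show "openin S {p \<in> topspace S. f p \<in> O'}"
    proof (subst openin_subopen, clarify)
      fix p assume p: "p \<in> topspace S" "f p \<in> O'"
      define c where "c = chart_at p"
      have c: "c \<in> \<A>" "p \<in> fst c" using chart_at[OF p(1)] by (auto simp: c_def)
      obtain F g W B' where W: "open W" "snd c p \<in> W" "homeomorphism W B' F g"
        "\<forall>q\<in>fst c. snd c q \<in> W \<longrightarrow> f q = F (snd c q)" using local_f[OF c] by blast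
      have "open (W \<inter> F -` O')"
        by (rule continuous_open_preimage[OF homeomorphism_cont1[OF W(3)] W(1) O'])
      then have "openin S {q \<in> fst c. snd c q \<in> W \<inter> F -` O'}" by (rule openin_chart_ball[OF c(1)])
      then show "\<exists>N. openin S N \<and> p \<in> N \<and> N \<subseteq> {p \<in> topspace S. f p \<in> O'}"
        using c W(2,4) p(2) chart_subset[OF c(1)]
        by (intro exI[of _ "{q \<in> fst c. snd c q \<in> W \<inter> F -` O'}"]) auto
    qed
  qed auto
  have inj_f: "\<exists>U. openin S U \<and> p \<in> U \<and> inj_on f U" if p: "p \<in> topspace S" for p
  proof -
    define c where "c = chart_at p"
    have c: "c \<in> \<A>" "p \<in> fst c" using chart_at[OF p] by (auto simp: c_def)
    obtain F g W B' where W: "open W" "snd c p \<in> W" "homeomorphism W B' F g"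
      "\<forall>q\<in>fst c. snd c q \<in> W \<longrightarrow> f q = F (snd c q)" using local_f[OF c] by blast
    have "inj_on f {q \<in> fst c. snd c q \<in> W}"
    proof (rule inj_onI)
      fix a b assume ab: "a \<in> {q \<in> fst c. snd c q \<in> W}" "b \<in> {q \<in> fst c. snd c q \<in> W}" "f a = f b"
      then have "F (snd c a) = F (snd c b)" using W(4) by auto
      then have "snd c a = snd c b" using homeomorphism_apply1[OF W(3)] ab by (metis (mono_tags, lifting) mem_Collect_eq)
      then show "a = b" using smooth_surface_chart(3)[OF surface c(1)] ab by (auto dest: inj_onD)
    qed
    then show ?thesis using openin_chart_ball[OF c(1) W(1)] c W(2)
      by (intro exI[of _ "{q \<in> fst c. snd c q \<in> W}"]) auto
  qed
  \<comment> \<open>Openness relative to the closed disc includes boundary points: there |x| = 1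
    along the boundary line and |x| \<le> 1 elsewhere confine the half disc to the correct side of
    the circle.\<close>
  have open_f: "openin (top_of_set (cball 0 1)) (f ` U)" if U: "openin S U" for U
  proof -
    have "\<exists>e>0. ball (f p) e \<inter> cball 0 1 \<subseteq> f ` U" if p: "p \<in> U" for p
    proof -
      have pS: "p \<in> topspace S" using p openin_subset[OF U] by blast
      define c where "c = chart_at p"
      have c: "c \<in> \<A>" "p \<in> fst c" using chart_at[OF pS] by (auto simp: c_def)
      let ?u0 = "snd c p"
      obtain F g W B' where W: "open W" "?u0 \<in> W" "open B'" "homeomorphism W B' F g"
        "\<forall>q\<in>fst c. snd c q \<in> W \<longrightarrow> f q = F (snd c q)" "W \<inter> half_plane \<subseteq> snd c ` fst c"
        using local_f[OF c] by blast
      have "openin (top_of_set half_plane) (snd c ` (U \<inter> fst c))"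
        by (rule smooth_surface_chart(4)[OF surface c(1)])
          (auto intro: openin_Int U smooth_surface_chart(1)[OF surface c(1)])
      then obtain r1 where r1: "r1 > 0" "ball ?u0 r1 \<inter> half_plane \<subseteq> snd c ` (U \<inter> fst c)"
        unfolding openin_contains_ball using p c(2) by blast
      obtain r2 where r2: "r2 > 0" "ball ?u0 r2 \<subseteq> W" using W(1,2) by (rule openE)
      define \<sigma> where "\<sigma> = min r1 r2"
      have \<sigma>: "\<sigma> > 0" "ball ?u0 \<sigma> \<inter> half_plane \<subseteq> snd c ` (U \<inter> fst c)" "ball ?u0 \<sigma> \<subseteq> W"
        using r1 r2 by (auto simp: \<sigma>_def)
      have op: "open (F ` N)" if "open N" "N \<subseteq> W" for N
      proof -
        have "openin (top_of_set B') (F ` N)"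
          using homeomorphism_imp_open_map[OF W(4), of N] that by (simp add: open_subset)
        then show ?thesis using W(3) openin_open_trans by blast
      qed
      have h: "homeomorphism (ball ?u0 \<sigma>) (F ` ball ?u0 \<sigma>) F g"
        by (rule homeomorphism_of_subsets[OF W(4) \<sigma>(3), of B']) auto
      have ex_q: "\<exists>q. q \<in> U \<inter> fst c \<and> snd c q = u \<and> f q = F u" if u: "u \<in> ball ?u0 \<sigma> \<inter> half_plane" for u
      proof -
        obtain q where "q \<in> U \<inter> fst c" "snd c q = u" using \<sigma>(2) u by blast
        then show ?thesis using W(5) \<sigma>(3) u by blast
      qed
      have "\<exists>e>0. ball (F ?u0) e \<inter> cball 0 1 \<subseteq> F ` (ball ?u0 \<sigma> \<inter> half_plane)"
      proof (rule half_disc_image_contains_relative_ball[OF h op[OF open_ball \<sigma>(3)] \<sigma>(1) in_half_plane[OF c]])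
        show "open (F ` N)" if "open N" "N \<subseteq> ball ?u0 \<sigma>" for N using op[of N] that \<sigma>(3) by blast
        show "norm (F u) \<le> 1" if u: "u \<in> ball ?u0 \<sigma> \<inter> half_plane" for u
        proof -
          obtain q where q: "q \<in> fst c" "f q = F u" using ex_q[OF u] by blast
          then show ?thesis using fD chart_subset[OF c(1) q(1)] by (metis image_subset_iff mem_cball_0)
        qed
        show "norm (F u) = 1" if u: "u \<in> ball ?u0 \<sigma>" "u $ 2 = 0" for u
        proof -
          have "u \<in> ball ?u0 \<sigma> \<inter> half_plane" using u by (simp add: half_plane_def)
          then obtain q where q: "q \<in> fst c" "snd c q = u" "f q = F u" using ex_q by blast
          then have "norm (x q) = 1"
            using position_tangent_on_boundary(2)[OF surface imm free_boundary c(1) q(1)] u by simp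
          then show ?thesis using norm_f[OF chart_subset[OF c(1) q(1)]] q(3) by simp
        qed
      qed
      then obtain e where e: "e > 0" "ball (F ?u0) e \<inter> cball 0 1 \<subseteq> F ` (ball ?u0 \<sigma> \<inter> half_plane)" by blast
      have "F ` (ball ?u0 \<sigma> \<inter> half_plane) \<subseteq> f ` U"
      proof
        fix y assume "y \<in> F ` (ball ?u0 \<sigma> \<inter> half_plane)"
        then obtain u where u: "u \<in> ball ?u0 \<sigma> \<inter> half_plane" "y = F u" by blast
        then show "y \<in> f ` U" using ex_q[OF u(1)] by (metis IntD1 imageI)
      qed
      then have "ball (F ?u0) e \<inter> cball 0 1 \<subseteq> f ` U" using e(2) by (rule subset_trans[rotated])
      moreover have "f p = F ?u0" using W(2,5) c(2) by blast
      ultimately show ?thesis using e(1) by (intro exI[of _ e]) simp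
    qed
    moreover have "f ` U \<subseteq> cball 0 1" using openin_subset[OF U] fD by blast
    ultimately show ?thesis unfolding openin_contains_ball by blast
  qed
  have homeo: "homeomorphic_map S (top_of_set (cball 0 1)) f"
  proof (rule homeomorphic_map_of_local_homeomorphism_onto_ball[OF compact _ connected _ cont_f fD open_f inj_f])
    show "Hausdorff_space S" using surface by (simp add: smooth_surface_def)
    show "topspace S \<noteq> {}" using p0 by blast
  qed
  have "f ` topspace S = cball 0 1" using homeomorphic_imp_surjective_map[OF homeo] by simp
  then have "x ` topspace S = P \<inter> cball 0 1"
  proof -
    assume onto: "f ` topspace S = cball 0 1"
    have "v \<in> x ` topspace S" if v: "v \<in> P" "norm v \<le> 1" for v
    proof -
      have "L v \<in> f ` topspace S" using onto L(5)[OF v(1)] v(2) by simp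
      then obtain p where p: "p \<in> topspace S" "L v = L (x p)" by (auto simp: f_def)
      have "v = M (L v)" by (rule L(6)[OF v(1), symmetric])
      also have "\<dots> = x p" unfolding p(2) by (rule L(6)[OF xP[OF p(1)]])
      finally have "v = x p" .
      then show ?thesis using p(1) by blast
    qed
    then show ?thesis using xP ball by auto
  qed
  moreover have "S homeomorphic_space top_of_set (cball (0::real^2) 1)"
    using homeo homeomorphic_map_imp_homeomorphic_space by blast
  ultimately show ?thesis using P by blast
qed

end

theorem theorem3p1:
  fixes S :: "'p topology" and \<A> :: "'p chart set" and x :: "'p \<Rightarrow> complex^2"
  assumes "smooth_surface S \<A>" and "compact_space S" and "connected_space S"
    and "surface_boundary \<A> \<noteq> {}"
    and "immersion \<A> x" and "x ` topspace S \<subseteq> cball 0 1"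
    and "minimal \<A> x" and "lagrangian \<A> x"
    and "legendrian_free_boundary \<A> x"
  shows "S homeomorphic_space top_of_set (cball (0::real^2) 1) \<and>
    (\<exists>P :: (complex^2) set. subspace P \<and> dim P = 2 \<and> x ` topspace S = P \<inter> cball 0 1)"
proof -
  interpret free_boundary_minimal_lagrangian S \<A> x using assms by unfold_locales
  show ?thesis by (rule equatorial_disc)
qed

end
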